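(* Let $k\in\mathbb N$, $\nu>0$ and $f\in\mathcal B_k^{2+\nu}$ with domain $I=[0,1)$ such that $\int_{I}\frac{D^2f(x)}{Df(x)}dx=0$. Then there are constants $C>0$ and $0<\lambda<1$ such that for every $n\ge 0$ and every $\alpha\in\mathcal A$, $$d_{C^2}\big(\mathcal Z_{I_\alpha^n}(R^n(f)),\mathrm{Id}\big)\le C\lambda^{\sqrt n}.$$
   Context: Let $\mathcal A$ be a finite alphabet with $d\ge 2$ elements and $I$ a bounded interval. A generalized interval exchange map (g.i.e.m.) is a bijection $f:I\to I$ together with a partition $\{I_\alpha\}_{\alpha\in\mathcal A}$ of $I$ into nonempty intervals of the form $[a,b)$ such that each $f|_{I_\alpha}$ is an orientation-preserving homeomorphism onto an interval. For intervals $J,U$ write $J<U$ if their interiors are disjoint and $x<y$ for all $x\in J$, $y\in U$. The combinatorial data of $f$ are the bijections $\pi_0,\pi_1:\mathcal A\to\{1,\dots,d\}$ with $I_\alpha<I_\beta\iff\pi_0(\alpha)<\pi_0(\beta)$ and $f(I_\alpha)<f(I_\beta)\iff\pi_1(\alpha)<\pi_1(\beta)$; they are assumed irreducible: $\pi_1\circ\pi_0^{-1}(\{1,\dots,j\})\neq\{1,\dots,j\}$ for $1\le j<d$. Rauzy–Veech renormalization: let $\alpha(\varepsilon)=\pi_\varepsilon^{-1}(d)$, $\varepsilon\in\{0,1\}$. If $|I_{\alpha(0)}|>|f(I_{\alpha(1)})|$, $f$ has type 0, winner $\alpha(0)$, loser $\alpha(1)$, and $I^1=I\setminus f(I_{\alpha(1)})$,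 $I^1_\alpha=I_\alpha$ for $\alpha\ne\alpha(0)$, $I^1_{\alpha(0)}=I_{\alpha(0)}\setminus f(I_{\alpha(1)})$. If $|I_{\alpha(0)}|<|f(I_{\alpha(1)})|$, $f$ has type 1, winner $\alpha(1)$, loser $\alpha(0)$, and $I^1=I\setminus I_{\alpha(0)}$, $I^1_\alpha=I_\alpha$ for $\alpha\ne\alpha(0),\alpha(1)$, $I^1_{\alpha(1)}=f^{-1}(f(I_{\alpha(1)})\setminus I_{\alpha(0)})$, $I^1_{\alpha(0)}=I_{\alpha(1)}\setminus I^1_{\alpha(1)}$. The renormalization $R(f):I^1\to I^1$ is the first return map of $f$ to $I^1$, regarded as a g.i.e.m. with partition $\{I^1_\alpha\}$. $f$ is infinitely renormalizable if $R^n(f)$ is defined for all $n$. Write $f_n=R^n(f)$ ($f_0=f$), $I^n$ its domain ($I^0=I$), $\{I^n_\alpha\}$ its partition, $\varepsilon_n$ its type, $\alpha_n(\varepsilon_n)$ and $\alpha_n(1-\varepsilon_n)$ its winner and loser. $f$ has $k$-bounded combinatorics if it is infinitely renormalizable and for each $n$ and $\beta,\gamma\in\mathcal A$ there exist $n_1,p\ge 0$ with $|n-n_1|<k$, $|n-n_1-p|<k$, $\alpha_{n_1}(\varepsilon_{n_1})=\beta$, $\alpha_{n_1+p}(1-\varepsilon_{n_1+p})=\gamma$ and $\alpha_{n_1+i}(1-\varepsilon_{n_1+i})=\alpha_{n_1+i+1}(\varepsilon_{n_1+i+1})$ for $0\le i<p$. $f$ has no connection if $f^m(\partial I_\alpha)\ne\partial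 I_\beta$ for all $m\ge1$ and $\alpha,\beta$ with $\pi_0(\beta)\ne1$, where $\partial[a,b)=\{a\}$. $f$ has genus one if it has at most two discontinuities. $\mathcal B_k^{2+\nu}$ is the set of g.i.e.m. $f$ such that (i) each $f|_{I_\alpha}$ extends to $\overline{I_\alpha}$ as an orientation-preserving $C^{2+\nu}$ diffeomorphism onto its image; (ii) $f$ has $k$-bounded combinatorics; (iii) $f$ has genus one and no connection. The integral $\int_I\frac{D^2f}{Df}$ means $\sum_\alpha\int_{I_\alpha}\frac{D^2f}{Df}$. Zoom: for an interval $H$ and a diffeomorphism $g$ on $H$, $\mathcal Z_H(g)=A_1\circ g\circ A_2:[0,1]\to[0,1]$, where $A_2$ is the orientation-preserving affine map sending $[0,1]$ onto $H$ and $A_1$ the orientation-preserving affine map sending $g(H)$ onto $[0,1]$ (here $g=R^n(f)|_{\overline{I^n_\alpha}}$). $d_{C^2}(f,g)=\sum_{i=0}^2\sup_{x\in[0,1]}|D^if(x)-D^ig(x)|$. *)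

theory Defs
  imports "HOL-Analysis.Analysis"
begin

record 'a giem =
  gdom  :: "real set"
  gpart :: "'a \<Rightarrow> real set"
  gmap  :: "real \<Rightarrow> real"

definition ilt :: "real set \<Rightarrow> real set \<Rightarrow> bool" where
  "ilt J U \<longleftrightarrow> interior J \<inter> interior U = {} \<and> (\<forall>x\<in>J. \<forall>y\<in>U. x < y)"

definition ilen :: "real set \<Rightarrow> real" where
  "ilen J = Sup J - Inf J"

definition is_giem :: "('a::finite) giem \<Rightarrow> bool" where
  "is_giem T \<longleftrightarrow>
     (\<exists>a b. a < b \<and> gdom T = {a..<b}) \<and>
     (\<forall>\<alpha>. \<exists>l r. l < r \<and> gpart T \<alpha> = {l..<r}) \<and>
     (\<forall>\<alpha> \<beta>. \<alpha> \<noteq> \<beta> \<longrightarrow> gpart T \<alpha> \<inter> gpart T \<beta> = {}) \<and>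
     (\<Union>\<alpha>. gpart T \<alpha>) = gdom T \<and>
     bij_betw (gmap T) (gdom T) (gdom T) \<and>
     (\<forall>\<alpha>. continuous_on (gpart T \<alpha>) (gmap T) \<and> strict_mono_on (gpart T \<alpha>) (gmap T)
          \<and> is_interval (gmap T ` gpart T \<alpha>))"

definition pi0 :: "('a::finite) giem \<Rightarrow> 'a \<Rightarrow> nat" where
  "pi0 T = (THE \<pi>. bij_betw \<pi> UNIV {1..CARD('a)} \<and>
              (\<forall>\<alpha> \<beta>. ilt (gpart T \<alpha>) (gpart T \<beta>) \<longleftrightarrow> \<pi> \<alpha> < \<pi> \<beta>))"

definition pi1 :: "('a::finite) giem \<Rightarrow> 'a \<Rightarrow> nat" where
  "pi1 T = (THE \<pi>. bij_betw \<pi> UNIV {1..CARD('a)} \<and>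
              (\<forall>\<alpha> \<beta>. ilt (gmap T ` gpart T \<alpha>) (gmap T ` gpart T \<beta>) \<longleftrightarrow> \<pi> \<alpha> < \<pi> \<beta>))"

definition irreducible_comb :: "('a::finite) giem \<Rightarrow> bool" where
  "irreducible_comb T \<longleftrightarrow>
     (\<forall>j. 1 \<le> j \<and> j < CARD('a) \<longrightarrow> pi1 T ` {\<alpha>. pi0 T \<alpha> \<in> {1..j}} \<noteq> {1..j})"

definition alph :: "('a::finite) giem \<Rightarrow> nat \<Rightarrow> 'a" where
  "alph T e = (THE \<alpha>. (if e = 0 then pi0 T else pi1 T) \<alpha> = CARD('a))"

definition renormalizable :: "('a::finite) giem \<Rightarrow> bool" where
  "renormalizable T \<longleftrightarrow>
     ilen (gpart T (alph T 0)) \<noteq> ilen (gmap T ` gpart T (alph T 1))"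

definition gtype :: "('a::finite) giem \<Rightarrow> nat" where
  "gtype T = (if ilen (gpart T (alph T 0)) > ilen (gmap T ` gpart T (alph T 1)) then 0 else 1)"

definition winner :: "('a::finite) giem \<Rightarrow> 'a" where
  "winner T = alph T (gtype T)"

definition loser :: "('a::finite) giem \<Rightarrow> 'a" where
  "loser T = alph T (1 - gtype T)"

definition first_return :: "real set \<Rightarrow> (real \<Rightarrow> real) \<Rightarrow> real \<Rightarrow> real" where
  "first_return J f x = (f ^^ (LEAST m. 0 < m \<and> (f ^^ m) x \<in> J)) x"

definition RV :: "('a::finite) giem \<Rightarrow> 'a giem" where
  "RV T = (let a0 = alph T 0; a1 = alph T 1; I = gdom T; P = gpart T; f = gmap T;
               B = f ` P a1 in
           if ilen (P a0) > ilen B then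
             (let I1 = I - B in
               \<lparr>gdom = I1, gpart = P(a0 := P a0 - B), gmap = first_return I1 f\<rparr>)
           else
             (let I1 = I - P a0; Q = {x \<in> I. f x \<in> B - P a0} in
               \<lparr>gdom = I1, gpart = P(a1 := Q, a0 := P a1 - Q), gmap = first_return I1 f\<rparr>))"

definition Rn :: "nat \<Rightarrow> ('a::finite) giem \<Rightarrow> 'a giem" where
  "Rn n T = (RV ^^ n) T"

definition inf_renormalizable :: "('a::finite) giem \<Rightarrow> bool" where
  "inf_renormalizable T \<longleftrightarrow> (\<forall>n. renormalizable (Rn n T))"

definition k_bounded :: "nat \<Rightarrow> ('a::finite) giem \<Rightarrow> bool" where
  "k_bounded k T \<longleftrightarrow> inf_renormalizable T \<and>
     (\<forall>n \<beta> \<gamma>. \<exists>n1 p. \<bar>int n - int n1\<bar> < int k \<and> \<bar>int n - int n1 - int p\<bar> < int k \<and>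
        winner (Rn n1 T) = \<beta> \<and> loser (Rn (n1 + p) T) = \<gamma> \<and>
        (\<forall>i<p. loser (Rn (n1 + i) T) = winner (Rn (n1 + i + 1) T)))"

text \<open>no connection; the boundary of [a,b) is {a} = {Inf [a,b)}\<close>
definition no_connection :: "('a::finite) giem \<Rightarrow> bool" where
  "no_connection T \<longleftrightarrow>
     (\<forall>m\<ge>1. \<forall>\<alpha> \<beta>. pi0 T \<beta> \<noteq> 1 \<longrightarrow>
        (gmap T ^^ m) (Inf (gpart T \<alpha>)) \<noteq> Inf (gpart T \<beta>))"

definition genus_one :: "('a::finite) giem \<Rightarrow> bool" where
  "genus_one T \<longleftrightarrow>
     finite {x \<in> gdom T. \<not> continuous (at x within gdom T) (gmap T)} \<and>
     card {x \<in> gdom T. \<not> continuous (at x within gdom T) (gmap T)} \<le> 2"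

definition C2nu_branches :: "real \<Rightarrow> ('a::finite) giem \<Rightarrow> bool" where
  "C2nu_branches \<nu> T \<longleftrightarrow> (\<forall>\<alpha>. \<exists>g g1 g2 H.
     (\<forall>x\<in>gpart T \<alpha>. g x = gmap T x) \<and>
     (\<forall>x\<in>closure (gpart T \<alpha>).
        (g has_real_derivative g1 x) (at x within closure (gpart T \<alpha>)) \<and>
        (g1 has_real_derivative g2 x) (at x within closure (gpart T \<alpha>)) \<and>
        g1 x > 0) \<and>
     (\<forall>x\<in>closure (gpart T \<alpha>). \<forall>y\<in>closure (gpart T \<alpha>).
        \<bar>g2 x - g2 y\<bar> \<le> H * \<bar>x - y\<bar> powr \<nu>))"

definition in_B :: "nat \<Rightarrow> real \<Rightarrow> ('a::finite) giem \<Rightarrow> bool" where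
  "in_B k \<nu> T \<longleftrightarrow> is_giem T \<and> irreducible_comb T \<and> C2nu_branches \<nu> T \<and>
     k_bounded k T \<and> genus_one T \<and> no_connection T"

definition nonlin_integral :: "('a::finite) giem \<Rightarrow> real" where
  "nonlin_integral T = (\<Sum>\<alpha>\<in>UNIV. integral (gpart T \<alpha>)
        (\<lambda>x. deriv (deriv (gmap T)) x / deriv (gmap T) x))"

text \<open>zoom: A1 \<circ> g \<circ> A2 with A2 : [0,1] \<rightarrow> H, A1 : g(H) \<rightarrow> [0,1] affine increasing\<close>
definition zoom :: "real set \<Rightarrow> (real \<Rightarrow> real) \<Rightarrow> real \<Rightarrow> real" where
  "zoom H g t = (g (Inf H + t * (Sup H - Inf H)) - Inf (g ` H)) / (Sup (g ` H) - Inf (g ` H))"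

text \<open>C^2 distance on [0,1], given the functions and their first two derivatives\<close>
definition dC2 :: "(real \<Rightarrow> real) \<Rightarrow> (real \<Rightarrow> real) \<Rightarrow> (real \<Rightarrow> real) \<Rightarrow>
                   (real \<Rightarrow> real) \<Rightarrow> (real \<Rightarrow> real) \<Rightarrow> (real \<Rightarrow> real) \<Rightarrow> real" where
  "dC2 F F1 F2 G G1 G2 =
     (SUP t\<in>{0..1}. \<bar>F t - G t\<bar>) + (SUP t\<in>{0..1}. \<bar>F1 t - G1 t\<bar>) + (SUP t\<in>{0..1}. \<bar>F2 t - G2 t\<bar>)"

end

theory Submission
  imports Defs
begin

text \<open>
  Write \<open>f\<^sub>n\<close> for the n-th renormalization. On each branch, \<open>f\<^sub>n\<close> is an iterate of f, so its nonlinearity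
  \<open>D\<^sup>2f\<^sub>n / Df\<^sub>n\<close> is obtained from that of f by the positive transfer operator
  \<open>\<phi> \<mapsto> \<Sum>\<^sub>i (\<phi> \<circ> f\<^sup>i) Df\<^sup>i\<close>. Let \<open>h\<^sub>n\<close> be the image of the constant 1. The quotient
  \<open>\<psi>\<^sub>n = (D\<^sup>2f\<^sub>n / Df\<^sub>n) / h\<^sub>n\<close> evolves by averaging: on the loser interval the new value at x is a convex
  combination of the old values at x and at \<open>f\<^sub>n x\<close>, elsewhere nothing changes. If the geometry of the
  partitions is bounded, the weights are bounded below and k-bounded combinatorics lets every letter see
  every other one in a bounded number of steps; together with a Lasota--Yorke type estimate for the Hoelder
  constant this makes the oscillation of \<open>\<psi>\<^sub>n\<close> decay exponentially. Since the integral of the nonlinearity is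
  preserved and vanishes, \<open>\<psi>\<^sub>n\<close> takes both signs, so it is itself exponentially small, and
  \<open>|I\<^sup>n\<^sub>\<alpha>| h\<^sub>n\<close> is bounded. This even gives the rate \<open>\<lambda>\<^sup>n\<close>.

  Bounded geometry follows from a uniform bound for the slopes of \<open>f\<^sub>n\<close>, and this is where genus one enters: \<open>f\<^sub>n\<close>
  is the first return map of a circle homeomorphism with two branches, whose mean logarithmic slopes
  always have opposite signs. Renormalizing adds one of them to the other (up to a bounded error), and two
  numbers that keep opposite signs under such additions, both kinds occurring regularly, stay bounded.
\<close>

section \<open>Partitions into intervals and combinatorial data\<close>

text \<open>There is a circle to break: contraction needs bounded geometry, and bounded geometry
  needs slope bounds uniform in n. What breaks it is a conserved quantity. Summed over all letters,
  the increase of \<open>m\<close> is the length 1 of the initial domain at every level, and log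
  derivative and log density vary by at most \<open>C1\<close> times the increase of
  \<open>m\<close>; so the distortion of each branch is bounded before anything is known about
  lengths. Only the size of one mean slope per branch is left open, and only for this the circle is
  used. There, secant slopes replace derivatives: a continuous branch may consist of several
  letters, and its derivative may jump where they meet. The two-branch map renormalizes more rarely
  than f: usually a step only shortens the domain, and the pair changes exactly when the cut hits
  the image or the preimage of 0. Bounded combinatorics makes each of these happen within any 4k
  steps. In the contraction, oscillation and Hoelder constant cannot be treated separately: each
  enters the estimate of the other, so one induction carries both. The Hoelder constant is taken
  relative to the current domain length.\<close>

definition ipart :: "real \<Rightarrow> ('a::finite \<Rightarrow> real) \<Rightarrow> ('a \<Rightarrow> real) \<Rightarrow> bool" where
  "ipart b L R \<longleftrightarrow> (\<forall>\<alpha>. L \<alpha> < R \<alpha>) \<and>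
     (\<forall>\<alpha> \<beta>. \<alpha> \<noteq> \<beta> \<longrightarrow> {L \<alpha>..<R \<alpha>} \<inter> {L \<beta>..<R \<beta>} = {}) \<and>
     (\<Union>\<alpha>. {L \<alpha>..<R \<alpha>}) = {0..<b}"

lemma ipart_less: "ipart b L R \<Longrightarrow> L \<alpha> < R \<alpha>"
  by (auto simp: ipart_def)

lemma ipart_mem: "ipart b L R \<Longrightarrow> L \<alpha> \<le> x \<Longrightarrow> x < R \<alpha> \<Longrightarrow> 0 \<le> x \<and> x < b"
  unfolding ipart_def by (metis (no_types, lifting) UN_I UNIV_I atLeastLessThan_iff)

lemma ipart_ex: "ipart b L R \<Longrightarrow> 0 \<le> x \<Longrightarrow> x < b \<Longrightarrow> \<exists>\<alpha>. L \<alpha> \<le> x \<and> x < R \<alpha>"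
  unfolding ipart_def by (metis (no_types, lifting) UN_E atLeastLessThan_iff)

lemma ipart_unique:
  "ipart b L R \<Longrightarrow> L \<alpha> \<le> x \<Longrightarrow> x < R \<alpha> \<Longrightarrow> L \<beta> \<le> x \<Longrightarrow> x < R \<beta> \<Longrightarrow> \<alpha> = \<beta>"
  unfolding ipart_def by (metis (no_types, lifting) IntI atLeastLessThan_iff empty_iff)

lemma ipart_L_ge: "ipart b L R \<Longrightarrow> 0 \<le> L \<alpha> \<and> L \<alpha> < b"
  using ipart_mem[of b L R \<alpha> "L \<alpha>"] ipart_less[of b L R \<alpha>] by auto

lemma ipart_R_le: assumes "ipart b L R" shows "R \<alpha> \<le> b"
proof (rule ccontr)
  assume "\<not> R \<alpha> \<le> b"
  then have "L \<alpha> \<le> max b (L \<alpha>)" "max b (L \<alpha>) < R \<alpha>"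
    using ipart_less[OF assms, of \<alpha>] by auto
  from ipart_mem[OF assms this] show False by auto
qed

lemma ipart_inj: "ipart b L R \<Longrightarrow> L \<alpha> = L \<beta> \<Longrightarrow> \<alpha> = \<beta>"
  using ipart_unique[of b L R \<alpha> "L \<alpha>" \<beta>] ipart_less[of b L R \<alpha>] ipart_less[of b L R \<beta>] by auto

lemma ipart_order: "ipart b L R \<Longrightarrow> L \<alpha> < L \<beta> \<Longrightarrow> R \<alpha> \<le> L \<beta>"
  using ipart_unique[of b L R \<alpha> "L \<beta>" \<beta>] ipart_less[of b L R \<beta>] by (cases "R \<alpha> \<le> L \<beta>") auto

lemma ipart_next:
  assumes "ipart b L R" "R \<alpha> < b" shows "\<exists>\<beta>. L \<beta> = R \<alpha>"
proof -
  have "0 \<le> R \<alpha>" using ipart_L_ge[OF assms(1), of \<alpha>] ipart_less[OF assms(1), of \<alpha>] by linarith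
  from ipart_ex[OF assms(1) this assms(2)] obtain \<beta> where b: "L \<beta> \<le> R \<alpha>" "R \<alpha> < R \<beta>" by auto
  have "\<not> L \<beta> < R \<alpha>"
  proof
    assume "L \<beta> < R \<alpha>"
    then have "\<alpha> = \<beta>"
      using ipart_unique[OF assms(1), of \<alpha> "max (L \<alpha>) (L \<beta>)" \<beta>] ipart_less[OF assms(1), of \<alpha>] b by auto
    then show False using b by auto
  qed
  then show ?thesis using b by force
qed

lemma ipart_last: assumes "ipart b L R" "\<And>\<beta>. L \<beta> \<le> L \<alpha>" shows "R \<alpha> = b"
  using ipart_next[OF assms(1), of \<alpha>] ipart_R_le[OF assms(1), of \<alpha>] assms(2) ipart_less[OF assms(1), of \<alpha>]
  by (metis leD le_less)

lemma ipart_first: assumes "ipart b L R" shows "\<exists>\<alpha>. L \<alpha> = 0"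
proof -
  have "0 < b" using ipart_L_ge[OF assms, of undefined] by linarith
  from ipart_ex[OF assms _ this] obtain \<alpha> where "L \<alpha> \<le> 0" by auto
  then show ?thesis using ipart_L_ge[OF assms, of \<alpha>] by force
qed

lemma ipart_sum: assumes "ipart b L R" shows "(\<Sum>\<alpha>\<in>UNIV. R \<alpha> - L \<alpha>) = b"
proof -
  have b: "0 < b" using ipart_L_ge[OF assms, of undefined] by linarith
  have "measure lborel (\<Union>\<alpha>\<in>UNIV. {L \<alpha>..<R \<alpha>}) = (\<Sum>\<alpha>\<in>UNIV. measure lborel {L \<alpha>..<R \<alpha>})"
    using assms unfolding ipart_def by (intro measure_finite_Union) (auto simp: disjoint_family_on_def less_imp_le)
  then show ?thesis
    using b assms ipart_less[OF assms] by (simp add: ipart_def less_imp_le)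
qed

lemma rank_unique:
  fixes p :: "'a::finite \<Rightarrow> nat"
  assumes "bij_betw p UNIV {1..CARD('a)}"
  shows "p \<alpha> = card {\<beta>. p \<beta> \<le> p \<alpha>}"
proof -
  have "p ` {\<beta>. p \<beta> \<le> p \<alpha>} = {1..p \<alpha>}"
  proof
    show "p ` {\<beta>. p \<beta> \<le> p \<alpha>} \<subseteq> {1..p \<alpha>}"
      using bij_betw_imp_surj_on[OF assms] by auto
    show "{1..p \<alpha>} \<subseteq> p ` {\<beta>. p \<beta> \<le> p \<alpha>}"
    proof
      fix i assume i: "i \<in> {1..p \<alpha>}"
      have "p \<alpha> \<le> CARD('a)" using bij_betw_imp_surj_on[OF assms] by auto
      then have "i \<in> range p" using i bij_betw_imp_surj_on[OF assms] by auto
      then show "i \<in> p ` {\<beta>. p \<beta> \<le> p \<alpha>}" using i by auto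
    qed
  qed
  then have "card {\<beta>. p \<beta> \<le> p \<alpha>} = card {1..p \<alpha>}"
    using card_image[of p "{\<beta>. p \<beta> \<le> p \<alpha>}"] bij_betw_imp_inj_on[OF assms]
    by (metis inj_on_subset subset_UNIV)
  then show ?thesis by simp
qed

text \<open>Justifies the \<open>THE\<close> in \<open>pi0\<close> and \<open>pi1\<close>: counting
  the letters whose key is not larger gives one such bijection, and \<open>rank_unique\<close>
  forces every other candidate to be the same count.\<close>

lemma rank_props:
  fixes key :: "'a::finite \<Rightarrow> real"
  assumes inj: "inj key"
  defines "p \<equiv> (THE p. bij_betw p UNIV {1..CARD('a)} \<and> (\<forall>\<alpha> \<beta>. key \<alpha> < key \<beta> \<longleftrightarrow> p \<alpha> < p \<beta>))"
  shows "bij_betw p UNIV {1..CARD('a)}" and "\<And>\<alpha> \<beta>. key \<alpha> < key \<beta> \<longleftrightarrow> p \<alpha> < p \<beta>"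
proof -
  define q where "q = (\<lambda>\<alpha>. card {\<beta>. key \<beta> \<le> key \<alpha>})"
  have lt: "q \<alpha> < q \<beta>" if "key \<alpha> < key \<beta>" for \<alpha> \<beta>
    unfolding q_def using that by (intro psubset_card_mono) (auto simp: psubset_eq set_eq_iff intro!: exI[of _ \<beta>])
  have lt_iff: "key \<alpha> < key \<beta> \<longleftrightarrow> q \<alpha> < q \<beta>" for \<alpha> \<beta>
    using lt[of \<alpha> \<beta>] lt[of \<beta> \<alpha>] injD[OF inj, of \<alpha> \<beta>] by (cases "key \<alpha>" "key \<beta>" rule: linorder_cases) auto
  have injq: "inj q"
    by (rule injI) (metis lt_iff inj injD less_irrefl linorder_neqE)
  have "q \<alpha> \<in> {1..CARD('a)}" for \<alpha>
  proof -
    have "card {\<alpha>} \<le> q \<alpha>" unfolding q_def by (rule card_mono) auto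
    moreover have "q \<alpha> \<le> CARD('a)" unfolding q_def by (rule card_mono) auto
    ultimately show ?thesis by auto
  qed
  then have "q ` UNIV = {1..CARD('a)}"
    using injq by (intro card_subset_eq) (auto simp: card_image)
  then have bq: "bij_betw q UNIV {1..CARD('a)}" using injq by (simp add: bij_betw_def)
  have "p = q" unfolding p_def
  proof (rule the_equality)
    show "bij_betw q UNIV {1..CARD('a)} \<and> (\<forall>\<alpha> \<beta>. key \<alpha> < key \<beta> \<longleftrightarrow> q \<alpha> < q \<beta>)"
      using bq lt_iff by auto
  next
    fix p' assume p': "bij_betw p' UNIV {1..CARD('a)} \<and> (\<forall>\<alpha> \<beta>. key \<alpha> < key \<beta> \<longleftrightarrow> p' \<alpha> < p' \<beta>)"
    then have "\<And>\<alpha> \<beta>. p' \<beta> \<le> p' \<alpha> \<longleftrightarrow> key \<beta> \<le> key \<alpha>" by (meson not_le)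
    then show "p' = q" using rank_unique[of p'] p' unfolding q_def by auto
  qed
  then show "bij_betw p UNIV {1..CARD('a)}" "\<And>\<alpha> \<beta>. key \<alpha> < key \<beta> \<longleftrightarrow> p \<alpha> < p \<beta>"
    using bq lt_iff by auto
qed

lemma rank_last:
  fixes p :: "'a::finite \<Rightarrow> nat"
  assumes p: "bij_betw p UNIV {1..CARD('a)}"
  shows "p (THE \<alpha>. p \<alpha> = CARD('a)) = CARD('a)" and "p \<beta> \<le> CARD('a)"
proof -
  have r: "range p = {1..CARD('a)}" using p by (simp add: bij_betw_def)
  show "p \<beta> \<le> CARD('a)" using r by auto
  have "CARD('a) \<in> range p" unfolding r by (simp add: Suc_leI)
  then obtain \<alpha> where a: "p \<alpha> = CARD('a)" by auto
  show "p (THE \<alpha>. p \<alpha> = CARD('a)) = CARD('a)"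
    by (rule theI[of _ \<alpha>]) (use a p in \<open>auto simp: bij_betw_def inj_def\<close>)
qed

text \<open>Initial segments of the order by \<open>key\<close>. Irreducibility is restated through
  them because endpoints are easy to follow through a renormalization step, while the numberings
  \<open>pi0\<close> and \<open>pi1\<close> are not.\<close>

definition down :: "('a \<Rightarrow> real) \<Rightarrow> 'a set \<Rightarrow> bool" where
  "down key A \<longleftrightarrow> (\<forall>\<alpha>\<in>A. \<forall>\<beta>. \<beta> \<notin> A \<longrightarrow> key \<alpha> < key \<beta>)"

lemma down_image_rank:
  fixes p :: "'a::finite \<Rightarrow> nat"
  assumes p: "bij_betw p UNIV {1..CARD('a)}" and "\<And>\<alpha> \<beta>. key \<alpha> < key \<beta> \<longleftrightarrow> p \<alpha> < p \<beta>"
    and "down key A"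
  shows "p ` A = {1..card A}"
proof -
  have injp: "inj p" and r: "range p = {1..CARD('a)}" using p by (auto simp: bij_betw_def)
  have lt: "p \<alpha> < p \<beta>" if "\<alpha> \<in> A" "\<beta> \<notin> A" for \<alpha> \<beta>
    using assms(2,3) that by (auto simp: down_def)
  have c: "card (p ` A) = card A" using injp by (metis card_image inj_on_subset subset_UNIV)
  have "{1..card A} \<subseteq> p ` A"
  proof
    fix i assume i: "i \<in> {1..card A}"
    have "card A \<le> CARD('a)" by (rule card_mono) auto
    then obtain \<gamma> where g: "p \<gamma> = i" using i r by (metis atLeastAtMost_iff imageE order_trans)
    show "i \<in> p ` A"
    proof (rule ccontr)
      assume "i \<notin> p ` A"
      then have "\<gamma> \<notin> A" using g by auto
      then have "p ` A \<subseteq> {1..<i}" using lt g r by fastforce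
      then have "card (p ` A) \<le> card {1..<i}" by (intro card_mono) auto
      then show False using c i by auto
    qed
  qed
  then show ?thesis using c by (intro card_subset_eq[symmetric]) auto
qed

text \<open>The ranks of an initial segment are the numbers up to its cardinality
  (\<open>down_image_rank\<close>), so the values j violating irreducibility correspond to the sets
  that are initial in both orders.\<close>

lemma irreducible_iff_down:
  fixes p q :: "'a::finite \<Rightarrow> nat"
  assumes p: "bij_betw p UNIV {1..CARD('a)}" "\<And>\<alpha> \<beta>. k0 \<alpha> < k0 \<beta> \<longleftrightarrow> p \<alpha> < p \<beta>"
    and q: "bij_betw q UNIV {1..CARD('a)}" "\<And>\<alpha> \<beta>. k1 \<alpha> < k1 \<beta> \<longleftrightarrow> q \<alpha> < q \<beta>"
  shows "(\<forall>j. 1 \<le> j \<and> j < CARD('a) \<longrightarrow> q ` {\<alpha>. p \<alpha> \<in> {1..j}} \<noteq> {1..j}) \<longleftrightarrow>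
    (\<forall>A. A \<noteq> {} \<and> A \<noteq> UNIV \<longrightarrow> \<not> (down k0 A \<and> down k1 A))" (is "?l \<longleftrightarrow> ?r")
proof
  assume l: ?l
  show ?r
  proof (intro allI impI notI)
    fix A :: "'a set" assume A: "A \<noteq> {} \<and> A \<noteq> UNIV" and d: "down k0 A \<and> down k1 A"
    have pa: "p ` A = {1..card A}" and qa: "q ` A = {1..card A}"
      using down_image_rank[OF p, of A] down_image_rank[OF q, of A] d by auto
    have "{\<alpha>. p \<alpha> \<in> {1..card A}} = A"
      unfolding pa[symmetric] using p(1) by (auto simp: bij_betw_def inj_def)
    moreover have "card A < CARD('a)" using A by (intro psubset_card_mono) auto
    moreover have "1 \<le> card A" using A by (simp add: Suc_leI card_gt_0_iff)
    ultimately show False using l qa by metis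
  qed
next
  assume r: ?r
  show ?l
  proof (intro allI impI notI)
    fix j assume j: "1 \<le> j \<and> j < CARD('a)" and e: "q ` {\<alpha>. p \<alpha> \<in> {1..j}} = {1..j}"
    define A where "A = {\<alpha>. p \<alpha> \<in> {1..j}}"
    have rp: "range p = {1..CARD('a)}" and rq: "range q = {1..CARD('a)}"
      using p(1) q(1) by (auto simp: bij_betw_def)
    have inA: "\<alpha> \<in> A \<longleftrightarrow> p \<alpha> \<le> j" for \<alpha>
      using rp unfolding A_def by auto
    have inA': "\<alpha> \<in> A \<longleftrightarrow> q \<alpha> \<le> j" for \<alpha>
    proof
      assume "\<alpha> \<in> A" then have "q \<alpha> \<in> q ` A" by auto
      then show "q \<alpha> \<le> j" using e unfolding A_def by auto
    next
      assume "q \<alpha> \<le> j"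
      moreover have "q \<alpha> \<in> {1..CARD('a)}" using rq by auto
      ultimately have "q \<alpha> \<in> q ` A" using e unfolding A_def by auto
      then show "\<alpha> \<in> A" using q(1) by (auto simp: bij_betw_def inj_def)
    qed
    have "down k0 A" "down k1 A" unfolding down_def p(2) q(2)
      using inA inA' by (meson le_less_trans not_le)+
    moreover have "A \<noteq> {}"
    proof -
      have "1 \<in> range p" using rp j by auto
      then show ?thesis using inA j by auto
    qed
    moreover have "A \<noteq> UNIV"
    proof -
      have "CARD('a) \<in> range p" using rp j by auto
      then show ?thesis using inA j by (metis UNIV_I imageE not_le)
    qed
    ultimately show False using r by auto
  qed
qed


section \<open>Endpoints of the intervals and of their images\<close>

definition lft :: "('a::finite) giem \<Rightarrow> 'a \<Rightarrow> real" where "lft T \<alpha> = Inf (gpart T \<alpha>)"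
definition rgt :: "('a::finite) giem \<Rightarrow> 'a \<Rightarrow> real" where "rgt T \<alpha> = Sup (gpart T \<alpha>)"
definition ilft :: "('a::finite) giem \<Rightarrow> 'a \<Rightarrow> real" where "ilft T \<alpha> = gmap T (lft T \<alpha>)"
definition irgt :: "('a::finite) giem \<Rightarrow> 'a \<Rightarrow> real" where "irgt T \<alpha> = Sup (gmap T ` gpart T \<alpha>)"

definition irred :: "('a::finite) giem \<Rightarrow> bool" where
  "irred T \<longleftrightarrow> (\<forall>A. A \<noteq> {} \<and> A \<noteq> UNIV \<longrightarrow> \<not> (down (lft T) A \<and> down (ilft T) A))"

text \<open>A strictly increasing map on an interval without last point does not attain its
  supremum, and an image that is an interval fills everything from the first value up to it.\<close>

lemma strict_mono_image_half_open:
  fixes f :: "real \<Rightarrow> real"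
  assumes "l < r" "strict_mono_on {l..<r} f" "is_interval (f ` {l..<r})" "bdd_above (f ` {l..<r})"
  shows "f ` {l..<r} = {f l..<Sup (f ` {l..<r})}" and "f l < Sup (f ` {l..<r})"
proof -
  let ?S = "Sup (f ` {l..<r})"
  have lt: "f x < ?S" if "x \<in> {l..<r}" for x
  proof -
    define y where "y = (x + r) / 2"
    have y: "x < y" "y \<in> {l..<r}" using that by (auto simp: y_def)
    then have "f x < f y" using assms(2) that by (auto simp: strict_mono_on_def)
    also have "f y \<le> ?S" using y assms(4) by (intro cSup_upper) auto
    finally show ?thesis .
  qed
  show "f l < ?S" using lt assms(1) by auto
  show "f ` {l..<r} = {f l..<?S}"
  proof
    show "f ` {l..<r} \<subseteq> {f l..<?S}"
    proof
      fix z assume "z \<in> f ` {l..<r}"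
      then obtain x where x: "x \<in> {l..<r}" "z = f x" by auto
      then have "f l \<le> f x"
        using assms(2) by (cases "x = l") (auto simp: strict_mono_on_def less_imp_le)
      then show "z \<in> {f l..<?S}" using lt x by auto
    qed
    show "{f l..<?S} \<subseteq> f ` {l..<r}"
    proof
      fix z assume z: "z \<in> {f l..<?S}"
      have "f ` {l..<r} \<noteq> {}" using assms(1) by auto
      then obtain w where w: "w \<in> f ` {l..<r}" "z < w"
        using z less_cSup_iff[OF _ assms(4)] by auto
      moreover have "f l \<in> f ` {l..<r}" using assms(1) by auto
      ultimately show "z \<in> f ` {l..<r}"
        using assms(3) z unfolding is_interval_1 by (meson atLeastLessThan_iff less_imp_le)
    qed
  qed
qed

text \<open>The left endpoint of the domain can be fixed at 0 because every renormalization step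
  cuts at the right end.\<close>

locale giem =
  fixes T :: "('a::finite) giem" and b :: real
  assumes giem: "is_giem T" and dom: "gdom T = {0..<b}"
begin

abbreviation "f \<equiv> gmap T"

lemmas giem' = giem[unfolded is_giem_def]
lemmas giem_parts = giem'[THEN conjunct2, THEN conjunct1]
lemmas giem_disj = giem'[THEN conjunct2, THEN conjunct2, THEN conjunct1]
lemmas giem_union = giem'[THEN conjunct2, THEN conjunct2, THEN conjunct2, THEN conjunct1]
lemmas giem_bij = giem'[THEN conjunct2, THEN conjunct2, THEN conjunct2, THEN conjunct2, THEN conjunct1]
lemmas giem_branch = giem'[THEN conjunct2, THEN conjunct2, THEN conjunct2, THEN conjunct2, THEN conjunct2, rule_format]

lemma part: "gpart T \<alpha> = {lft T \<alpha>..<rgt T \<alpha>}" and lft_less: "lft T \<alpha> < rgt T \<alpha>"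
proof -
  from giem_parts obtain l r where "l < r" "gpart T \<alpha> = {l..<r}" by blast
  then show "gpart T \<alpha> = {lft T \<alpha>..<rgt T \<alpha>}" "lft T \<alpha> < rgt T \<alpha>"
    by (auto simp: lft_def rgt_def)
qed

lemma mono: "lft T \<alpha> \<le> x \<Longrightarrow> x < y \<Longrightarrow> y < rgt T \<alpha> \<Longrightarrow> f x < f y"
  using giem_branch[of \<alpha>] unfolding part by (auto simp: strict_mono_on_def)

lemma cont: "continuous_on {lft T \<alpha>..<rgt T \<alpha>} f"
  using giem_branch[of \<alpha>] unfolding part by blast

lemma bij: "bij_betw f {0..<b} {0..<b}"
  using giem_bij unfolding dom .

lemma inj: "0 \<le> x \<Longrightarrow> x < b \<Longrightarrow> 0 \<le> y \<Longrightarrow> y < b \<Longrightarrow> f x = f y \<Longrightarrow> x = y"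
  using bij by (auto simp: bij_betw_def inj_on_def)

lemma maps: "0 \<le> x \<Longrightarrow> x < b \<Longrightarrow> 0 \<le> f x \<and> f x < b"
  using bij unfolding bij_betw_def by (metis atLeastLessThan_iff imageI)

lemma surj: "0 \<le> y \<Longrightarrow> y < b \<Longrightarrow> \<exists>x. 0 \<le> x \<and> x < b \<and> f x = y"
proof -
  assume "0 \<le> y" "y < b"
  then have "y \<in> f ` {0..<b}" using bij by (simp add: bij_betw_def)
  then show ?thesis by auto
qed

lemma ipart_top: "ipart b (lft T) (rgt T)"
  unfolding ipart_def using lft_less giem_disj giem_union unfolding dom part by blast

lemma img: "f ` {lft T \<alpha>..<rgt T \<alpha>} = {ilft T \<alpha>..<irgt T \<alpha>}" and ilft_less: "ilft T \<alpha> < irgt T \<alpha>"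
proof -
  have sub: "{lft T \<alpha>..<rgt T \<alpha>} \<subseteq> {0..<b}" using ipart_top unfolding ipart_def by blast
  have a: "strict_mono_on {lft T \<alpha>..<rgt T \<alpha>} f" "is_interval (f ` {lft T \<alpha>..<rgt T \<alpha>})"
    using giem_branch[of \<alpha>] unfolding part by blast+
  have "f ` {lft T \<alpha>..<rgt T \<alpha>} \<subseteq> {0..<b}" using sub bij by (auto simp: bij_betw_def)
  then have "bdd_above (f ` {lft T \<alpha>..<rgt T \<alpha>})"
    by (meson bdd_above_Ico bdd_above_mono)
  from strict_mono_image_half_open[OF lft_less a this]
  show "f ` {lft T \<alpha>..<rgt T \<alpha>} = {ilft T \<alpha>..<irgt T \<alpha>}" "ilft T \<alpha> < irgt T \<alpha>"
    unfolding ilft_def irgt_def part by auto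
qed

lemma ipart_bot: "ipart b (ilft T) (irgt T)"
proof -
  have sub: "{lft T \<alpha>..<rgt T \<alpha>} \<subseteq> {0..<b}" for \<alpha> using ipart_top unfolding ipart_def by blast
  have "{ilft T \<alpha>..<irgt T \<alpha>} \<inter> {ilft T \<beta>..<irgt T \<beta>} = {}" if "\<alpha> \<noteq> \<beta>" for \<alpha> \<beta>
  proof -
    have "{lft T \<alpha>..<rgt T \<alpha>} \<inter> {lft T \<beta>..<rgt T \<beta>} = {}"
      using that ipart_top unfolding ipart_def by blast
    moreover have "inj_on f {0..<b}" using bij by (auto simp: bij_betw_def)
    ultimately show ?thesis unfolding img[symmetric]
      using sub[of \<alpha>] sub[of \<beta>] by (metis image_empty inj_on_image_Int)
  qed
  moreover have "(\<Union>\<alpha>. {ilft T \<alpha>..<irgt T \<alpha>}) = {0..<b}"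
  proof -
    have "(\<Union>\<alpha>. {ilft T \<alpha>..<irgt T \<alpha>}) = f ` (\<Union>\<alpha>. {lft T \<alpha>..<rgt T \<alpha>})"
      unfolding image_UN img ..
    also have "\<dots> = f ` {0..<b}" using ipart_top by (simp add: ipart_def)
    finally show ?thesis using bij by (simp add: bij_betw_def)
  qed
  ultimately show ?thesis unfolding ipart_def using ilft_less by blast
qed

lemma in_img: "lft T \<alpha> \<le> x \<Longrightarrow> x < rgt T \<alpha> \<Longrightarrow> ilft T \<alpha> \<le> f x \<and> f x < irgt T \<alpha>"
  using img[of \<alpha>] by (metis atLeastLessThan_iff imageI)

lemma img_ex: "ilft T \<alpha> \<le> y \<Longrightarrow> y < irgt T \<alpha> \<Longrightarrow> \<exists>x. lft T \<alpha> \<le> x \<and> x < rgt T \<alpha> \<and> f x = y"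
proof -
  assume "ilft T \<alpha> \<le> y" "y < irgt T \<alpha>"
  then have "y \<in> f ` {lft T \<alpha>..<rgt T \<alpha>}" by (simp add: img)
  then show ?thesis by auto
qed

lemma img_letter:
  assumes "0 \<le> x" "x < b" "ilft T \<alpha> \<le> f x" "f x < irgt T \<alpha>"
  shows "lft T \<alpha> \<le> x \<and> x < rgt T \<alpha>"
proof -
  obtain y where y: "lft T \<alpha> \<le> y" "y < rgt T \<alpha>" "f y = f x" using img_ex[OF assms(3,4)] by auto
  then have "y = x" using inj[of y x] ipart_mem[OF ipart_top, of \<alpha> y] assms by auto
  then show ?thesis using y by auto
qed

lemma ilt_half_open: assumes "ipart b L R"
  shows "ilt {L \<alpha>..<R \<alpha>} {L \<beta>..<R \<beta>} \<longleftrightarrow> L \<alpha> < L \<beta>"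
proof
  assume "ilt {L \<alpha>..<R \<alpha>} {L \<beta>..<R \<beta>}"
  then show "L \<alpha> < L \<beta>" using ipart_less[OF assms] by (force simp: ilt_def)
next
  assume "L \<alpha> < L \<beta>"
  then have "R \<alpha> \<le> L \<beta>" using ipart_order[OF assms] by auto
  then show "ilt {L \<alpha>..<R \<alpha>} {L \<beta>..<R \<beta>}" by (auto simp: ilt_def)
qed

lemma pi0_props: "bij_betw (pi0 T) UNIV {1..CARD('a)}" "\<And>\<alpha> \<beta>. lft T \<alpha> < lft T \<beta> \<longleftrightarrow> pi0 T \<alpha> < pi0 T \<beta>"
proof -
  have "inj (lft T)" using ipart_inj[OF ipart_top] by (auto simp: inj_def)
  note r = rank_props[OF this]
  show "bij_betw (pi0 T) UNIV {1..CARD('a)}"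
    unfolding pi0_def part ilt_half_open[OF ipart_top] by (rule r(1))
  show "lft T \<alpha> < lft T \<beta> \<longleftrightarrow> pi0 T \<alpha> < pi0 T \<beta>" for \<alpha> \<beta>
    unfolding pi0_def part ilt_half_open[OF ipart_top] by (rule r(2))
qed

lemma pi1_props: "bij_betw (pi1 T) UNIV {1..CARD('a)}" "\<And>\<alpha> \<beta>. ilft T \<alpha> < ilft T \<beta> \<longleftrightarrow> pi1 T \<alpha> < pi1 T \<beta>"
proof -
  have "inj (ilft T)" using ipart_inj[OF ipart_bot] by (auto simp: inj_def)
  note r = rank_props[OF this]
  show "bij_betw (pi1 T) UNIV {1..CARD('a)}"
    unfolding pi1_def part img ilt_half_open[OF ipart_bot] by (rule r(1))
  show "ilft T \<alpha> < ilft T \<beta> \<longleftrightarrow> pi1 T \<alpha> < pi1 T \<beta>" for \<alpha> \<beta>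
    unfolding pi1_def part img ilt_half_open[OF ipart_bot] by (rule r(2))
qed

lemma irreducible_iff: "irreducible_comb T \<longleftrightarrow> irred T"
  unfolding irreducible_comb_def irred_def by (rule irreducible_iff_down[OF pi0_props pi1_props])

definition "a0 = alph T 0"
definition "a1 = alph T 1"

lemma a0_max: "lft T \<beta> \<le> lft T a0"
proof -
  have e: "alph T 0 = (THE \<alpha>. pi0 T \<alpha> = CARD('a))" by (simp add: alph_def)
  have "pi0 T a0 = CARD('a)" unfolding a0_def e by (rule rank_last(1)[OF pi0_props(1)])
  then have "\<not> pi0 T a0 < pi0 T \<beta>" using rank_last(2)[OF pi0_props(1), of \<beta>] by linarith
  then show ?thesis using pi0_props(2)[of a0 \<beta>] by linarith
qed

lemma a1_max: "ilft T \<beta> \<le> ilft T a1"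
proof -
  have e: "alph T 1 = (THE \<alpha>. pi1 T \<alpha> = CARD('a))" by (simp add: alph_def)
  have "pi1 T a1 = CARD('a)" unfolding a1_def e by (rule rank_last(1)[OF pi1_props(1)])
  then have "\<not> pi1 T a1 < pi1 T \<beta>" using rank_last(2)[OF pi1_props(1), of \<beta>] by linarith
  then show ?thesis using pi1_props(2)[of a1 \<beta>] by linarith
qed

lemma rgt_a0: "rgt T a0 = b" using ipart_last[OF ipart_top a0_max] .
lemma irgt_a1: "irgt T a1 = b" using ipart_last[OF ipart_bot a1_max] .

lemma a0_less: "\<beta> \<noteq> a0 \<Longrightarrow> rgt T \<beta> \<le> lft T a0"
  using a0_max[of \<beta>] ipart_inj[OF ipart_top, of \<beta> a0] ipart_order[OF ipart_top, of \<beta> a0] by force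
lemma a1_less: "\<beta> \<noteq> a1 \<Longrightarrow> irgt T \<beta> \<le> ilft T a1"
  using a1_max[of \<beta>] ipart_inj[OF ipart_bot, of \<beta> a1] ipart_order[OF ipart_bot, of \<beta> a1] by force

lemma ilen_a0: "ilen (gpart T a0) = b - lft T a0"
  unfolding ilen_def rgt_a0[symmetric] lft_def rgt_def ..
lemma ilen_a1: "ilen (gmap T ` gpart T a1) = b - ilft T a1"
  unfolding part img ilen_def using irgt_a1 ilft_less[of a1] by simp

lemma gtype_0: "gtype T = 0 \<longleftrightarrow> lft T a0 < ilft T a1"
  unfolding gtype_def a0_def[symmetric] a1_def[symmetric] ilen_a0 ilen_a1 by auto

lemma renormalizable_iff: "renormalizable T \<longleftrightarrow> lft T a0 \<noteq> ilft T a1"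
  unfolding renormalizable_def a0_def[symmetric] a1_def[symmetric] ilen_a0 ilen_a1 by auto

lemma winner_eq: "winner T = (if lft T a0 < ilft T a1 then a0 else a1)"
  and loser_eq: "loser T = (if lft T a0 < ilft T a1 then a1 else a0)"
  using gtype_0 unfolding winner_def loser_def a0_def a1_def
  by (auto simp: gtype_def)

end

section \<open>One step of Rauzy--Veech renormalization\<close>

locale rv_step = giem T b for T :: "('a::finite) giem" and b +
  assumes irred: "irred T" and ne: "lft T a0 \<noteq> ilft T a1" and card: "CARD('a) \<ge> 2"
begin

lemma other: "\<exists>\<beta>::'a. \<beta> \<noteq> \<alpha>"
proof (rule ccontr)
  assume "\<nexists>\<beta>. \<beta> \<noteq> \<alpha>"
  then have "(UNIV :: 'a set) = {\<alpha>}" by auto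
  then have "CARD('a) = 1" by (metis card.empty card.insert empty_iff finite.emptyI One_nat_def)
  then show False using card by simp
qed

text \<open>If one letter were last in both orders, its complement would be initial in both, against
  irreducibility.\<close>

lemma a0_ne_a1: "a0 \<noteq> a1"
proof
  assume e: "a0 = a1"
  have "down (lft T) (- {a0})" unfolding down_def
  proof (intro ballI allI impI)
    fix \<alpha> \<beta> assume a: "\<alpha> \<in> - {a0}" "\<beta> \<notin> - {a0}"
    then have "rgt T \<alpha> \<le> lft T a0" by (intro a0_less) auto
    then show "lft T \<alpha> < lft T \<beta>" using a lft_less[of \<alpha>] by auto
  qed
  moreover have "down (ilft T) (- {a0})" unfolding down_def
  proof (intro ballI allI impI)
    fix \<alpha> \<beta> assume a: "\<alpha> \<in> - {a0}" "\<beta> \<notin> - {a0}"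
    then have "irgt T \<alpha> \<le> ilft T a1" using e by (intro a1_less) auto
    then show "ilft T \<alpha> < ilft T \<beta>" using a e ilft_less[of \<alpha>] by auto
  qed
  moreover have "- {a0} \<noteq> {}" using other[of a0] by auto
  moreover have "- {a0} \<noteq> UNIV" by auto
  ultimately show False using irred[unfolded irred_def, THEN spec, of "- {a0}"] by simp
qed

text \<open>\<open>b'\<close> and \<open>xc\<close> allow both types to be treated together: the
  points that need two steps to return form the interval from \<open>xc\<close> to
  \<open>rgt T a1\<close> (\<open>ret\<close>, \<open>ret_conv\<close>), and in either type this
  becomes the interval of the loser. In type 0 it is the whole interval of \<open>a1\<close>
  (\<open>xc_ty0\<close>).\<close>

definition "b' = max (lft T a0) (ilft T a1)"
definition "xc = (SOME x. lft T a1 \<le> x \<and> x < rgt T a1 \<and> f x = b')"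
abbreviation "ty0 \<equiv> lft T a0 < ilft T a1"

lemma rgt_a1_le: "rgt T a1 \<le> lft T a0" using a0_less[of a1] a0_ne_a1 by auto
lemma irgt_a0_le: "irgt T a0 \<le> ilft T a1" using a1_less[of a0] a0_ne_a1 by auto

lemma b'_pos: "0 < b'" and b'_less: "b' < b"
  using rgt_a1_le lft_less[of a1] ipart_L_ge[OF ipart_top, of a1] ipart_L_ge[OF ipart_top, of a0]
    ipart_L_ge[OF ipart_bot, of a1] unfolding b'_def by auto

lemma xc: "lft T a1 \<le> xc" "xc < rgt T a1" "f xc = b'"
proof -
  have "\<exists>x. lft T a1 \<le> x \<and> x < rgt T a1 \<and> f x = b'"
    by (rule img_ex) (use b'_less irgt_a1 in \<open>auto simp: b'_def\<close>)
  from someI_ex[OF this] show "lft T a1 \<le> xc" "xc < rgt T a1" "f xc = b'"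
    unfolding xc_def by auto
qed

lemma xc_ty0: "ty0 \<Longrightarrow> xc = lft T a1"
proof -
  assume t: ty0
  then have "f xc = f (lft T a1)" using xc(3) by (simp add: b'_def ilft_def)
  then show ?thesis using inj[of xc "lft T a1"] xc ipart_mem[OF ipart_top, of a1 xc]
      ipart_L_ge[OF ipart_top, of a1] by auto
qed

lemma xc_ty1: "\<not> ty0 \<Longrightarrow> lft T a1 < xc"
proof -
  assume "\<not> ty0"
  then have "f (lft T a1) < f xc" using ne xc(3) unfolding b'_def ilft_def by auto
  then show ?thesis using xc(1) by (cases "xc = lft T a1") auto
qed

text \<open>Only the branch of \<open>a1\<close> reaches \<open>b'\<close> or more. It lands there
  in the interval of \<open>a0\<close>, whose image ends at or below \<open>ilft T a1\<close>; so a
  point that leaves the shortened domain is back one step later, and return times are 1 or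
  2.\<close>

lemma ret:
  assumes "0 \<le> x" "x < b" "b' \<le> f x"
  shows "xc \<le> x" "x < rgt T a1" "x < b'" "lft T a0 \<le> f x" "f x < b" "f (f x) < b'"
proof -
  have fx: "f x < b" using maps assms by auto
  have m: "lft T a1 \<le> x \<and> x < rgt T a1"
    by (rule img_letter) (use assms fx irgt_a1 in \<open>auto simp: b'_def\<close>)
  then show "x < rgt T a1" by auto
  show "xc \<le> x" using mono[of a1 x xc] m xc assms by (cases "xc \<le> x") auto
  show "x < b'" using m rgt_a1_le by (auto simp: b'_def)
  show "lft T a0 \<le> f x" using assms by (auto simp: b'_def)
  then have "f (f x) < irgt T a0" using in_img[of a0 "f x"] fx rgt_a0 by auto
  then show "f (f x) < b'" using irgt_a0_le by (auto simp: b'_def)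
  show "f x < b" by fact
qed

lemma ret_conv:
  assumes "xc \<le> x" "x < rgt T a1"
  shows "b' \<le> f x"
proof (cases "x = xc")
  case False
  then have "f xc < f x" using assms xc by (intro mono[of a1]) auto
  then show ?thesis using xc by auto
qed (use xc in auto)

definition "rvmap x = (if f x < b' then f x else f (f x))"

definition "L' = (if ty0 then lft T else (lft T)(a0 := xc))"
definition "R' = (if ty0 then (rgt T)(a0 := b') else (rgt T)(a1 := xc, a0 := rgt T a1))"

lemma first_return_eq:
  assumes "0 \<le> x" "x < b'"
  shows "first_return {0..<b'} f x = rvmap x"
proof -
  have x: "0 \<le> x" "x < b" using assms b'_less by auto
  show ?thesis
  proof (cases "f x < b'")
    case True
    have "(LEAST m. 0 < m \<and> (f ^^ m) x \<in> {0..<b'}) = 1"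
      by (rule Least_equality) (use True maps[OF x] in auto)
    then show ?thesis using True unfolding first_return_def rvmap_def by simp
  next
    case False
    have r: "f (f x) < b'" using ret(6)[OF x] False by auto
    have "(LEAST m. 0 < m \<and> (f ^^ m) x \<in> {0..<b'}) = 2"
    proof (rule Least_equality)
      show "0 < (2::nat) \<and> (f ^^ 2) x \<in> {0..<b'}"
        using r maps[OF x] maps[of "f x"] by (simp add: numeral_2_eq_2)
      fix m assume m: "0 < m \<and> (f ^^ m) x \<in> {0..<b'}"
      then have "m \<noteq> 1" using False by auto
      then show "2 \<le> m" using m by auto
    qed
    then show ?thesis using False unfolding first_return_def rvmap_def by (simp add: numeral_2_eq_2)
  qed
qed

lemma RV_dom: "gdom (RV T) = {0..<b'}"
  and RV_map: "gmap (RV T) = first_return {0..<b'} f"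
  and RV_part: "gpart (RV T) \<alpha> = {L' \<alpha>..<R' \<alpha>}"
proof -
  have imb: "f ` gpart T a1 = {ilft T a1..<b}" unfolding part img irgt_a1 ..
  have pa0: "gpart T a0 = {lft T a0..<b}" unfolding part rgt_a0 ..
  have e: "ilen (gpart T a0) > ilen (f ` gpart T a1) \<longleftrightarrow> ty0"
    unfolding ilen_a0 ilen_a1 by auto
  have Q: "\<not> ty0 \<Longrightarrow> {x \<in> {0..<b}. f x \<in> {ilft T a1..<b} - {lft T a0..<b}} = {lft T a1..<xc}"
  proof (intro set_eqI iffI)
    fix x assume t: "\<not> ty0" and "x \<in> {x \<in> {0..<b}. f x \<in> {ilft T a1..<b} - {lft T a0..<b}}"
    then have x: "0 \<le> x" "x < b" "ilft T a1 \<le> f x" "f x < b" "f x < b'" by (auto simp: b'_def)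
    then have m: "lft T a1 \<le> x \<and> x < rgt T a1" by (intro img_letter) (auto simp: irgt_a1)
    then have "x < xc" using x ret_conv[of x] by force
    then show "x \<in> {lft T a1..<xc}" using m by auto
  next
    fix x assume t: "\<not> ty0" and x: "x \<in> {lft T a1..<xc}"
    then have "f x < f xc" using xc by (intro mono[of a1]) auto
    moreover have "ilft T a1 \<le> f x \<and> f x < irgt T a1" using x xc by (intro in_img) auto
    moreover have "0 \<le> x \<and> x < b" using x xc ipart_mem[OF ipart_top, of a1 x] by auto
    ultimately show "x \<in> {x \<in> {0..<b}. f x \<in> {ilft T a1..<b} - {lft T a0..<b}}"
      using t xc irgt_a1 by (auto simp: b'_def)
  qed
  have p1: "gpart T a1 = {lft T a1..<rgt T a1}" by (rule part)
  have D: "{0..<b} - {c..<b} = {0..<c}" if "c \<le> b" for c using that by auto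
  have R: "RV T = (if ty0 then \<lparr>gdom = {0..<b} - {ilft T a1..<b},
       gpart = (gpart T)(a0 := {lft T a0..<b} - {ilft T a1..<b}), gmap = first_return ({0..<b} - {ilft T a1..<b}) f\<rparr>
     else \<lparr>gdom = {0..<b} - {lft T a0..<b}, gpart = (gpart T)(a1 := {x \<in> {0..<b}. f x \<in> {ilft T a1..<b} - {lft T a0..<b}},
       a0 := gpart T a1 - {x \<in> {0..<b}. f x \<in> {ilft T a1..<b} - {lft T a0..<b}}), gmap = first_return ({0..<b} - {lft T a0..<b}) f\<rparr>)"
    unfolding RV_def Let_def a0_def[symmetric] a1_def[symmetric] dom imb pa0 e[unfolded imb pa0] ..
  have c: "ilft T a1 \<le> b" "lft T a0 \<le> b" using b'_less by (auto simp: b'_def)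
  show "gdom (RV T) = {0..<b'}" "gmap (RV T) = first_return {0..<b'} f"
    unfolding R D[OF c(1)] D[OF c(2)] by (auto simp: b'_def max_def)
  show "gpart (RV T) \<alpha> = {L' \<alpha>..<R' \<alpha>}"
  proof (cases ty0)
    case True
    then show ?thesis unfolding R using c by (auto simp: L'_def R'_def b'_def part rgt_a0)
  next
    case False
    have "{lft T a1..<rgt T a1} - {lft T a1..<xc} = {xc..<rgt T a1}" using xc by auto
    then show ?thesis unfolding R Q[OF False] using False by (auto simp: L'_def R'_def part)
  qed
qed

lemma RV_map_eq: "0 \<le> x \<Longrightarrow> x < b' \<Longrightarrow> gmap (RV T) x = rvmap x"
  unfolding RV_map by (rule first_return_eq)

lemma win: "winner T = (if ty0 then a0 else a1)" and lose: "loser T = (if ty0 then a1 else a0)"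
  using winner_eq loser_eq by auto

lemma L'_R': "L' \<alpha> < R' \<alpha>"
  using lft_less[of \<alpha>] xc xc_ty1 ne unfolding L'_def R'_def b'_def by auto

lemma L'_loser: "L' (loser T) = xc" "R' (loser T) = rgt T a1"
  unfolding lose L'_def R'_def using xc_ty0 a0_ne_a1 by auto

lemma sub_winner: "\<alpha> \<noteq> loser T \<Longrightarrow> L' \<alpha> = lft T \<alpha> \<and> R' \<alpha> \<le> rgt T \<alpha>"
  unfolding lose L'_def R'_def using b'_less rgt_a0 xc by (auto split: if_splits)

lemma not_loser_lt: "\<alpha> \<noteq> loser T \<Longrightarrow> L' \<alpha> \<le> x \<Longrightarrow> x < R' \<alpha> \<Longrightarrow> f x < b'"
proof -
  assume a: "\<alpha> \<noteq> loser T" "L' \<alpha> \<le> x" "x < R' \<alpha>"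
  have m: "lft T \<alpha> \<le> x" "x < rgt T \<alpha>" using a sub_winner[OF a(1)] by auto
  show "f x < b'"
  proof (cases "\<alpha> = a1")
    case True
    then have "\<not> ty0" using a lose by auto
    then have "x < xc" using a True a0_ne_a1 unfolding R'_def by auto
    then have "f x < f xc" using m True xc by (intro mono[of a1]) auto
    then show ?thesis using xc by auto
  next
    case False
    then show ?thesis using in_img[OF m] a1_less[OF False] by (auto simp: b'_def)
  qed
qed

lemma ipart': "ipart b' L' R'"
proof -
  have R0: "R' \<alpha> \<le> b'" for \<alpha>
  proof (cases "\<alpha> = a0")
    case True then show ?thesis using rgt_a1_le unfolding R'_def b'_def by auto
  next
    case False
    then have "rgt T \<alpha> \<le> b'" "xc \<le> b'" using a0_less[of \<alpha>] rgt_a1_le xc by (auto simp: b'_def)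
    then show ?thesis using False unfolding R'_def by auto
  qed
  have L0: "0 \<le> L' \<alpha>" for \<alpha>
    using ipart_L_ge[OF ipart_top, of \<alpha>] xc ipart_L_ge[OF ipart_top, of a1] unfolding L'_def by auto
  have dj: False if ab: "\<alpha> \<noteq> \<beta>" and x: "L' \<alpha> \<le> x" "x < R' \<alpha>" "L' \<beta> \<le> x" "x < R' \<beta>" for \<alpha> \<beta> x
  proof (cases ty0)
    case True
    then have "lft T \<gamma> \<le> x" "x < rgt T \<gamma>" if "\<gamma> = \<alpha> \<or> \<gamma> = \<beta>" for \<gamma>
      using that x b'_less rgt_a0 unfolding L'_def R'_def by (auto split: if_splits)
    then show False using ipart_unique[OF ipart_top, of \<alpha> x \<beta>] ab by blast
  next
    case False
    have nl: "loser T = a0" using False lose by auto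
    \<comment> \<open>In type 1 the new interval of \<open>a0\<close> is carved out of the old
      interval of \<open>a1\<close>, all others lie in their own old interval. Two new intervals can
      therefore only meet if their letters are \<open>a0\<close> and \<open>a1\<close>, and these
      are separated by \<open>xc\<close>.\<close>
    have s: "lft T (if \<gamma> = a0 then a1 else \<gamma>) \<le> x" "x < rgt T (if \<gamma> = a0 then a1 else \<gamma>)"
      if "\<gamma> = \<alpha> \<or> \<gamma> = \<beta>" for \<gamma>
      using that x False xc unfolding L'_def R'_def by (auto split: if_splits)
    have "(if \<alpha> = a0 then a1 else \<alpha>) = (if \<beta> = a0 then a1 else \<beta>)"
      using ipart_unique[OF ipart_top] s by blast
    then have "{\<alpha>, \<beta>} = {a0, a1}" using ab by (auto split: if_splits)
    then show False using x False a0_ne_a1 unfolding L'_def R'_def by (auto simp: doubleton_eq_iff)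
  qed
  have cov: "\<exists>\<alpha>. L' \<alpha> \<le> x \<and> x < R' \<alpha>" if x: "0 \<le> x" "x < b'" for x
  proof -
    obtain \<alpha> where a: "lft T \<alpha> \<le> x" "x < rgt T \<alpha>" using ipart_ex[OF ipart_top, of x] x b'_less by auto
    show ?thesis
    proof (cases ty0)
      case True
      then show ?thesis using a x by (intro exI[of _ \<alpha>]) (auto simp: L'_def R'_def)
    next
      case False
      have "\<alpha> \<noteq> a0" using a x False by (auto simp: b'_def)
      then show ?thesis using a False a0_ne_a1
        by (intro exI[of _ "if \<alpha> = a1 \<and> xc \<le> x then a0 else \<alpha>"]) (auto simp: L'_def R'_def)
    qed
  qed
  have "{L' \<alpha>..<R' \<alpha>} \<inter> {L' \<beta>..<R' \<beta>} = {}" if "\<alpha> \<noteq> \<beta>" for \<alpha> \<beta>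
    using dj[OF that] by (meson atLeastLessThan_iff disjoint_iff)
  moreover have "(\<Union>\<alpha>. {L' \<alpha>..<R' \<alpha>}) = {0..<b'}"
  proof (intro set_eqI iffI)
    fix x assume "x \<in> (\<Union>\<alpha>. {L' \<alpha>..<R' \<alpha>})"
    then obtain \<alpha> where "L' \<alpha> \<le> x" "x < R' \<alpha>" by auto
    then show "x \<in> {0..<b'}" using L0[of \<alpha>] R0[of \<alpha>] by auto
  next
    fix x assume "x \<in> {0..<b'}" then show "x \<in> (\<Union>\<alpha>. {L' \<alpha>..<R' \<alpha>})" using cov[of x] by auto
  qed
  ultimately show ?thesis unfolding ipart_def using L'_R' by blast
qed

lemma rvmap_bij: "bij_betw rvmap {0..<b'} {0..<b'}"
  unfolding bij_betw_def
proof
  have in0: "0 \<le> x \<and> x < b" if "x \<in> {0..<b'}" for x using that b'_less by auto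
  show "inj_on rvmap {0..<b'}"
  proof (rule inj_onI)
    fix x y assume x: "x \<in> {0..<b'}" and y: "y \<in> {0..<b'}" and e: "rvmap x = rvmap y"
    note m = maps[of x] maps[of y] in0[OF x] in0[OF y]
    show "x = y"
      using e m inj[of x y] inj[of "f x" "f y"] inj[of x "f y"] inj[of "f x" y] x y
      unfolding rvmap_def by (auto split: if_splits)
  qed
  show "rvmap ` {0..<b'} = {0..<b'}"
  proof
    show "rvmap ` {0..<b'} \<subseteq> {0..<b'}"
    proof
      fix z assume "z \<in> rvmap ` {0..<b'}"
      then obtain x where x: "x \<in> {0..<b'}" "z = rvmap x" by auto
      show "z \<in> {0..<b'}"
        using x in0[OF x(1)] maps[of x] maps[of "f x"] ret(6)[of x] unfolding rvmap_def by auto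
    qed
    show "{0..<b'} \<subseteq> rvmap ` {0..<b'}"
    proof
      fix z assume z: "z \<in> {0..<b'}"
      then obtain x where x: "0 \<le> x" "x < b" "f x = z" using surj[of z] b'_less by auto
      show "z \<in> rvmap ` {0..<b'}"
      proof (cases "x < b'")
        case True
        then have "rvmap x = z" using x z by (auto simp: rvmap_def)
        then show ?thesis using x True by (intro image_eqI[of _ _ x]) auto
      next
        case False
        \<comment> \<open>The preimage x of z was cut off. One preimage further back lies in the new
          domain and returns to z in two steps.\<close>
        obtain y where y: "0 \<le> y" "y < b" "f y = x" using surj[of x] x by auto
        have "y < b'" using ret(3)[of y] y False by auto
        moreover have "rvmap y = z" using y x False by (auto simp: rvmap_def)
        ultimately show ?thesis using y by (intro image_eqI[of _ _ y]) auto
      qed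
    qed
  qed
qed

lemma branch_loser_cont: "continuous_on {xc..<rgt T a1} (\<lambda>x. f (f x))"
proof (rule continuous_on_compose2[of "{lft T a0..<rgt T a0}" f])
  show "continuous_on {lft T a0..<rgt T a0} f" by (rule cont)
  show "continuous_on {xc..<rgt T a1} f"
    using cont[of a1] by (rule continuous_on_subset) (use xc in auto)
  show "f ` {xc..<rgt T a1} \<subseteq> {lft T a0..<rgt T a0}"
  proof
    fix z assume "z \<in> f ` {xc..<rgt T a1}"
    then obtain x where x: "xc \<le> x" "x < rgt T a1" "z = f x" by auto
    then show "z \<in> {lft T a0..<rgt T a0}"
      using ret(4,5)[of x] ret_conv[of x] ipart_mem[OF ipart_top, of a1 x] xc rgt_a0 by auto
  qed
qed

lemma branch: "continuous_on {L' \<alpha>..<R' \<alpha>} rvmap \<and> strict_mono_on {L' \<alpha>..<R' \<alpha>} rvmap"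
proof (cases "\<alpha> = loser T")
  case False
  have s: "{L' \<alpha>..<R' \<alpha>} \<subseteq> {lft T \<alpha>..<rgt T \<alpha>}" using sub_winner[OF False] by auto
  have e: "rvmap x = f x" if "x \<in> {L' \<alpha>..<R' \<alpha>}" for x
    using not_loser_lt[OF False] that by (auto simp: rvmap_def)
  have "continuous_on {L' \<alpha>..<R' \<alpha>} f" using cont s by (rule continuous_on_subset)
  then have c: "continuous_on {L' \<alpha>..<R' \<alpha>} rvmap" using e by (metis (no_types, lifting) continuous_on_cong)
  have "strict_mono_on {L' \<alpha>..<R' \<alpha>} rvmap"
    unfolding strict_mono_on_def using e s mono[of \<alpha>] by fastforce
  with c show ?thesis by blast
next
  case True
  have I: "{L' \<alpha>..<R' \<alpha>} = {xc..<rgt T a1}" using L'_loser True by auto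
  have e: "rvmap x = f (f x)" if "x \<in> {xc..<rgt T a1}" for x
    using ret_conv[of x] that by (auto simp: rvmap_def)
  have c: "continuous_on {xc..<rgt T a1} rvmap"
    using branch_loser_cont e by (metis (no_types, lifting) continuous_on_cong)
  have "strict_mono_on {xc..<rgt T a1} rvmap"
    unfolding strict_mono_on_def
  proof (intro allI impI)
    fix x y assume "x \<in> {xc..<rgt T a1} \<and> y \<in> {xc..<rgt T a1} \<and> x < y"
    then have x: "x \<in> {xc..<rgt T a1}" and y: "y \<in> {xc..<rgt T a1}" and xy: "x < y" by auto
    have "f x < f y" by (rule mono[of a1]) (use x y xy xc in auto)
    moreover have "lft T a0 \<le> f x" "f y < b"
      using ret(4,5)[of x] ret(4,5)[of y] ret_conv[of x] ret_conv[of y] x y xc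
        ipart_mem[OF ipart_top, of a1 x] ipart_mem[OF ipart_top, of a1 y] by auto
    ultimately have "f (f x) < f (f y)" using mono[of a0 "f x" "f y"] by (auto simp: rgt_a0)
    then show "rvmap x < rvmap y" using e x y by auto
  qed
  then show ?thesis unfolding I using c by blast
qed

lemma map_cong: "x \<in> {0..<b'} \<Longrightarrow> gmap (RV T) x = rvmap x" using RV_map_eq by auto

lemma part'_sub: "{L' \<alpha>..<R' \<alpha>} \<subseteq> {0..<b'}" using ipart' unfolding ipart_def by blast

lemma RV_giem: "is_giem (RV T)"
  unfolding is_giem_def RV_dom RV_part
proof (intro conjI)
  show "\<exists>a c. a < c \<and> {0..<b'} = {a..<c}" using b'_pos by blast
  show "\<forall>\<alpha>. \<exists>l r. l < r \<and> {L' \<alpha>..<R' \<alpha>} = {l..<r}" using L'_R' by blast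
  show "\<forall>\<alpha> \<beta>. \<alpha> \<noteq> \<beta> \<longrightarrow> {L' \<alpha>..<R' \<alpha>} \<inter> {L' \<beta>..<R' \<beta>} = {}"
    and "(\<Union>\<alpha>. {L' \<alpha>..<R' \<alpha>}) = {0..<b'}" using ipart' unfolding ipart_def by blast+
  show "bij_betw (gmap (RV T)) {0..<b'} {0..<b'}"
    using rvmap_bij map_cong by (metis (no_types, lifting) bij_betw_cong)
  show "\<forall>\<alpha>. continuous_on {L' \<alpha>..<R' \<alpha>} (gmap (RV T)) \<and> strict_mono_on {L' \<alpha>..<R' \<alpha>} (gmap (RV T)) \<and>
        is_interval (gmap (RV T) ` {L' \<alpha>..<R' \<alpha>})"
  proof
    fix \<alpha>
    have e: "gmap (RV T) x = rvmap x" if "x \<in> {L' \<alpha>..<R' \<alpha>}" for x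
      using part'_sub[of \<alpha>] that map_cong by blast
    have c: "continuous_on {L' \<alpha>..<R' \<alpha>} (gmap (RV T))"
      using branch[of \<alpha>] e by (metis (no_types, lifting) continuous_on_cong)
    moreover have "strict_mono_on {L' \<alpha>..<R' \<alpha>} (gmap (RV T))"
      using branch[of \<alpha>] e unfolding strict_mono_on_def by auto
    moreover have "is_interval (gmap (RV T) ` {L' \<alpha>..<R' \<alpha>})"
      using connected_continuous_image[OF c] by (simp add: is_interval_connected_1 connected_Ico)
    ultimately show "continuous_on {L' \<alpha>..<R' \<alpha>} (gmap (RV T)) \<and> strict_mono_on {L' \<alpha>..<R' \<alpha>} (gmap (RV T)) \<and>
        is_interval (gmap (RV T) ` {L' \<alpha>..<R' \<alpha>})" by blast
  qed
qed

lemma lft_RV: "lft (RV T) \<alpha> = L' \<alpha>" and rgt_RV: "rgt (RV T) \<alpha> = R' \<alpha>"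
  using L'_R'[of \<alpha>] unfolding lft_def rgt_def RV_part by auto

lemma ilft_RV: "\<alpha> \<noteq> loser T \<Longrightarrow> ilft (RV T) \<alpha> = ilft T \<alpha>" "ilft (RV T) (loser T) = f b'"
proof -
  have *: "ilft (RV T) \<beta> = rvmap (L' \<beta>)" for \<beta>
    unfolding ilft_def lft_RV by (rule map_cong) (use part'_sub[of \<beta>] L'_R'[of \<beta>] in auto)
  show "\<alpha> \<noteq> loser T \<Longrightarrow> ilft (RV T) \<alpha> = ilft T \<alpha>"
    using not_loser_lt[of \<alpha> "L' \<alpha>"] L'_R'[of \<alpha>] sub_winner[of \<alpha>] unfolding * unfolding rvmap_def ilft_def by auto
  show "ilft (RV T) (loser T) = f b'"
    unfolding * L'_loser rvmap_def xc(3) by auto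
qed

text \<open>A set initial in both new orders misses the winner, which is last in the order that the
  step leaves unchanged. It then misses the loser, which in the other order now lies beyond the
  winner. Only the loser has moved, and before the step it was last there, so the set was initial in
  both old orders.\<close>

lemma irred_RV: "irred (RV T)"
  unfolding irred_def
proof (intro allI impI notI)
  fix A :: "'a set" assume A: "A \<noteq> {} \<and> A \<noteq> UNIV" and d: "down (lft (RV T)) A \<and> down (ilft (RV T)) A"
  then obtain \<gamma> where g: "\<gamma> \<notin> A" by auto
  have d0: "L' \<alpha> < L' \<beta>" if "\<alpha> \<in> A" "\<beta> \<notin> A" for \<alpha> \<beta> using d that unfolding down_def lft_RV by auto
  have d1: "ilft (RV T) \<alpha> < ilft (RV T) \<beta>" if "\<alpha> \<in> A" "\<beta> \<notin> A" for \<alpha> \<beta> using d that unfolding down_def by auto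
  have "down (lft T) A \<and> down (ilft T) A"
  proof (cases ty0)
    case True
    have L: "L' = lft T" using True by (simp add: L'_def)
    have lo: "loser T = a1" using True lose by auto
    have w: "a0 \<notin> A" using d0[of a0 \<gamma>] g a0_max[of \<gamma>] unfolding L by (auto simp: not_less[symmetric])
    have "ilft T a0 < f b'"
      using mono[of a0 "lft T a0" b'] True rgt_a0 b'_less by (auto simp: b'_def ilft_def)
    then have l: "a1 \<notin> A" using d1[of a1 a0] w ilft_RV(1)[of a0] ilft_RV(2) lo a0_ne_a1 by force
    have "ilft T \<alpha> < ilft T \<beta>" if "\<alpha> \<in> A" "\<beta> \<notin> A" for \<alpha> \<beta>
    proof (cases "\<beta> = a1")
      case True
      have "\<alpha> \<noteq> a1" using l that by auto
      then show ?thesis using a1_less[of \<alpha>] ilft_less[of \<alpha>] True by auto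
    next
      case False
      then show ?thesis using d1[OF that] ilft_RV(1)[of \<alpha>] ilft_RV(1)[of \<beta>] l that lo by force
    qed
    then show ?thesis using d0 unfolding L down_def by blast
  next
    case False
    have lo: "loser T = a0" using False lose by auto
    have "b' = lft T a0" using False by (auto simp: b'_def)
    then have IL: "ilft (RV T) \<alpha> = ilft T \<alpha>" for \<alpha>
      using ilft_RV lo by (cases "\<alpha> = a0") (auto simp: ilft_def)
    have w: "a1 \<notin> A" using d1[of a1 \<gamma>] g a1_max[of \<gamma>] unfolding IL by (auto simp: not_less[symmetric])
    have "L' a1 < L' a0" using False xc_ty1 a0_ne_a1 by (auto simp: L'_def)
    then have l: "a0 \<notin> A" using d0[of a0 a1] w by force
    have "lft T \<alpha> < lft T \<beta>" if "\<alpha> \<in> A" "\<beta> \<notin> A" for \<alpha> \<beta>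
    proof (cases "\<beta> = a0")
      case True
      have "\<alpha> \<noteq> a0" using l that by auto
      then show ?thesis using a0_less[of \<alpha>] lft_less[of \<alpha>] True by auto
    next
      case False
      then show ?thesis using d0[OF that] l that \<open>\<not> ty0\<close> by (auto simp: L'_def split: if_splits)
    qed
    then show ?thesis using d1 unfolding IL down_def by blast
  qed
  then show False using irred[unfolded irred_def, THEN spec, of A] A by simp
qed

end

section \<open>Circle maps with two branches\<close>

definition sl :: "(real \<Rightarrow> real) \<Rightarrow> real \<Rightarrow> real \<Rightarrow> real" where
  "sl g x y = ln ((g y - g x) / (y - x))"

text \<open>The logarithmic slopes of g oscillate no more than the monotone function m; this form of bounded variation is
  stable under composition, and m restricted to disjoint intervals never adds up to more than its total increase.\<close>
definition slope_var :: "(real \<Rightarrow> real) \<Rightarrow> (real \<Rightarrow> real) \<Rightarrow> real \<Rightarrow> real \<Rightarrow> bool" where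
  "slope_var g m p q \<longleftrightarrow> strict_mono_on {p..q} g \<and> mono_on {p..q} m \<and>
     (\<forall>x y x' y'. p \<le> x \<longrightarrow> x < y \<longrightarrow> y \<le> q \<longrightarrow> p \<le> x' \<longrightarrow> x' < y' \<longrightarrow> y' \<le> q \<longrightarrow>
        \<bar>sl g x y - sl g x' y'\<bar> \<le> m (max y y') - m (min x x'))"

lemma slope_varD:
  assumes "slope_var g m p q" "p \<le> x" "x < y" "y \<le> q" "p \<le> x'" "x' < y'" "y' \<le> q"
  shows "\<bar>sl g x y - sl g x' y'\<bar> \<le> m (max y y') - m (min x x')"
  using assms by (auto simp: slope_var_def)

lemma slope_var_mono: "slope_var g m p q \<Longrightarrow> p \<le> x \<Longrightarrow> x < y \<Longrightarrow> y \<le> q \<Longrightarrow> g x < g y"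
  by (auto simp: slope_var_def strict_mono_on_def)

lemma slope_var_m_mono: "slope_var g m p q \<Longrightarrow> p \<le> x \<Longrightarrow> x \<le> y \<Longrightarrow> y \<le> q \<Longrightarrow> m x \<le> m y"
  by (auto simp: slope_var_def mono_on_def)

lemma slope_var_total:
  assumes "slope_var g m p q" "p \<le> x" "x < y" "y \<le> q" "p \<le> x'" "x' < y'" "y' \<le> q"
  shows "\<bar>sl g x y - sl g x' y'\<bar> \<le> m q - m p"
proof -
  have "m (max y y') \<le> m q" "m p \<le> m (min x x')"
    by (rule slope_var_m_mono[OF assms(1)]; use assms in linarith)+
  then show ?thesis using slope_varD[OF assms] by linarith
qed

lemma slope_var_subset:
  assumes "slope_var g m p q" "p \<le> p'" "q' \<le> q"
  shows "slope_var g m p' q'"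
  using assms unfolding slope_var_def strict_mono_on_def mono_on_def by auto

lemma sl_comp:
  assumes "slope_var g0 m0 p q" "slope_var g1 m1 p1 q1" "p1 \<le> g0 p" "g0 q \<le> q1"
    and "p \<le> x" "x < y" "y \<le> q"
  shows "sl (\<lambda>x. g1 (g0 x)) x y = sl g1 (g0 x) (g0 y) + sl g0 x y"
proof -
  have a: "g0 x < g0 y" "p1 \<le> g0 x" "g0 y \<le> q1"
    using slope_var_mono[OF assms(1), of x y] slope_var_mono[OF assms(1), of p x]
      slope_var_mono[OF assms(1), of y q] assms by (cases "p = x"; cases "y = q"; auto)+
  have b: "g1 (g0 x) < g1 (g0 y)" using slope_var_mono[OF assms(2)] a by auto
  have "(g1 (g0 y) - g1 (g0 x)) / (y - x) =
      ((g1 (g0 y) - g1 (g0 x)) / (g0 y - g0 x)) * ((g0 y - g0 x) / (y - x))"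
    using a assms by simp
  then show ?thesis unfolding sl_def using a b assms
    by (simp add: ln_mult ln_div)
qed

lemma slope_var_comp:
  assumes "slope_var g0 m0 p q" "slope_var g1 m1 p1 q1" "p1 \<le> g0 p" "g0 q \<le> q1"
  shows "slope_var (\<lambda>x. g1 (g0 x)) (\<lambda>x. m0 x + m1 (g0 x)) p q"
proof -
  have in1: "p1 \<le> g0 x \<and> g0 x \<le> q1" if "p \<le> x" "x \<le> q" for x
    using slope_var_mono[OF assms(1), of p x] slope_var_mono[OF assms(1), of x q] assms that
    by (cases "p = x"; cases "x = q"; auto)
  have le: "g0 x \<le> g0 y" if "p \<le> x" "x \<le> y" "y \<le> q" for x y
    using slope_var_mono[OF assms(1), of x y] that by (cases "x = y") auto
  show ?thesis unfolding slope_var_def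
  proof (intro conjI allI impI)
    show "strict_mono_on {p..q} (\<lambda>x. g1 (g0 x))"
      unfolding strict_mono_on_def
    proof (intro allI impI)
      fix x y assume "x \<in> {p..q} \<and> y \<in> {p..q} \<and> x < y"
      then have "x \<in> {p..q}" "y \<in> {p..q}" "x < y" by auto
      then show "g1 (g0 x) < g1 (g0 y)"
        using slope_var_mono[OF assms(1), of x y] in1[of x] in1[of y]
        by (intro slope_var_mono[OF assms(2)]) auto
    qed
    show "mono_on {p..q} (\<lambda>x. m0 x + m1 (g0 x))"
      unfolding mono_on_def
    proof (intro allI impI)
      fix x y assume "x \<in> {p..q} \<and> y \<in> {p..q} \<and> x \<le> y"
      then have "x \<in> {p..q}" "y \<in> {p..q}" "x \<le> y" by auto
      then show "m0 x + m1 (g0 x) \<le> m0 y + m1 (g0 y)"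
        using slope_var_m_mono[OF assms(1), of x y] slope_var_m_mono[OF assms(2), of "g0 x" "g0 y"]
          in1[of x] in1[of y] le[of x y] by auto
    qed
    fix x y x' y' assume a: "p \<le> x" "x < y" "y \<le> q" and a': "p \<le> x'" "x' < y'" "y' \<le> q"
    have mx: "g0 (max y y') = max (g0 y) (g0 y')" and mn: "g0 (min x x') = min (g0 x) (g0 x')"
      using le[of y y'] le[of y' y] le[of x x'] le[of x' x] a a' by (auto simp: max_def min_def)
    have 1: "\<bar>sl g0 x y - sl g0 x' y'\<bar> \<le> m0 (max y y') - m0 (min x x')"
      by (rule slope_varD[OF assms(1) a a'])
    have 2: "\<bar>sl g1 (g0 x) (g0 y) - sl g1 (g0 x') (g0 y')\<bar> \<le> m1 (max (g0 y) (g0 y')) - m1 (min (g0 x) (g0 x'))"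
      by (rule slope_varD[OF assms(2)])
         (use in1[of x] in1[of y] in1[of x'] in1[of y'] slope_var_mono[OF assms(1), of x y]
           slope_var_mono[OF assms(1), of x' y'] a a' in auto)
    show "\<bar>sl (\<lambda>x. g1 (g0 x)) x y - sl (\<lambda>x. g1 (g0 x)) x' y'\<bar>
        \<le> m0 (max y y') + m1 (g0 (max y y')) - (m0 (min x x') + m1 (g0 (min x x')))"
      unfolding sl_comp[OF assms a] sl_comp[OF assms a'] mx mn using 1 2 by linarith
  qed
qed

text \<open>A circle homeomorphism, with 0 and c identified, cut at the preimage u of 0; a is the
  image of 0. Passing to a first return map redistributes the increases of \<open>m0\<close> and
  \<open>m1\<close> without enlarging their total, so the same \<open>V\<close> serves at all
  levels.\<close>

definition cpair :: "real \<Rightarrow> real \<Rightarrow> real \<Rightarrow> real \<Rightarrow> (real \<Rightarrow> real) \<Rightarrow> (real \<Rightarrow> real) \<Rightarrow>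
    (real \<Rightarrow> real) \<Rightarrow> (real \<Rightarrow> real) \<Rightarrow> bool" where
  "cpair V u a c g0 g1 m0 m1 \<longleftrightarrow> 0 < u \<and> u < c \<and> 0 < a \<and> a < c \<and>
     g0 0 = a \<and> g0 u = c \<and> g1 u = 0 \<and> g1 c = a \<and>
     continuous_on {0..u} g0 \<and> continuous_on {u..c} g1 \<and> slope_var g0 m0 0 u \<and> slope_var g1 m1 u c \<and>
     (m0 u - m0 0) + (m1 c - m1 u) \<le> V"

text \<open>Absolute mean logarithmic slopes of the branches \<open>g0: [0,u] \<rightarrow> [a,c]\<close> and \<open>g1: [u,c] \<rightarrow> [0,a]\<close>.\<close>
definition sX :: "real \<Rightarrow> real \<Rightarrow> real \<Rightarrow> real" where "sX u a c = \<bar>ln ((c - a) / u)\<bar>"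
definition sY :: "real \<Rightarrow> real \<Rightarrow> real \<Rightarrow> real" where "sY u a c = \<bar>ln (a / (c - u))\<bar>"

lemma abs_diff_opposite: "(x::real) * y \<le> 0 \<Longrightarrow> \<bar>x - y\<bar> = \<bar>x\<bar> + \<bar>y\<bar>"
  by (auto simp: mult_le_0_iff abs_if)

text \<open>The two source lengths u and c - u and the two image lengths c - a and a both add up to
  c: if one branch stretches on average, the other shrinks.\<close>

lemma ln_opposite:
  fixes u a c :: real
  assumes "0 < u" "u < c" "0 < a" "a < c"
  shows "ln ((c - a) / u) * ln (a / (c - u)) \<le> 0"
proof (cases "c - a \<ge> u")
  case True
  then have "ln ((c - a) / u) \<ge> 0" "ln (a / (c - u)) \<le> 0" using assms by auto
  then show ?thesis by (simp add: mult_nonneg_nonpos)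
next
  case False
  then have "ln ((c - a) / u) \<le> 0" "ln (a / (c - u)) \<ge> 0" using assms by auto
  then show ?thesis by (simp add: mult_nonpos_nonneg)
qed

text \<open>After cutting at a, points of [0,u] return through \<open>g1\<close>. The mean log slope
  of the new first branch is the old one plus a slope of \<open>g1\<close>, and that slope is within
  V of the new second mean. The new means have opposite signs, so the sum of their absolute values
  is the absolute value of their difference, which is the old first mean up to V.\<close>

lemma cpair_step0:
  assumes c: "cpair V u a c g0 g1 m0 m1" and ua: "u < a"
  shows "cpair V u (g1 a) a (\<lambda>x. g1 (g0 x)) g1 (\<lambda>x. m0 x + m1 (g0 x)) m1"
    and "sX u a c \<ge> sX u (g1 a) a + sY u (g1 a) a - V" and "sY u a c \<ge> sY u (g1 a) a - V"
proof -
  have p: "0 < u" "u < c" "0 < a" "a < c" "g0 0 = a" "g0 u = c" "g1 u = 0" "g1 c = a"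
     "continuous_on {0..u} g0" "slope_var g0 m0 0 u" "slope_var g1 m1 u c" "(m0 u - m0 0) + (m1 c - m1 u) \<le> V"
     "continuous_on {u..c} g1"
    using c by (auto simp: cpair_def)
  have a': "0 < g1 a" "g1 a < a"
    using slope_var_mono[OF p(11), of u a] slope_var_mono[OF p(11), of a c] p ua by auto
  have s0: "slope_var (\<lambda>x. g1 (g0 x)) (\<lambda>x. m0 x + m1 (g0 x)) 0 u"
    by (rule slope_var_comp[OF p(10,11)]) (use p ua in auto)
  show cp: "cpair V u (g1 a) a (\<lambda>x. g1 (g0 x)) g1 (\<lambda>x. m0 x + m1 (g0 x)) m1"
    unfolding cpair_def
  proof (intro conjI)
    have "slope_var g1 m1 u a" by (rule slope_var_subset[OF p(11)]) (use p in auto)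
    then show "slope_var g1 m1 u a" .
    have "g0 ` {0..u} \<subseteq> {u..c}"
    proof
      fix y assume "y \<in> g0 ` {0..u}"
      then obtain x where x: "0 \<le> x" "x \<le> u" "y = g0 x" by auto
      show "y \<in> {u..c}"
        using slope_var_mono[OF p(10), of 0 x] slope_var_mono[OF p(10), of x u] p ua x
        by (cases "x = 0"; cases "x = u") auto
    qed
    then show "continuous_on {0..u} (\<lambda>x. g1 (g0 x))"
      by (rule continuous_on_compose2[OF p(13) p(9)])
    show "continuous_on {u..a} g1" by (rule continuous_on_subset[OF p(13)]) (use p in auto)
  qed (use p a' ua s0 in auto)
  have V1: "m1 c - m1 u \<le> V" using p(12) slope_var_m_mono[OF p(10), of 0 u] p by auto
  have e1: "\<bar>sl g1 a c - sl g1 u a\<bar> \<le> V" "\<bar>sl g1 u c - sl g1 u a\<bar> \<le> V"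
    using slope_var_total[OF p(11), of a c u a] slope_var_total[OF p(11), of u c u a] p ua V1 by auto
  have s: "ln ((a - g1 a) / u) = ln ((c - a) / u) + sl g1 a c"
    "ln (g1 a / (a - u)) = sl g1 u a" "ln (a / (c - u)) = sl g1 u c"
    unfolding sl_def using p a' by (simp_all add: ln_div)
  show "sX u a c \<ge> sX u (g1 a) a + sY u (g1 a) a - V"
    using abs_diff_opposite[OF ln_opposite[of u a "g1 a"]] e1 p a' ua unfolding sX_def sY_def s by auto
  show "sY u a c \<ge> sY u (g1 a) a - V" using e1 unfolding sX_def sY_def s by auto
qed


text \<open>The mirror case: the domain is cut at u, the part of \<open>g0\<close> beyond the
  preimage u' of u is followed by \<open>g1\<close>, and the composite becomes the second branch.
  \<open>sX\<close> and \<open>sY\<close> exchange their roles in the estimate.\<close>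

lemma cpair_step1:
  assumes c: "cpair V u a c g0 g1 m0 m1" and ua: "a < u"
  shows "\<exists>u'. 0 < u' \<and> u' < u \<and> g0 u' = u \<and> cpair V u' a u g0 (\<lambda>x. g1 (g0 x)) m0 (\<lambda>x. m0 x + m1 (g0 x)) \<and>
     sY u a c \<ge> sX u' a u + sY u' a u - V \<and> sX u a c \<ge> sX u' a u - V"
proof -
  have p: "0 < u" "u < c" "0 < a" "a < c" "g0 0 = a" "g0 u = c" "g1 u = 0" "g1 c = a"
     "continuous_on {0..u} g0" "slope_var g0 m0 0 u" "slope_var g1 m1 u c" "(m0 u - m0 0) + (m1 c - m1 u) \<le> V"
     "continuous_on {u..c} g1"
    using c by (auto simp: cpair_def)
  obtain u' where u': "0 \<le> u'" "u' \<le> u" "g0 u' = u"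
    using IVT'[of g0 0 u u] p ua by auto
  have u2: "0 < u'" "u' < u" using u' p ua by (cases "u' = 0"; cases "u' = u"; auto)+
  have s1: "slope_var (\<lambda>x. g1 (g0 x)) (\<lambda>x. m0 x + m1 (g0 x)) u' u"
    by (rule slope_var_comp[OF slope_var_subset[OF p(10)] p(11)]) (use p u' u2 in auto)
  have cp: "cpair V u' a u g0 (\<lambda>x. g1 (g0 x)) m0 (\<lambda>x. m0 x + m1 (g0 x))"
    unfolding cpair_def
  proof (intro conjI)
    show "slope_var g0 m0 0 u'" by (rule slope_var_subset[OF p(10)]) (use p u2 in auto)
    have "g0 ` {u'..u} \<subseteq> {u..c}"
    proof
      fix y assume "y \<in> g0 ` {u'..u}"
      then obtain x where x: "u' \<le> x" "x \<le> u" "y = g0 x" by auto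
      show "y \<in> {u..c}"
        using slope_var_mono[OF p(10), of u' x] slope_var_mono[OF p(10), of x u] p ua x u' u2
        by (cases "x = u'"; cases "x = u") auto
    qed
    moreover have "continuous_on {u'..u} g0"
      by (rule continuous_on_subset[OF p(9)]) (use u2 in auto)
    ultimately show "continuous_on {u'..u} (\<lambda>x. g1 (g0 x))"
      by (intro continuous_on_compose2[OF p(13)])
    show "continuous_on {0..u'} g0" by (rule continuous_on_subset[OF p(9)]) (use u2 in auto)
  qed (use p u' u2 ua s1 in auto)
  have V1: "m0 u - m0 0 \<le> V" using p(12) slope_var_m_mono[OF p(11), of u c] p by auto
  have e1: "\<bar>sl g0 u' u - sl g0 0 u'\<bar> \<le> V" "\<bar>sl g0 0 u - sl g0 0 u'\<bar> \<le> V"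
    using slope_var_total[OF p(10), of u' u 0 u'] slope_var_total[OF p(10), of 0 u 0 u'] p u2 V1 by auto
  have s: "ln (a / (u - u')) = ln (a / (c - u)) + sl g0 u' u"
    "ln ((u - a) / u') = sl g0 0 u'" "ln ((c - a) / u) = sl g0 0 u"
    unfolding sl_def using p u' u2 by (simp_all add: ln_div)
  have "sY u a c \<ge> sX u' a u + sY u' a u - V"
    using abs_diff_opposite[OF ln_opposite[of u' u a]] e1 p u2 ua unfolding sX_def sY_def s by auto
  moreover have "sX u a c \<ge> sX u' a u - V" using e1 unfolding sX_def sY_def s by auto
  ultimately show ?thesis using cp u' u2 by blast
qed

lemma cpair_V_nonneg: assumes "cpair V u a c g0 g1 m0 m1" shows "V \<ge> 0"
proof -
  have p: "0 < u" "u < c" "slope_var g0 m0 0 u" "slope_var g1 m1 u c" "(m0 u - m0 0) + (m1 c - m1 u) \<le> V"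
    using assms by (auto simp: cpair_def)
  show ?thesis using slope_var_m_mono[OF p(3), of 0 u] slope_var_m_mono[OF p(4), of u c] p by auto
qed

text \<open>f is the first return map to [0,b) of the circle map glued from g0 and g1.\<close>
definition induced :: "(real \<Rightarrow> real) \<Rightarrow> real \<Rightarrow> real \<Rightarrow> (real \<Rightarrow> real) \<Rightarrow> (real \<Rightarrow> real) \<Rightarrow> bool" where
  "induced f b u g0 g1 \<longleftrightarrow> (\<forall>x. 0 \<le> x \<longrightarrow> x < b \<longrightarrow>
     f x = (if x < u then (if g0 x < b then g0 x else g1 (g0 x)) else g1 x))"

text \<open>The domain length b may range above a and u and up to c. Within this range f can be
  renormalized many times while the pair stays the same; the pair is due for a change when b comes
  down to a or u.\<close>

definition coarse :: "real \<Rightarrow> (real \<Rightarrow> real) \<Rightarrow> real \<Rightarrow> real \<Rightarrow> real \<Rightarrow> real \<Rightarrow> (real \<Rightarrow> real) \<Rightarrow> (real \<Rightarrow> real) \<Rightarrow> bool" where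
  "coarse V f b u a c g0 g1 \<longleftrightarrow> (\<exists>m0 m1. cpair V u a c g0 g1 m0 m1) \<and> induced f b u g0 g1 \<and> u < b \<and> a < b \<and> b \<le> c"

lemma coarse_f0: "coarse V f b u a c g0 g1 \<Longrightarrow> f 0 = a" and coarse_fu: "coarse V f b u a c g0 g1 \<Longrightarrow> f u = 0"
  by (auto simp: coarse_def cpair_def induced_def)

lemma coarse_ranges:
  assumes "coarse V f b u a c g0 g1"
  shows "0 \<le> x \<Longrightarrow> x < u \<Longrightarrow> a \<le> g0 x \<and> g0 x < c"
    and "u \<le> x \<Longrightarrow> x < c \<Longrightarrow> 0 \<le> g1 x \<and> g1 x < a"
proof -
  obtain m0 m1 where "cpair V u a c g0 g1 m0 m1" using assms by (auto simp: coarse_def)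
  then have p: "0 < u" "u < c" "g0 0 = a" "g0 u = c" "g1 u = 0" "g1 c = a"
    "slope_var g0 m0 0 u" "slope_var g1 m1 u c" by (auto simp: cpair_def)
  show "0 \<le> x \<Longrightarrow> x < u \<Longrightarrow> a \<le> g0 x \<and> g0 x < c"
    using slope_var_mono[OF p(7), of 0 x] slope_var_mono[OF p(7), of x u] p by (cases "x = 0") auto
  show "u \<le> x \<Longrightarrow> x < c \<Longrightarrow> 0 \<le> g1 x \<and> g1 x < a"
    using slope_var_mono[OF p(8), of u x] slope_var_mono[OF p(8), of x c] p by (cases "x = u") auto
qed

text \<open>The new length \<open>b'\<close> is never below a or u, so the pair changes only if
  \<open>b'\<close> equals the larger of them; then \<open>cpair_step0\<close> or
  \<open>cpair_step1\<close> gives the new pair. Every alternative loses at most V in each mean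
  slope.\<close>

lemma coarse_step:
  assumes c: "coarse V f b u a c g0 g1" and b': "b' < b" "u \<le> b'" "a \<le> b'" "\<not> (u = b' \<and> a = b')"
    and f': "\<And>x. 0 \<le> x \<Longrightarrow> x < b' \<Longrightarrow> f' x = (if f x < b' then f x else f (f x))"
  shows "\<exists>u' a' c' g0' g1'. coarse V f' b' u' a' c' g0' g1' \<and>
     sX u a c \<ge> sX u' a' c' - V \<and> sY u a c \<ge> sY u' a' c' - V \<and>
     (b' = a \<longrightarrow> u' = u \<and> sX u a c \<ge> sX u' a' c' + sY u' a' c' - V) \<and>
     (b' = u \<longrightarrow> a' = a \<and> sY u a c \<ge> sX u' a' c' + sY u' a' c' - V) \<and>
     (b' \<noteq> a \<longrightarrow> a' = a) \<and> (b' \<noteq> u \<longrightarrow> u' = u)"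
proof -
  obtain m0 m1 where cp: "cpair V u a c g0 g1 m0 m1" using c by (auto simp: coarse_def)
  have p: "0 < u" "u < c" "0 < a" "a < c" "g0 0 = a" "g0 u = c" "g1 u = 0" "g1 c = a"
     "slope_var g0 m0 0 u" "slope_var g1 m1 u c"
    using cp by (auto simp: cpair_def)
  have bc: "b \<le> c" and ub: "u < b" "a < b" using c by (auto simp: coarse_def)
  have fx: "f x = (if x < u then (if g0 x < b then g0 x else g1 (g0 x)) else g1 x)" if "0 \<le> x" "x < b" for x
    using c that by (auto simp: coarse_def induced_def)
  note rg = coarse_ranges[OF c]
  have V: "V \<ge> 0" by (rule cpair_V_nonneg[OF cp])
  \<comment> \<open>Inducing in two stages is inducing at once: before any change of the pair, f' is
    already the map induced by the old pair on the shorter domain.\<close>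
  have f1: "f' x = (if x < u then (if g0 x < b' then g0 x else g1 (g0 x)) else g1 x)" if x: "0 \<le> x" "x < b'" for x
  proof (cases "x < u")
    case True
    have r: "a \<le> g0 x" "g0 x < c" using rg(1)[of x] x True by auto
    consider "g0 x < b'" | "b' \<le> g0 x" "g0 x < b" | "b \<le> g0 x" by linarith
    then show ?thesis
    proof cases
      case 1 then show ?thesis using f'[OF x] fx[of x] x b' True by auto
    next
      case 2 then show ?thesis using f'[OF x] fx[of x] fx[of "g0 x"] x b' True r p by auto
    next
      case 3
      then have "0 \<le> g1 (g0 x)" "g1 (g0 x) < a" using rg(2)[of "g0 x"] r ub by auto
      then show ?thesis using 3 f'[OF x] fx[of x] x b' True by auto
    qed
  next
    case False
    then have "0 \<le> g1 x" "g1 x < a" using rg(2)[of x] x bc b' by auto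
    then show ?thesis using f'[OF x] fx[of x] x b' False by auto
  qed
  have nn: "sX s t r \<ge> 0" "sY s t r \<ge> 0" for s t r by (simp_all add: sX_def sY_def)
  consider (same) "u < b'" "a < b'" | (zero) "b' = a" "u < a" | (one) "b' = u" "a < u"
    using b' by linarith
  then show ?thesis
  proof cases
    case same
    have "coarse V f' b' u a c g0 g1"
      using cp f1 same bc b' unfolding coarse_def induced_def by auto
    then show ?thesis using V same by (intro exI[of _ u] exI[of _ a] exI[of _ c] exI[of _ g0] exI[of _ g1]) auto
  next
    case zero
    note s = cpair_step0[OF cp zero(2)]
    have "g1 a < a" using rg(2)[of a] zero p by auto
    moreover have "induced f' b' u (\<lambda>x. g1 (g0 x)) g1"
      unfolding induced_def
    proof (intro allI impI)
      fix x assume x: "0 \<le> x" "x < b'"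
      show "f' x = (if x < u then (if g1 (g0 x) < b' then g1 (g0 x) else g1 (g1 (g0 x))) else g1 x)"
        using f1[OF x] rg(1)[of x] rg(2)[of "g0 x"] x zero by auto
    qed
    ultimately have "coarse V f' b' u (g1 a) a (\<lambda>x. g1 (g0 x)) g1"
      unfolding coarse_def using s(1) zero by auto
    moreover have "sX u a c \<ge> sX u (g1 a) a - V" using s(2) nn(2)[of u "g1 a" a] by linarith
    ultimately show ?thesis using zero s(2,3)
      by (intro exI[of _ u] exI[of _ "g1 a"] exI[of _ a] exI[of _ "\<lambda>x. g1 (g0 x)"] exI[of _ g1]) simp
  next
    case one
    obtain u' where u': "0 < u'" "u' < u" "g0 u' = u" and
      s: "cpair V u' a u g0 (\<lambda>x. g1 (g0 x)) m0 (\<lambda>x. m0 x + m1 (g0 x))"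
     "sY u a c \<ge> sX u' a u + sY u' a u - V" "sX u a c \<ge> sX u' a u - V"
      using cpair_step1[OF cp one(2)] by blast
    have "induced f' b' u' g0 (\<lambda>x. g1 (g0 x))"
      unfolding induced_def
    proof (intro allI impI)
      fix x assume x: "0 \<le> x" "x < b'"
      have "g0 x < b' \<longleftrightarrow> x < u'"
        using slope_var_mono[OF p(9), of x u'] slope_var_mono[OF p(9), of u' x] x u' one
        by (cases x u' rule: linorder_cases) auto
      then show "f' x = (if x < u' then (if g0 x < b' then g0 x else g1 (g0 (g0 x))) else g1 (g0 x))"
        using f1[OF x] x one by auto
    qed
    then have "coarse V f' b' u' a u g0 (\<lambda>x. g1 (g0 x))"
      unfolding coarse_def using s(1) one u' by auto
    moreover have "sY u a c \<ge> sY u' a u - V" using s(2) nn(1)[of u' a u] by linarith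
    ultimately show ?thesis using one s(2,3)
      by (intro exI[of _ u'] exI[of _ a] exI[of _ u] exI[of _ g0] exI[of _ "\<lambda>x. g1 (g0 x)"]) simp
  qed
qed

text \<open>Between x and y the map is \<open>g0\<close>, \<open>g1\<close>, or \<open>g1\<close>
  after \<open>g0\<close>. Each of the at most two secant slopes involved is within V of a mean
  slope bounded by B, whence twice B + V.\<close>

lemma coarse_slope_bound:
  assumes c: "coarse V f b u a c g0 g1" and X: "sX u a c \<le> B" and Y: "sY u a c \<le> B"
    and x: "0 \<le> x" "x < y" "y < b"
    and mono: "\<And>s t. x \<le> s \<Longrightarrow> s < t \<Longrightarrow> t \<le> y \<Longrightarrow> f s < f t"
  shows "\<bar>sl f x y\<bar> \<le> 2 * B + 2 * V"
proof -
  obtain m0 m1 where cp: "cpair V u a c g0 g1 m0 m1" using c by (auto simp: coarse_def)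
  have p: "0 < u" "u < c" "0 < a" "a < c" "g0 0 = a" "g0 u = c" "g1 u = 0" "g1 c = a"
     "slope_var g0 m0 0 u" "slope_var g1 m1 u c" "(m0 u - m0 0) + (m1 c - m1 u) \<le> V"
    using cp by (auto simp: cpair_def)
  have bc: "b \<le> c" and ub: "u < b" "a < b" using c by (auto simp: coarse_def)
  have fx: "f x = (if x < u then (if g0 x < b then g0 x else g1 (g0 x)) else g1 x)" if "0 \<le> x" "x < b" for x
    using c that by (auto simp: coarse_def induced_def)
  note rg = coarse_ranges[OF c]
  have V: "V \<ge> 0" by (rule cpair_V_nonneg[OF cp])
  have B: "B \<ge> 0" using X unfolding sX_def by linarith
  have mm: "m0 u - m0 0 \<le> V" "m1 c - m1 u \<le> V"
    using p(11) slope_var_m_mono[OF p(9), of 0 u] slope_var_m_mono[OF p(10), of u c] p by auto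
  have b0: "\<bar>sl g0 s t\<bar> \<le> B + V" if "0 \<le> s" "s < t" "t \<le> u" for s t
  proof -
    have "\<bar>sl g0 s t - sl g0 0 u\<bar> \<le> V" using slope_var_total[OF p(9), of s t 0 u] that mm p by auto
    moreover have "\<bar>sl g0 0 u\<bar> \<le> B" using X unfolding sX_def sl_def p by simp
    ultimately show ?thesis by linarith
  qed
  have b1: "\<bar>sl g1 s t\<bar> \<le> B + V" if "u \<le> s" "s < t" "t \<le> c" for s t
  proof -
    have "\<bar>sl g1 s t - sl g1 u c\<bar> \<le> V" using slope_var_total[OF p(10), of s t u c] that mm p by auto
    moreover have "\<bar>sl g1 u c\<bar> \<le> B" using Y unfolding sY_def sl_def p by simp
    ultimately show ?thesis by linarith
  qed
  have lt: "f x < f y" using mono[of x y] x by auto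
  have yb: "0 \<le> y" "y < b" "x < b" using x by auto
  note F = fx[OF x(1) yb(3)] fx[OF yb(1,2)]
  \<comment> \<open>In the first three cases both points are mapped by the same composition. The
    other three contradict that f increases from x to y, or that \<open>g0\<close> is
    increasing.\<close>
  consider "x < u" "y < u" "g0 x < b" "g0 y < b" | "x < u" "y < u" "b \<le> g0 x" "b \<le> g0 y"
    | "u \<le> x" "u \<le> y"
    | "x < u" "g0 x < b" "y < u \<longrightarrow> b \<le> g0 y" | "x < u" "y < u" "b \<le> g0 x" "g0 y < b"
    | "x < u" "b \<le> g0 x" "u \<le> y"
    using x by linarith
  then show ?thesis
  proof cases
    case 1
    then have "sl f x y = sl g0 x y" using F by (simp add: sl_def)
    then show ?thesis using b0[of x y] x 1 B V by auto
  next
    case 2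
    have "sl f x y = sl (\<lambda>x. g1 (g0 x)) x y" using F 2 by (simp add: sl_def)
    also have "\<dots> = sl g1 (g0 x) (g0 y) + sl g0 x y"
      by (rule sl_comp[OF slope_var_subset[OF p(9)] p(10), of x u]) (use 2 x p ub in auto)
    finally show ?thesis
      using b0[of x y] b1[of "g0 x" "g0 y"] x 2 ub rg(1)[of y] slope_var_mono[OF p(9), of x y] by auto
  next
    case 3
    then have "sl f x y = sl g1 x y" using F by (simp add: sl_def)
    then show ?thesis using b1[of x y] x 3 B V bc by auto
  next
    case 4
    have "a \<le> f x" using F 4 rg(1)[of x] x by auto
    moreover have "f y < a"
      using F 4 rg(2)[of y] rg(1)[of y] rg(2)[of "g0 y"] yb ub bc by (cases "y < u") auto
    ultimately show ?thesis using lt by auto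
  next
    case 5
    then show ?thesis using slope_var_mono[OF p(9), of x y] x by auto
  next
    case 6
    have "f x = g1 (g0 x)" "f y = g1 y" using F 6 by auto
    moreover have "g1 y < g1 (g0 x)"
      by (rule slope_var_mono[OF p(10)]) (use 6 yb rg(1)[of x] x in auto)
    ultimately show ?thesis using lt by auto
  qed
qed

text \<open>Within N steps the sum of both quantities is charged once to X and once to Y. So X n and
  Y n each dominate the sum at n + N up to an error, and the sum at least halves from n to n + N
  apart from that error.\<close>

lemma window_bounded:
  fixes X Y :: "nat \<Rightarrow> real"
  assumes nn: "\<And>n. X n \<ge> 0" "\<And>n. Y n \<ge> 0" and e: "e \<ge> 0"
    and d: "\<And>n. X n \<ge> X (Suc n) - e" "\<And>n. Y n \<ge> Y (Suc n) - e"
    and c0: "\<And>n. c0 n \<Longrightarrow> X n \<ge> X (Suc n) + Y (Suc n) - e"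
    and c1: "\<And>n. c1 n \<Longrightarrow> Y n \<ge> X (Suc n) + Y (Suc n) - e"
    and w: "\<And>n. \<exists>i. n \<le> i \<and> i < n + N \<and> c0 i" "\<And>n. \<exists>i. n \<le> i \<and> i < n + N \<and> c1 i"
  shows "\<exists>B. \<forall>n. X n \<le> B \<and> Y n \<le> B"
proof -
  have dX: "X n \<ge> X (n + j) - real j * e" and dY: "Y n \<ge> Y (n + j) - real j * e" for n j
  proof (induction j)
    case (Suc j)
    case 1 show ?case using Suc(1) d(1)[of "n + j"] by (simp add: algebra_simps)
    case 2 show ?case using Suc(2) d(2)[of "n + j"] by (simp add: algebra_simps)
  qed auto
  have XY: "X (Suc i) + Y (Suc i) \<ge> X (n + N) + Y (n + N) - 2 * real N * e" if "n \<le> i" "i < n + N" for n i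
  proof -
    define j where "j = n + N - Suc i"
    have j: "n + N = Suc i + j" using that by (simp add: j_def)
    have "real j * e \<le> real N * e" using j that e by (intro mult_right_mono) auto
    then show ?thesis using dX[of "Suc i" j] dY[of "Suc i" j] unfolding j by linarith
  qed
  have je: "real (i - n) * e + e \<le> real N * e" if "n \<le> i" "i < n + N" for i n
  proof -
    have "real (i - n) + 1 \<le> real N" using that by linarith
    from mult_right_mono[OF this e] show ?thesis by (simp add: algebra_simps)
  qed
  define t where "t n = X n + Y n" for n
  \<comment> \<open>The error consists of at most N e up to and including the step where the event
    occurs, and N e for each of X and Y from there to n + N.\<close>
  have half: "t (n + N) \<le> t n / 2 + 3 * real N * e" for n
  proof -
    obtain i where i: "n \<le> i" "i < n + N" "c0 i" using w(1) by blast
    obtain j where j: "n \<le> j" "j < n + N" "c1 j" using w(2) by blast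
    have "X n \<ge> X i - real (i - n) * e" "Y n \<ge> Y j - real (j - n) * e"
      using dX[of n "i - n"] dY[of n "j - n"] i j by auto
    then have "X n \<ge> t (n + N) - 3 * real N * e" "Y n \<ge> t (n + N) - 3 * real N * e"
      using c0[OF i(3)] c1[OF j(3)] XY[OF i(1,2)] XY[OF j(1,2)] je[OF i(1,2)] je[OF j(1,2)]
      unfolding t_def by linarith+
    then show ?thesis unfolding t_def by (simp add: field_simps)
  qed
  define M where "M = Max (t ` {..<N})"
  have N: "N > 0" using w(1)[of 0] by auto
  have tM: "t n \<le> M" if "n < N" for n unfolding M_def using that by (intro Max_ge) auto
  have M: "M \<ge> 0" using tM[of 0] N nn[of 0] unfolding t_def by auto
  have "t n \<le> M + 6 * real N * e" for n
  proof (induction n rule: less_induct)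
    case (less n)
    show ?case
    proof (cases "n < N")
      case True
      moreover have "0 \<le> 6 * real N * e" using e by auto
      ultimately show ?thesis using tM[of n] by linarith
    next
      case False
      then have "t n \<le> t (n - N) / 2 + 3 * real N * e" using half[of "n - N"] by auto
      moreover have "t (n - N) \<le> M + 6 * real N * e" using less False N by auto
      ultimately show ?thesis using M by linarith
    qed
  qed
  then have "X n \<le> M + 6 * real N * e \<and> Y n \<le> M + 6 * real N * e" for n
    using nn[of n] unfolding t_def by (smt (verit))
  then show ?thesis by blast
qed

section \<open>The renormalization sequence and its slopes\<close>

locale rvseq =
  fixes T :: "('a::finite) giem" and k :: nat
  assumes giem0: "is_giem T" and dom0: "gdom T = {0..<1}" and irr0: "irreducible_comb T"
    and kb: "k_bounded k T" and card: "CARD('a) \<ge> 2"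
begin

definition "b n = Sup (gdom (Rn n T))"
abbreviation "l n \<equiv> lft (Rn n T)"
abbreviation "r n \<equiv> rgt (Rn n T)"
abbreviation "il n \<equiv> ilft (Rn n T)"
abbreviation "f n \<equiv> gmap (Rn n T)"
abbreviation "A0 n \<equiv> giem.a0 (Rn n T)"
abbreviation "A1 n \<equiv> giem.a1 (Rn n T)"
abbreviation "win n \<equiv> winner (Rn n T)"
abbreviation "lose n \<equiv> loser (Rn n T)"
abbreviation "ty n \<equiv> l n (A0 n) < il n (A1 n)"
abbreviation "xc n \<equiv> rv_step.xc (Rn n T)"

lemma Rn_Suc: "Rn (Suc n) T = RV (Rn n T)" by (simp add: Rn_def)
lemma Rn_0: "Rn 0 T = T" by (simp add: Rn_def)

lemma b_0: "b 0 = 1" unfolding b_def Rn_0 dom0 by simp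

lemma step: "rv_step (Rn n T) (b n)"
proof -
  have "is_giem (Rn n T) \<and> gdom (Rn n T) = {0..<b n} \<and> irred (Rn n T)"
  proof (induction n)
    case 0
    interpret G: giem "Rn 0 T" "b 0"
      by unfold_locales (use giem0 dom0 b_0 Rn_0 in auto)
    show ?case using G.giem G.dom irr0 G.irreducible_iff Rn_0 by auto
  next
    case (Suc n)
    interpret G: giem "Rn n T" "b n" by unfold_locales (use Suc in auto)
    have "renormalizable (Rn n T)" using kb by (auto simp: k_bounded_def inf_renormalizable_def)
    then interpret S: rv_step "Rn n T" "b n"
      by unfold_locales (use Suc card G.renormalizable_iff in auto)
    have "b (Suc n) = S.b'" unfolding b_def Rn_Suc S.RV_dom using S.b'_pos by simp
    then show ?case unfolding Rn_Suc using S.RV_giem S.RV_dom S.irred_RV by auto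
  qed
  note P = this
  interpret G: giem "Rn n T" "b n" by unfold_locales (use P in auto)
  have "renormalizable (Rn n T)" using kb by (auto simp: k_bounded_def inf_renormalizable_def)
  then show ?thesis by unfold_locales (use P card G.renormalizable_iff in auto)
qed

lemma b'_eq: "rv_step.b' (Rn n T) = b (Suc n)"
proof -
  interpret S: rv_step "Rn n T" "b n" by (rule step)
  show ?thesis unfolding b_def Rn_Suc S.RV_dom using S.b'_pos by simp
qed

lemma b_Suc: "b (Suc n) = max (l n (A0 n)) (il n (A1 n))"
proof -
  interpret S: rv_step "Rn n T" "b n" by (rule step)
  show ?thesis using b'_eq[of n] S.b'_def by simp
qed

lemma b_pos: "0 < b n"
proof -
  interpret S: rv_step "Rn n T" "b n" by (rule step)
  show ?thesis using S.b'_pos S.b'_less by simp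
qed

lemma b_less: "b (Suc n) < b n"
proof -
  interpret S: rv_step "Rn n T" "b n" by (rule step)
  show ?thesis using S.b'_less b'_eq by simp
qed

lemma top: "ipart (b n) (l n) (r n)" and bot: "ipart (b n) (il n) (irgt (Rn n T))"
proof -
  interpret S: rv_step "Rn n T" "b n" by (rule step)
  show "ipart (b n) (l n) (r n)" "ipart (b n) (il n) (irgt (Rn n T))" by (rule S.ipart_top S.ipart_bot)+
qed

lemma il_eq: "il n \<alpha> = f n (l n \<alpha>)" by (simp add: ilft_def)

lemma A0_max: "l n \<alpha> \<le> l n (A0 n)" and A1_max: "il n \<alpha> \<le> il n (A1 n)"
  and A0_A1: "A0 n \<noteq> A1 n" and r_A0: "r n (A0 n) = b n" and ne: "l n (A0 n) \<noteq> il n (A1 n)"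
  and r_A1_le: "r n (A1 n) \<le> l n (A0 n)"
proof -
  interpret S: rv_step "Rn n T" "b n" by (rule step)
  show "l n \<alpha> \<le> l n (A0 n)" "il n \<alpha> \<le> il n (A1 n)" "A0 n \<noteq> A1 n" "r n (A0 n) = b n" "l n (A0 n) \<noteq> il n (A1 n)"
    "r n (A1 n) \<le> l n (A0 n)"
    by (rule S.a0_max S.a1_max S.a0_ne_a1 S.rgt_a0 S.ne S.rgt_a1_le)+
qed

lemma win_eq: "win n = (if ty n then A0 n else A1 n)" and lose_eq: "lose n = (if ty n then A1 n else A0 n)"
proof -
  interpret S: rv_step "Rn n T" "b n" by (rule step)
  show "win n = (if ty n then A0 n else A1 n)" "lose n = (if ty n then A1 n else A0 n)"
    by (rule S.win S.lose)+
qed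

lemma xc: "l n (A1 n) \<le> xc n" "xc n < r n (A1 n)" "f n (xc n) = b (Suc n)"
  "ty n \<Longrightarrow> xc n = l n (A1 n)" "\<not> ty n \<Longrightarrow> l n (A1 n) < xc n"
proof -
  interpret S: rv_step "Rn n T" "b n" by (rule step)
  show "l n (A1 n) \<le> xc n" "xc n < r n (A1 n)" "f n (xc n) = b (Suc n)"
  "ty n \<Longrightarrow> xc n = l n (A1 n)" "\<not> ty n \<Longrightarrow> l n (A1 n) < xc n"
    using S.xc S.xc_ty0 S.xc_ty1 b'_eq by auto
qed

lemma l_Suc: "l (Suc n) = (if ty n then l n else (l n)(A0 n := xc n))"
  and r_Suc: "r (Suc n) = (if ty n then (r n)(A0 n := b (Suc n)) else (r n)(A1 n := xc n, A0 n := r n (A1 n)))"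
proof -
  interpret S: rv_step "Rn n T" "b n" by (rule step)
  show "l (Suc n) = (if ty n then l n else (l n)(A0 n := xc n))"
    unfolding Rn_Suc using S.lft_RV S.L'_def by auto
  show "r (Suc n) = (if ty n then (r n)(A0 n := b (Suc n)) else (r n)(A1 n := xc n, A0 n := r n (A1 n)))"
    unfolding Rn_Suc b'_eq[symmetric] using S.rgt_RV S.R'_def by auto
qed

lemma il_Suc: "\<alpha> \<noteq> lose n \<Longrightarrow> il (Suc n) \<alpha> = il n \<alpha>" "il (Suc n) (lose n) = f n (b (Suc n))"
proof -
  interpret S: rv_step "Rn n T" "b n" by (rule step)
  show "\<alpha> \<noteq> lose n \<Longrightarrow> il (Suc n) \<alpha> = il n \<alpha>" "il (Suc n) (lose n) = f n (b (Suc n))"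
    using S.ilft_RV b'_eq unfolding Rn_Suc by auto
qed

lemma f_Suc: "0 \<le> x \<Longrightarrow> x < b (Suc n) \<Longrightarrow> f (Suc n) x = (if f n x < b (Suc n) then f n x else f n (f n x))"
proof -
  interpret S: rv_step "Rn n T" "b n" by (rule step)
  show "0 \<le> x \<Longrightarrow> x < b (Suc n) \<Longrightarrow> f (Suc n) x = (if f n x < b (Suc n) then f n x else f n (f n x))"
    using S.RV_map_eq S.rvmap_def b'_eq unfolding Rn_Suc by auto
qed

lemma f_mono: "l n \<alpha> \<le> x \<Longrightarrow> x < y \<Longrightarrow> y < r n \<alpha> \<Longrightarrow> f n x < f n y"
proof -
  interpret S: rv_step "Rn n T" "b n" by (rule step)
  show "l n \<alpha> \<le> x \<Longrightarrow> x < y \<Longrightarrow> y < r n \<alpha> \<Longrightarrow> f n x < f n y" by (rule S.mono)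
qed

lemma f_inj: "0 \<le> x \<Longrightarrow> x < b n \<Longrightarrow> 0 \<le> y \<Longrightarrow> y < b n \<Longrightarrow> f n x = f n y \<Longrightarrow> x = y"
proof -
  interpret S: rv_step "Rn n T" "b n" by (rule step)
  show "0 \<le> x \<Longrightarrow> x < b n \<Longrightarrow> 0 \<le> y \<Longrightarrow> y < b n \<Longrightarrow> f n x = f n y \<Longrightarrow> x = y" by (rule S.inj)
qed

lemma other: "\<exists>\<beta>::'a. \<beta> \<noteq> \<alpha>"
proof -
  interpret S: rv_step "Rn 0 T" "b 0" by (rule step)
  show ?thesis by (rule S.other)
qed

text \<open>Centring the two-sided window of \<open>k_bounded\<close> at N + k puts all its steps
  after N and before N + 2k, the form needed for arguments forward in time.\<close>

lemma chain:
  "\<exists>n1 p. N \<le> n1 \<and> n1 + p < N + 2 * k \<and> win n1 = \<beta> \<and> lose (n1 + p) = \<gamma> \<and>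
     (\<forall>i<p. lose (n1 + i) = win (n1 + i + 1))"
proof -
  obtain n1 p where np: "\<bar>int (N + k) - int n1\<bar> < int k" "\<bar>int (N + k) - int n1 - int p\<bar> < int k"
    "win n1 = \<beta>" "lose (n1 + p) = \<gamma>" "\<forall>i<p. lose (n1 + i) = win (n1 + i + 1)"
    using kb unfolding k_bounded_def by blast
  then have "N \<le> n1" "n1 + p < N + 2 * k" by linarith+
  with np show ?thesis by blast
qed

lemma wins: "\<exists>i. N \<le> i \<and> i < N + 2 * k \<and> win i = \<beta>"
proof -
  obtain n1 p where "N \<le> n1" "n1 + p < N + 2 * k" "win n1 = \<beta>" using chain by blast
  then show ?thesis by (intro exI[of _ n1]) auto
qed

lemma A0_Suc: "ty n \<Longrightarrow> A0 (Suc n) = A0 n"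
proof -
  assume "ty n"
  then have e: "l (Suc n) = l n" by (simp add: l_Suc)
  have "l n (A0 (Suc n)) = l n (A0 n)"
    by (rule antisym[OF A0_max A0_max[of "Suc n" "A0 n", unfolded e]])
  then show ?thesis by (rule ipart_inj[OF top])
qed

lemma A1_Suc: "\<not> ty n \<Longrightarrow> A1 (Suc n) = A1 n"
proof -
  assume t: "\<not> ty n"
  then have "b (Suc n) = l n (A0 n)" using b_Suc[of n] by auto
  then have e: "il (Suc n) \<alpha> = il n \<alpha>" for \<alpha>
    using il_Suc(1)[of \<alpha> n] il_Suc(2)[of n] t lose_eq[of n] by (cases "\<alpha> = A0 n") (auto simp: il_eq)
  have "il n (A1 (Suc n)) = il n (A1 n)"
    by (rule antisym[OF A1_max A1_max[of "Suc n" "A1 n", unfolded e]])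
  then show ?thesis by (rule ipart_inj[OF bot])
qed

text \<open>Suppose the cut never hits the image of 0. The letter at 0 is never last on top, so it
  stays at 0, and when it wins within 2k steps it does so as the last letter below. From then on
  type 0 would cut exactly at its image endpoint, so every step has type 1; this letter stays last
  below and wins each time, leaving no win to any other letter in the second 2k steps.\<close>

lemma zero_window: "\<exists>i. n \<le> i \<and> i < n + 4 * k \<and> b (Suc i) = f i 0"
proof (rule ccontr)
  assume "\<nexists>i. n \<le> i \<and> i < n + 4 * k \<and> b (Suc i) = f i 0"
  then have no: "b (Suc i) \<noteq> f i 0" if "n \<le> i" "i < n + 4 * k" for i using that by blast
  obtain \<xi> where xi: "l n \<xi> = 0" using ipart_first[OF top] by blast
  have nA0: "\<xi> \<noteq> A0 i" if "l i \<xi> = 0" for i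
  proof
    assume e: "\<xi> = A0 i"
    obtain \<beta> where "\<beta> \<noteq> \<xi>" using other by blast
    moreover have "l i \<beta> = 0" using A0_max[of i \<beta>] ipart_L_ge[OF top[of i], of \<beta>] e that by simp
    ultimately show False using ipart_inj[OF top[of i], of \<beta> \<xi>] that by auto
  qed
  have zj: "l (n + j) \<xi> = 0" for j
  proof (induction j)
    case (Suc j) then show ?case using nA0[of "n + j"] l_Suc[of "n + j"] by auto
  qed (use xi in auto)
  have z: "l i \<xi> = 0" if "n \<le> i" for i using that zj[of "i - n"] by simp
  obtain i1 where i1: "n \<le> i1" "i1 < n + 2 * k" "win i1 = \<xi>" using wins by blast
  have m: "\<not> ty i \<and> win i = \<xi>" if "n \<le> i" "i < n + 4 * k" "\<xi> = A1 i" for i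
    using that z[of i] no[of i] b_Suc[of i] win_eq[of i] by (auto simp: il_eq)
  have "\<xi> = A1 i1" using i1 win_eq[of i1] nA0[OF z[OF i1(1)]] by (auto split: if_splits)
  then have A: "i1 + j < n + 4 * k \<Longrightarrow> \<xi> = A1 (i1 + j)" for j
  proof (induction j)
    case (Suc j)
    then show ?case using m[of "i1 + j"] A1_Suc[of "i1 + j"] i1 by auto
  qed auto
  obtain \<beta> where be: "\<beta> \<noteq> \<xi>" using other by blast
  obtain i where i: "n + 2 * k \<le> i" "i < n + 2 * k + 2 * k" "win i = \<beta>" using wins by blast
  have "\<xi> = A1 i" using A[of "i - i1"] i i1 by auto
  then show False using m[of i] i be by auto
qed

text \<open>The dual argument, with top and bottom exchanged: the letter whose image starts at 0 has
  left endpoint U. If the cut never hits U, this letter becomes last on top and then wins every step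
  of the second half of the window.\<close>

lemma preimage_window:
  assumes U: "\<And>i. 0 \<le> U i \<and> U i < b i \<and> f i (U i) = 0" "\<And>i. b (Suc i) \<noteq> U i \<Longrightarrow> U (Suc i) = U i"
  shows "\<exists>i. n \<le> i \<and> i < n + 4 * k \<and> b (Suc i) = U i"
proof (rule ccontr)
  assume "\<nexists>i. n \<le> i \<and> i < n + 4 * k \<and> b (Suc i) = U i"
  then have no: "b (Suc i) \<noteq> U i" if "n \<le> i" "i < n + 4 * k" for i using that by blast
  obtain \<zeta> where "il n \<zeta> = 0" using ipart_first[OF bot] by blast
  then have ze: "l n \<zeta> = U n"
    using f_inj[of "l n \<zeta>" n "U n"] U(1)[of n] ipart_L_ge[OF top[of n], of \<zeta>] by (auto simp: il_eq)
  have tyA: "ty i" if "n \<le> i" "i < n + 4 * k" "l i \<zeta> = U i" "\<zeta> = A0 i" for i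
    using that no[of i] b_Suc[of i] by (auto simp: max_def split: if_splits)
  have lUj: "j \<le> 4 * k \<Longrightarrow> l (n + j) \<zeta> = U (n + j)" for j
  proof (induction j)
    case (Suc j)
    then have IH: "l (n + j) \<zeta> = U (n + j)" by auto
    have "U (Suc (n + j)) = U (n + j)" using U(2)[of "n + j"] no[of "n + j"] Suc by auto
    moreover have "l (Suc (n + j)) \<zeta> = l (n + j) \<zeta>"
      using l_Suc[of "n + j"] tyA[of "n + j"] IH Suc by auto
    ultimately show ?case using IH by simp
  qed (use ze in auto)
  have lU: "l i \<zeta> = U i" if "n \<le> i" "i \<le> n + 4 * k" for i
    using that lUj[of "i - n"] by simp
  obtain i1 where i1: "n \<le> i1" "i1 < n + 2 * k" "win i1 = \<zeta>" using wins by blast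
  have "\<zeta> \<noteq> A1 i1"
  proof
    assume e: "\<zeta> = A1 i1"
    have "il i1 \<zeta> = 0" using lU[of i1] U(1)[of i1] i1 by (auto simp: il_eq)
    moreover obtain \<beta> where "\<beta> \<noteq> \<zeta>" using other by blast
    moreover have "il i1 \<beta> = 0" using A1_max[of i1 \<beta>] ipart_L_ge[OF bot[of i1], of \<beta>] e \<open>il i1 \<zeta> = 0\<close> by simp
    ultimately show False using ipart_inj[OF bot[of i1], of \<beta> \<zeta>] by auto
  qed
  then have z: "\<zeta> = A0 i1" using i1 win_eq[of i1] by (auto split: if_splits)
  have A: "i1 + j < n + 4 * k \<Longrightarrow> \<zeta> = A0 (i1 + j)" for j
  proof (induction j)
    case (Suc j)
    then show ?case using tyA[of "i1 + j"] lU[of "i1 + j"] A0_Suc[of "i1 + j"] i1 by auto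
  qed (use z in auto)
  obtain \<beta> where be: "\<beta> \<noteq> \<zeta>" using other by blast
  obtain i where i: "n + 2 * k \<le> i" "i < n + 2 * k + 2 * k" "win i = \<beta>" using wins by blast
  have "\<zeta> = A0 i" using A[of "i - i1"] i i1 by auto
  then show False using tyA[of i] lU[of i] win_eq[of i] i be by auto
qed

lemma slopes_bounded:
  assumes c0: "coarse V (f 0) (b 0) u a c g0 g1"
  shows "\<exists>K. \<forall>n \<alpha> x y. l n \<alpha> \<le> x \<longrightarrow> x < y \<longrightarrow> y < r n \<alpha> \<longrightarrow> \<bar>sl (f n) x y\<bar> \<le> K"
proof -
  \<comment> \<open>A state is a tuple (u, a, c, g0, g1). \<open>P\<close> says that it represents
    level n and \<open>Q\<close> that a transition is as in \<open>coarse_step\<close>, so dependent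
    choice gives one coherent sequence of pairs.\<close>
  define P where "P n s = (case s of (u, a, c, g0, g1) \<Rightarrow> coarse V (f n) (b n) u a c g0 g1)" for n s
  define Q where "Q n s s' = (case s of (u, a, c, g0, g1) \<Rightarrow> case s' of (u', a', c', g0', g1') \<Rightarrow>
     sX u a c \<ge> sX u' a' c' - V \<and> sY u a c \<ge> sY u' a' c' - V \<and>
     (b (Suc n) = a \<longrightarrow> u' = u \<and> sX u a c \<ge> sX u' a' c' + sY u' a' c' - V) \<and>
     (b (Suc n) = u \<longrightarrow> a' = a \<and> sY u a c \<ge> sX u' a' c' + sY u' a' c' - V) \<and>
     (b (Suc n) \<noteq> a \<longrightarrow> a' = a) \<and> (b (Suc n) \<noteq> u \<longrightarrow> u' = u))"
    for n and s s' :: "real \<times> real \<times> real \<times> (real \<Rightarrow> real) \<times> (real \<Rightarrow> real)"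
  have "\<exists>s'. P (Suc n) s' \<and> Q n s s'" if Pn: "P n s" for n s
  proof -
    obtain u a c g0 g1 where s: "s = (u, a, c, g0, g1)" by (metis prod_cases5)
    have c: "coarse V (f n) (b n) u a c g0 g1" using Pn unfolding P_def s by simp
    have a: "f n 0 = a" and u: "f n u = 0" using coarse_f0[OF c] coarse_fu[OF c] by auto
    have ub: "0 < u" "u < b n" using c by (auto simp: coarse_def cpair_def)
    obtain \<zeta> where "il n \<zeta> = 0" using ipart_first[OF bot] by blast
    then have ze: "l n \<zeta> = u"
      using f_inj[of "l n \<zeta>" n u] u ub ipart_L_ge[OF top[of n], of \<zeta>] by (auto simp: il_eq)
    obtain \<xi> where xi: "l n \<xi> = 0" using ipart_first[OF top] by blast
    have il: "il n \<xi> = a" using xi a by (simp add: il_eq)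
    \<comment> \<open>Both are left endpoints, u on top and a below, hence at most the last ones,
      whose maximum is the new length. As the last ones differ by renormalizability, the cut cannot
      equal u and a at once.\<close>
    have le: "u \<le> l n (A0 n)" "a \<le> il n (A1 n)" using A0_max[of n \<zeta>] A1_max[of n \<xi>] ze il by auto
    have "\<exists>u' a' c' g0' g1'. coarse V (f (Suc n)) (b (Suc n)) u' a' c' g0' g1' \<and>
     sX u a c \<ge> sX u' a' c' - V \<and> sY u a c \<ge> sY u' a' c' - V \<and>
     (b (Suc n) = a \<longrightarrow> u' = u \<and> sX u a c \<ge> sX u' a' c' + sY u' a' c' - V) \<and>
     (b (Suc n) = u \<longrightarrow> a' = a \<and> sY u a c \<ge> sX u' a' c' + sY u' a' c' - V) \<and>
     (b (Suc n) \<noteq> a \<longrightarrow> a' = a) \<and> (b (Suc n) \<noteq> u \<longrightarrow> u' = u)"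
      by (rule coarse_step[OF c b_less]) (use le b_Suc[of n] ne[of n] f_Suc in auto)
    then show ?thesis unfolding P_def Q_def s by auto
  qed
  moreover have "P 0 (u, a, c, g0, g1)" using c0 by (simp add: P_def)
  ultimately obtain S where S: "\<And>n. P n (S n)" "\<And>n. Q n (S n) (S (Suc n))"
    using dependent_nat_choice[of P Q] by blast
  define U where "U n = fst (S n)" for n
  define A where "A n = fst (snd (S n))" for n
  define C where "C n = fst (snd (snd (S n)))" for n
  have co: "coarse V (f n) (b n) (U n) (A n) (C n) (fst (snd (snd (snd (S n))))) (snd (snd (snd (snd (S n)))))" for n
    using S(1)[of n] unfolding P_def U_def A_def C_def by (auto split: prod.splits)
  have q: "sX (U n) (A n) (C n) \<ge> sX (U (Suc n)) (A (Suc n)) (C (Suc n)) - V"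
    "sY (U n) (A n) (C n) \<ge> sY (U (Suc n)) (A (Suc n)) (C (Suc n)) - V"
    "b (Suc n) = A n \<Longrightarrow> sX (U n) (A n) (C n) \<ge> sX (U (Suc n)) (A (Suc n)) (C (Suc n)) + sY (U (Suc n)) (A (Suc n)) (C (Suc n)) - V"
    "b (Suc n) = U n \<Longrightarrow> sY (U n) (A n) (C n) \<ge> sX (U (Suc n)) (A (Suc n)) (C (Suc n)) + sY (U (Suc n)) (A (Suc n)) (C (Suc n)) - V"
    "b (Suc n) \<noteq> U n \<Longrightarrow> U (Suc n) = U n" for n
    using S(2)[of n] unfolding Q_def U_def A_def C_def by (auto split: prod.splits)
  have A0: "A n = f n 0" for n using coarse_f0[OF co[of n]] by simp
  have U0: "0 \<le> U n \<and> U n < b n \<and> f n (U n) = 0" for n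
    using coarse_fu[OF co[of n]] co[of n] unfolding coarse_def cpair_def by auto
  have V: "V \<ge> 0" using c0 cpair_V_nonneg unfolding coarse_def by blast
  have "\<exists>B. \<forall>n. sX (U n) (A n) (C n) \<le> B \<and> sY (U n) (A n) (C n) \<le> B"
  proof (rule window_bounded[where e = V and N = "4 * k" and ?c0.0 = "\<lambda>n. b (Suc n) = A n" and ?c1.0 = "\<lambda>n. b (Suc n) = U n"])
    show "\<exists>i. n \<le> i \<and> i < n + 4 * k \<and> b (Suc i) = A i" for n unfolding A0 by (rule zero_window)
    show "\<exists>i. n \<le> i \<and> i < n + 4 * k \<and> b (Suc i) = U i" for n by (rule preimage_window[OF U0 q(5)])
  qed (use q V in \<open>auto simp: sX_def sY_def\<close>)
  then obtain B where B: "\<And>n. sX (U n) (A n) (C n) \<le> B" "\<And>n. sY (U n) (A n) (C n) \<le> B" by blast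
  have "\<bar>sl (f n) x y\<bar> \<le> 2 * B + 2 * V" if x: "l n \<alpha> \<le> x" "x < y" "y < r n \<alpha>" for n \<alpha> x y
  proof (rule coarse_slope_bound[OF co[of n] B])
    show "0 \<le> x" using ipart_L_ge[OF top[of n], of \<alpha>] x by auto
    show "y < b n" using ipart_R_le[OF top[of n], of \<alpha>] x by auto
    show "f n s < f n t" if "x \<le> s" "s < t" "t \<le> y" for s t
      using f_mono[of n \<alpha> s t] that x by auto
  qed (use x in auto)
  then show ?thesis by blast
qed

end

section \<open>The initial circle map\<close>

text \<open>All log slopes lie between -B and B, so an interval with a point of M inside costs at
  most 2B; away from M the mean value theorem and the Lipschitz bound for ln D cost at most C per
  unit of length. This admits corners of G at the points of M.\<close>

lemma slope_var_piecewise: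
  fixes G D :: "real \<Rightarrow> real"
  assumes cont: "continuous_on {p..q} G" and M: "finite M" and BC: "0 \<le> B" "0 \<le> C"
    and D: "\<And>x. p < x \<Longrightarrow> x < q \<Longrightarrow> x \<notin> M \<Longrightarrow>
       (G has_real_derivative D x) (at x) \<and> exp (- B) \<le> D x \<and> D x \<le> exp B"
    and L: "\<And>x y. p < x \<Longrightarrow> x < y \<Longrightarrow> y < q \<Longrightarrow> {x..y} \<inter> M = {} \<Longrightarrow> \<bar>ln (D x) - ln (D y)\<bar> \<le> C * (y - x)"
  shows "slope_var G (\<lambda>t. C * t + 2 * B * real (card {\<mu> \<in> M. \<mu> < t})) p q"
proof -
  define m where "m = (\<lambda>t. C * t + 2 * B * real (card {\<mu> \<in> M. \<mu> < t}))"
  \<comment> \<open>The value 1 at the exceptional points is arbitrary except that it lies between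
    exp (- B) and exp B, so the bounds on the integrand hold everywhere.\<close>
  define D' where "D' x = (if p < x \<and> x < q \<and> x \<notin> M then D x else 1)" for x
  have D'b: "exp (- B) \<le> D' x \<and> D' x \<le> exp B" for x
    using D[of x] BC unfolding D'_def by auto
  have bd: "exp (- B) * (y - x) \<le> G y - G x \<and> G y - G x \<le> exp B * (y - x)"
    if "p \<le> x" "x < y" "y \<le> q" for x y
  proof -
    have "(D' has_integral (G y - G x)) {x..y}"
    proof (rule fundamental_theorem_of_calculus_interior_strong[OF M])
      fix t assume t: "t \<in> {x<..<y} - M"
      then have "(G has_real_derivative D t) (at t)" "D' t = D t"
        using D[of t] that by (auto simp: D'_def)
      then show "(G has_vector_derivative D' t) (at t)"
        by (simp add: has_real_derivative_iff_has_vector_derivative)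
    qed (use that cont in \<open>auto intro: continuous_on_subset\<close>)
    moreover have "((\<lambda>_. exp (- B)) has_integral (y - x) *\<^sub>R exp (- B)) {x..y}"
      "((\<lambda>_. exp B) has_integral (y - x) *\<^sub>R exp B) {x..y}"
      using has_integral_const_real[of "exp (- B)" x y] has_integral_const_real[of "exp B" x y] that
      by simp_all
    ultimately have "(y - x) *\<^sub>R exp (- B) \<le> G y - G x" "G y - G x \<le> (y - x) *\<^sub>R exp B"
      using D'b by (auto intro: has_integral_le)
    then show ?thesis by (simp add: mult.commute)
  qed
  have inc: "G x < G y" if "p \<le> x" "x < y" "y \<le> q" for x y
  proof -
    have "0 < exp (- B) * (y - x)" using that by simp
    then show ?thesis using bd[OF that] by linarith
  qed
  have slB: "\<bar>sl G x y\<bar> \<le> B" if "p \<le> x" "x < y" "y \<le> q" for x y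
  proof -
    have "exp (- B) \<le> (G y - G x) / (y - x)" "(G y - G x) / (y - x) \<le> exp B"
      using bd[OF that] that by (auto simp: field_simps)
    moreover have "0 < (G y - G x) / (y - x)" using inc[OF that] that by auto
    ultimately have "- B \<le> ln ((G y - G x) / (y - x))" "ln ((G y - G x) / (y - x)) \<le> B"
      by (metis exp_le_cancel_iff exp_ln)+
    then show ?thesis unfolding sl_def by linarith
  qed
  have cm: "card {\<mu> \<in> M. \<mu> < s} \<le> card {\<mu> \<in> M. \<mu> < t}" if "s \<le> t" for s t
    by (rule card_mono) (use M that in auto)
  have mmono: "m s \<le> m t" if "s \<le> t" for s t
    unfolding m_def using cm[OF that] that BC by (intro add_mono mult_left_mono) auto
  have mjump: "m t \<ge> m s + 2 * B" if "\<mu> \<in> M" "s \<le> \<mu>" "\<mu> < t" for s t \<mu>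
  proof -
    have "\<mu> \<in> {\<mu> \<in> M. \<mu> < t}" "\<mu> \<notin> {\<mu> \<in> M. \<mu> < s}" "{\<mu> \<in> M. \<mu> < s} \<subseteq> {\<mu> \<in> M. \<mu> < t}"
      using that by auto
    then have "{\<mu> \<in> M. \<mu> < s} \<subset> {\<mu> \<in> M. \<mu> < t}" by blast
    then have "card {\<mu> \<in> M. \<mu> < s} < card {\<mu> \<in> M. \<mu> < t}"
      using M by (intro psubset_card_mono) simp_all
    then have "real (card {\<mu> \<in> M. \<mu> < s}) + 1 \<le> real (card {\<mu> \<in> M. \<mu> < t})" by linarith
    then have "2 * B * (real (card {\<mu> \<in> M. \<mu> < s}) + 1) \<le> 2 * B * real (card {\<mu> \<in> M. \<mu> < t})"
      using BC by (intro mult_left_mono) auto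
    moreover have "C * s \<le> C * t" using that BC by (intro mult_left_mono) auto
    ultimately show ?thesis unfolding m_def by (simp add: algebra_simps)
  qed
  have mlin: "m t \<ge> m s + C * (t - s)" if "s \<le> t" for s t
  proof -
    have "2 * B * real (card {\<mu> \<in> M. \<mu> < s}) \<le> 2 * B * real (card {\<mu> \<in> M. \<mu> < t})"
      using cm[OF that] BC by (intro mult_left_mono) auto
    then show ?thesis unfolding m_def by (simp add: algebra_simps)
  qed
  have "slope_var G m p q"
    unfolding slope_var_def
  proof (intro conjI allI impI)
    show "strict_mono_on {p..q} G" unfolding strict_mono_on_def using inc by auto
    show "mono_on {p..q} m" unfolding mono_on_def using mmono by auto
    fix x y x' y' assume a: "p \<le> x" "x < y" "y \<le> q" and a': "p \<le> x'" "x' < y'" "y' \<le> q"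
    define s where "s = min x x'"
    define t where "t = max y y'"
    have st: "s \<le> x" "s \<le> x'" "y \<le> t" "y' \<le> t" "p \<le> s" "t \<le> q" using a a' by (auto simp: s_def t_def)
    have "\<bar>sl G x y - sl G x' y'\<bar> \<le> m t - m s"
    proof (cases "\<exists>\<mu>\<in>M. s < \<mu> \<and> \<mu> < t")
      case True
      then obtain \<mu> where "\<mu> \<in> M" "s < \<mu>" "\<mu> < t" by auto
      then have "m t \<ge> m s + 2 * B" using mjump[of \<mu> s t] by auto
      then show ?thesis using slB[OF a] slB[OF a'] by linarith
    next
      case False
      have mv: "\<exists>\<xi>. x < \<xi> \<and> \<xi> < y \<and> sl G x y = ln (D \<xi>)" if "s \<le> x" "x < y" "y \<le> t" for x y
      proof -
        have "\<exists>l \<xi>. x < \<xi> \<and> \<xi> < y \<and> DERIV G \<xi> :> l \<and> G y - G x = (y - x) * l"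
        proof (rule MVT[OF that(2)])
          show "continuous_on {x..y} G" by (rule continuous_on_subset[OF cont]) (use that st in auto)
          fix z assume "x < z" "z < y"
          then show "G differentiable (at z)"
            using D[of z] False that st unfolding real_differentiable_def by (meson less_le_trans le_less_trans)
        qed
        then obtain l' \<xi> where xi: "x < \<xi>" "\<xi> < y" "DERIV G \<xi> :> l'" "G y - G x = (y - x) * l'" by blast
        have "s < \<xi>" "\<xi> < t" using xi that by auto
        then have "DERIV G \<xi> :> D \<xi>" using D[of \<xi>] False st by auto
        then have "l' = D \<xi>" using xi(3) DERIV_unique by blast
        then show ?thesis using xi that by (intro exI[of _ \<xi>]) (auto simp: sl_def)
      qed
      obtain \<xi> where xi: "x < \<xi>" "\<xi> < y" "sl G x y = ln (D \<xi>)" using mv[of x y] a st by auto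
      obtain \<xi>' where xi': "x' < \<xi>'" "\<xi>' < y'" "sl G x' y' = ln (D \<xi>')" using mv[of x' y'] a' st by auto
      have in1: "s < \<xi>" "\<xi> < t" "s < \<xi>'" "\<xi>' < t" using xi xi' st by auto
      have "\<bar>ln (D \<xi>) - ln (D \<xi>')\<bar> \<le> C * \<bar>\<xi> - \<xi>'\<bar>"
      proof (cases \<xi> \<xi>' rule: linorder_cases)
        case less
        have "{\<xi>..\<xi>'} \<inter> M = {}" using False in1 by force
        then show ?thesis using L[of \<xi> \<xi>'] less in1 st by auto
      next
        case greater
        have "{\<xi>'..\<xi>} \<inter> M = {}" using False in1 by force
        then show ?thesis using L[of \<xi>' \<xi>] greater in1 st by auto
      qed auto
      also have "\<dots> \<le> C * (t - s)" using in1 BC by (intro mult_left_mono) auto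
      also have "\<dots> \<le> m t - m s" using mlin[of s t] a st by auto
      finally show ?thesis using xi xi' by simp
    qed
    then show "\<bar>sl G x y - sl G x' y'\<bar> \<le> m (max y y') - m (min x x')" unfolding s_def t_def .
  qed
  then show ?thesis unfolding m_def .
qed

lemma left_limit:
  fixes f :: "real \<Rightarrow> real"
  assumes pq: "p < q" and mono: "strict_mono_on {p..<q} f" and img: "f ` {p..<q} = {f p..<e}"
  shows "(f \<longlongrightarrow> e) (at q within {p..<q})"
proof (rule order_tendstoI)
  have fe: "f x < e" if "x \<in> {p..<q}" for x
    using img that by (metis atLeastLessThan_iff imageI)
  fix a assume "e < a"
  then have "f x < a" if "x \<in> {p..<q}" for x using fe[OF that] by simp
  then show "\<forall>\<^sub>F x in at q within {p..<q}. f x < a"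
    unfolding eventually_at using zero_less_one by blast
next
  fix a assume a: "a < e"
  have "f p < e" using img pq by (metis atLeastLessThan_iff imageI order_refl)
  define z where "z = (max a (f p) + e) / 2"
  have z: "a < z" "f p \<le> z" "z < e" using a \<open>f p < e\<close> by (auto simp: z_def max_def field_simps)
  then have "z \<in> f ` {p..<q}" unfolding img by auto
  then obtain x0 where x0: "x0 \<in> {p..<q}" "z = f x0" by auto
  have "a < f x" if "x \<in> {p..<q}" "dist x q < q - x0" for x
  proof -
    have "x0 < x" using that by (auto simp: dist_real_def)
    then have "f x0 < f x" using mono x0 that unfolding strict_mono_on_def by blast
    then show ?thesis using z x0 by simp
  qed
  then show "\<forall>\<^sub>F x in at q within {p..<q}. a < f x"
    unfolding eventually_at using x0 by (intro exI[of _ "q - x0"]) auto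
qed

lemma continuous_on_extend_right:
  fixes f :: "real \<Rightarrow> real"
  assumes pq: "p < q" and c: "continuous_on {p..<q} f" and mono: "strict_mono_on {p..<q} f"
    and img: "f ` {p..<q} = {f p..<e}"
  shows "continuous_on {p..q} (\<lambda>x. if x < q then f x else e)"
  unfolding continuous_on_def
proof
  fix x assume x: "x \<in> {p..q}"
  let ?G = "\<lambda>x. if x < q then f x else e"
  have w: "at x within {p..q} = at x within {p..<q}"
    if "x < q" by (rule at_within_nhd[of x "{..<q}"]) (use that in auto)
  have w': "at q within {p..q} = at q within {p..<q}"
    by (rule at_within_nhd[of q UNIV]) auto
  have ev: "\<forall>\<^sub>F y in at x within {p..<q}. f y = ?G y"
    unfolding eventually_at by (intro exI[of _ 1]) auto
  show "(?G \<longlongrightarrow> ?G x) (at x within {p..q})"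
  proof (cases "x < q")
    case True
    then have "(f \<longlongrightarrow> f x) (at x within {p..<q})" using c x unfolding continuous_on_def by auto
    then have "(?G \<longlongrightarrow> f x) (at x within {p..<q})" using ev by (rule Lim_transform_eventually)
    then show ?thesis using w True by simp
  next
    case False
    then have "x = q" using x by auto
    moreover have "(?G \<longlongrightarrow> e) (at q within {p..<q})"
      using left_limit[OF pq mono img] ev unfolding \<open>x = q\<close> by (rule Lim_transform_eventually)
    ultimately show ?thesis using w' by simp
  qed
qed

lemma Ico_split:
  fixes s :: real
  assumes U: "{x1..<y1} \<union> {0..<y2} = {0..<s}" and d: "{x1..<y1} \<inter> {0..<y2} = {}"
    and "x1 < y1" "0 < y2"
  shows "y2 = x1" "y1 = s"
proof -
  have x: "0 \<le> x1" "y1 \<le> s" "y2 \<le> s"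
  proof -
    have "x1 \<in> {x1..<y1} \<union> {0..<y2}" using assms(3) by simp
    then have "x1 \<in> {0..<s}" unfolding U .
    then show "0 \<le> x1" by auto
    show "y1 \<le> s"
    proof (rule ccontr)
      assume "\<not> y1 \<le> s"
      then have "max x1 s \<in> {x1..<y1}" using assms by auto
      then have "max x1 s \<in> {0..<s}" using U by blast
      then show False by auto
    qed
    show "y2 \<le> s"
    proof (rule ccontr)
      assume "\<not> y2 \<le> s"
      then have "max 0 s \<in> {0..<y2}" using assms by auto
      then have "max 0 s \<in> {0..<s}" using U by blast
      then show False by auto
    qed
  qed
  have y2: "y2 \<le> x1"
  proof (rule ccontr)
    assume "\<not> y2 \<le> x1"
    then have "x1 \<in> {x1..<y1} \<inter> {0..<y2}" using x assms by auto
    then show False using d by auto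
  qed
  have "\<not> y2 < x1"
  proof
    assume "y2 < x1"
    moreover have "x1 < s" using x assms by auto
    ultimately have "y2 \<in> {x1..<y1} \<union> {0..<y2}" unfolding U using assms(4) by simp
    then show False using \<open>y2 < x1\<close> by auto
  qed
  then show e: "y2 = x1" using y2 by auto
  have "\<not> y1 < s"
  proof
    assume "y1 < s"
    then have "y1 \<in> {x1..<y1} \<union> {0..<y2}" unfolding U using x(1) assms(3) by simp
    then show False using e assms by auto
  qed
  then show "y1 = s" using x by auto
qed

lemma Ico_three:
  fixes a b :: real
  assumes U: "{a..<b} \<union> {x1..<y1} \<union> {0..<y2} = {0..<b}"
    and d: "{a..<b} \<inter> {x1..<y1} = {}" "{a..<b} \<inter> {0..<y2} = {}" "{x1..<y1} \<inter> {0..<y2} = {}"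
    and "x1 < y1" "0 < y2" "a < b"
  shows "y2 = x1" "y1 = a"
proof -
  have "0 \<le> a"
  proof -
    have "a \<in> {a..<b} \<union> {x1..<y1} \<union> {0..<y2}" using assms(7) by simp
    then have "a \<in> {0..<b}" unfolding U .
    then show ?thesis by auto
  qed
  then have "{0..<b} - {a..<b} = {0..<a}" using assms(7) by auto
  moreover have "{0..<b} - {a..<b} = {x1..<y1} \<union> {0..<y2}" using U d by blast
  ultimately have "{x1..<y1} \<union> {0..<y2} = {0..<a}" by simp
  from Ico_split[OF this d(3) assms(5,6)] show "y2 = x1" "y1 = a" by auto
qed

lemma ipart_prev:
  assumes I: "ipart b L R" "0 < L \<beta>" shows "\<exists>\<alpha>. R \<alpha> = L \<beta>"
proof -
  obtain \<xi> where "L \<xi> = 0" using ipart_first[OF I(1)] by blast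
  then have ne: "{\<alpha>. R \<alpha> \<le> L \<beta>} \<noteq> {}" using ipart_order[OF I(1), of \<xi> \<beta>] I by auto
  define m where "m = Max (R ` {\<alpha>. R \<alpha> \<le> L \<beta>})"
  have "m \<in> R ` {\<alpha>. R \<alpha> \<le> L \<beta>}" unfolding m_def using ne by (intro Max_in) auto
  then obtain \<alpha> where a: "m = R \<alpha>" "R \<alpha> \<le> L \<beta>" by auto
  have "R \<alpha> = L \<beta>"
  proof (rule ccontr)
    assume "R \<alpha> \<noteq> L \<beta>"
    then have lt: "R \<alpha> < L \<beta>" using a by auto
    then obtain \<gamma> where g: "L \<gamma> = R \<alpha>" using ipart_next[OF I(1), of \<alpha>] ipart_L_ge[OF I(1), of \<beta>] by auto
    then have "R \<gamma> \<le> L \<beta>" using ipart_order[OF I(1), of \<gamma> \<beta>] lt by auto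
    then have "R \<gamma> \<le> m" unfolding m_def by (intro Max_ge) auto
    then show False using ipart_less[OF I(1), of \<gamma>] g a by auto
  qed
  then show ?thesis by blast
qed


text \<open>F is the logarithm of the derivative and \<open>\<psi>\<close> the quotient of the
  second by the first derivative. The quotient also varies through its denominator, which is merely
  Lipschitz, so the exponent is capped at 1; length at most 1 makes the powers comparable.\<close>

lemma smooth_data:
  fixes g g1 g2 :: "real \<Rightarrow> real"
  assumes lr: "l < r" "r - l \<le> 1" and nu: "\<nu> > 0"
    and d: "\<And>x. x \<in> {l..r} \<Longrightarrow> (g has_real_derivative g1 x) (at x within {l..r})"
      "\<And>x. x \<in> {l..r} \<Longrightarrow> (g1 has_real_derivative g2 x) (at x within {l..r})"
      "\<And>x. x \<in> {l..r} \<Longrightarrow> g1 x > 0"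
    and H: "\<And>x y. x \<in> {l..r} \<Longrightarrow> y \<in> {l..r} \<Longrightarrow> \<bar>g2 x - g2 y\<bar> \<le> H * \<bar>x - y\<bar> powr \<nu>"
  shows "\<exists>F \<psi> K. 0 \<le> K \<and> (\<forall>x\<in>{l..r}. (g has_real_derivative exp (F x)) (at x within {l..r}) \<and>
      (F has_real_derivative \<psi> x) (at x within {l..r}) \<and> \<bar>F x\<bar> \<le> K \<and> \<bar>\<psi> x\<bar> \<le> K) \<and>
      (\<forall>x\<in>{l..r}. \<forall>y\<in>{l..r}. \<bar>\<psi> x - \<psi> y\<bar> \<le> K * \<bar>x - y\<bar> powr (min \<nu> 1))"
proof -
  have c1: "continuous_on {l..r} g1" using d(2) by (rule DERIV_continuous_on)
  have ne: "{l..r} \<noteq> {}" using lr by auto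
  obtain x0 where x0: "x0 \<in> {l..r}" "\<And>x. x \<in> {l..r} \<Longrightarrow> g1 x0 \<le> g1 x"
    using continuous_attains_inf[OF compact_Icc ne c1] by auto
  obtain x1 where x1: "x1 \<in> {l..r}" "\<And>x. x \<in> {l..r} \<Longrightarrow> g1 x \<le> g1 x1"
    using continuous_attains_sup[OF compact_Icc ne c1] by auto
  define \<delta> where "\<delta> = g1 x0"
  have de: "\<delta> > 0" "\<And>x. x \<in> {l..r} \<Longrightarrow> \<delta> \<le> g1 x" using d(3)[OF x0(1)] x0 by (auto simp: \<delta>_def)
  define h where "h = \<bar>H\<bar>"
  define \<nu>' where "\<nu>' = min \<nu> 1"
  have pw: "\<bar>x - y\<bar> powr \<nu> \<le> \<bar>x - y\<bar> powr \<nu>'" "\<bar>x - y\<bar> \<le> \<bar>x - y\<bar> powr \<nu>'" if "x \<in> {l..r}" "y \<in> {l..r}" for x y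
  proof -
    have le: "\<bar>x - y\<bar> \<le> 1" using that lr by auto
    show "\<bar>x - y\<bar> powr \<nu> \<le> \<bar>x - y\<bar> powr \<nu>'"
      using powr_mono'[of \<nu>' \<nu> "\<bar>x - y\<bar>"] le by (auto simp: \<nu>'_def)
    show "\<bar>x - y\<bar> \<le> \<bar>x - y\<bar> powr \<nu>'"
      using powr_mono'[of \<nu>' 1 "\<bar>x - y\<bar>"] le by (auto simp: \<nu>'_def)
  qed
  have H': "\<bar>g2 x - g2 y\<bar> \<le> h * \<bar>x - y\<bar> powr \<nu>'" if "x \<in> {l..r}" "y \<in> {l..r}" for x y
  proof -
    have "\<bar>g2 x - g2 y\<bar> \<le> h * \<bar>x - y\<bar> powr \<nu>"
      using H[OF that] unfolding h_def by (smt (verit) mult_right_mono powr_ge_zero)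
    also have "\<dots> \<le> h * \<bar>x - y\<bar> powr \<nu>'" using pw(1)[OF that] by (intro mult_left_mono) (auto simp: h_def)
    finally show ?thesis .
  qed
  have p1: "\<bar>x - y\<bar> powr \<nu>' \<le> 1" if "x \<in> {l..r}" "y \<in> {l..r}" for x y
    using powr_mono2[of \<nu>' "\<bar>x - y\<bar>" 1] that lr nu by (auto simp: \<nu>'_def)
  define M where "M = \<bar>g2 l\<bar> + h"
  have M: "\<bar>g2 x\<bar> \<le> M" if "x \<in> {l..r}" for x
  proof -
    have "h * \<bar>x - l\<bar> powr \<nu>' \<le> h * 1" using p1[of x l] that lr by (intro mult_left_mono) (auto simp: h_def)
    then show ?thesis using H'[of x l] that lr unfolding M_def by auto
  qed
  have M0: "M \<ge> 0" by (simp add: M_def h_def)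
  have g1L: "\<bar>g1 x - g1 y\<bar> \<le> M * \<bar>x - y\<bar>" if "x \<in> {l..r}" "y \<in> {l..r}" for x y
    using field_differentiable_bound[of "{l..r}" g1 g2 M x y] d(2) M that by auto
  \<comment> \<open>The first two entries bound the logarithm of the derivative at its extreme
    values, the third bounds the nonlinearity, and the fourth is its Hoelder constant from the
    quotient rule for differences.\<close>
  define K where "K = max (max \<bar>ln \<delta>\<bar> \<bar>ln (g1 x1)\<bar>) (max (M / \<delta>) (h / \<delta> + M * M / (\<delta> * \<delta>)))"
  have K0: "K \<ge> 0" by (auto simp: K_def)
  have KM: "M / \<delta> \<le> K" "h / \<delta> + M * M / (\<delta> * \<delta>) \<le> K" by (simp_all add: K_def le_max_iff_disj)
  have A: "(g has_real_derivative exp (ln (g1 x))) (at x within {l..r}) \<and>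
      ((\<lambda>x. ln (g1 x)) has_real_derivative g2 x / g1 x) (at x within {l..r}) \<and> \<bar>ln (g1 x)\<bar> \<le> K \<and> \<bar>g2 x / g1 x\<bar> \<le> K"
    if x: "x \<in> {l..r}" for x
  proof (intro conjI)
    show "(g has_real_derivative exp (ln (g1 x))) (at x within {l..r})" using d(1)[OF x] d(3)[OF x] by simp
    show "((\<lambda>x. ln (g1 x)) has_real_derivative g2 x / g1 x) (at x within {l..r})"
      using d(2)[OF x] d(3)[OF x] by (auto intro!: derivative_eq_intros)
    have "ln \<delta> \<le> ln (g1 x)" "ln (g1 x) \<le> ln (g1 x1)" using de x x1(2)[OF x] d(3)[OF x] by auto
    then show "\<bar>ln (g1 x)\<bar> \<le> K" unfolding K_def by auto
    have "\<bar>g2 x / g1 x\<bar> \<le> M / \<delta>" unfolding abs_divide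
      using M[OF x] de(1) de(2)[OF x] M0 by (intro frac_le) auto
    then show "\<bar>g2 x / g1 x\<bar> \<le> K" using KM by linarith
  qed
  have B: "\<bar>g2 x / g1 x - g2 y / g1 y\<bar> \<le> K * \<bar>x - y\<bar> powr \<nu>'" if x: "x \<in> {l..r}" and y: "y \<in> {l..r}" for x y
  proof -
    have pos: "g1 x > 0" "g1 y > 0" using d(3) x y by auto
    have e: "g2 x / g1 x - g2 y / g1 y = (g2 x - g2 y) / g1 x + g2 y * (g1 y - g1 x) / (g1 x * g1 y)"
      using pos by (simp add: field_simps)
    let ?p = "\<bar>x - y\<bar> powr \<nu>'"
    have "\<bar>(g2 x - g2 y) / g1 x\<bar> \<le> h * ?p / \<delta>" unfolding abs_divide
      using H'[OF x y] de(1) de(2)[OF x] by (intro frac_le) (auto simp: h_def)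
    moreover have "\<bar>g2 y * (g1 y - g1 x) / (g1 x * g1 y)\<bar> \<le> (M * (M * ?p)) / (\<delta> * \<delta>)"
      unfolding abs_divide abs_mult
    proof (rule frac_le)
      have "\<bar>g1 y - g1 x\<bar> \<le> M * ?p"
        using g1L[OF x y] mult_left_mono[OF pw(2)[OF x y] M0] by linarith
      then show "\<bar>g2 y\<bar> * \<bar>g1 y - g1 x\<bar> \<le> M * (M * ?p)" using M[OF y] M0 by (intro mult_mono) auto
      show "\<delta> * \<delta> \<le> \<bar>g1 x\<bar> * \<bar>g1 y\<bar>" using de(1) de(2)[OF x] de(2)[OF y] by (intro mult_mono) auto
    qed (use M0 de in auto)
    ultimately have "\<bar>g2 x / g1 x - g2 y / g1 y\<bar> \<le> h * ?p / \<delta> + (M * (M * ?p)) / (\<delta> * \<delta>)"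
      unfolding e by linarith
    also have "\<dots> = (h / \<delta> + M * M / (\<delta> * \<delta>)) * ?p" by (simp add: algebra_simps)
    also have "\<dots> \<le> K * ?p" using KM by (intro mult_right_mono) auto
    finally show ?thesis .
  qed
  show ?thesis unfolding \<nu>'_def[symmetric]
    by (rule exI[of _ "\<lambda>x. ln (g1 x)"], rule exI[of _ "\<lambda>x. g2 x / g1 x"], rule exI[of _ K],
        rule conjI[OF K0 conjI], rule ballI, rule A, assumption, intro ballI, rule B)
qed

context giem
begin

text \<open>Writing the derivative as exp of F turns the chain rule for compositions into addition.
  One constant K bounds F and \<open>\<psi>\<close> and is also the Hoelder constant of
  \<open>\<psi>\<close>.\<close>

definition smooth0 :: "('a \<Rightarrow> real \<Rightarrow> real) \<Rightarrow> ('a \<Rightarrow> real \<Rightarrow> real) \<Rightarrow> ('a \<Rightarrow> real \<Rightarrow> real) \<Rightarrow> real \<Rightarrow> real \<Rightarrow> bool" where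
  "smooth0 g F \<psi> K \<nu> \<longleftrightarrow> 0 \<le> K \<and> (\<forall>\<alpha>. \<forall>x\<in>{lft T \<alpha>..<rgt T \<alpha>}. g \<alpha> x = f x) \<and>
     (\<forall>\<alpha>. \<forall>x\<in>{lft T \<alpha>..rgt T \<alpha>}. (g \<alpha> has_real_derivative exp (F \<alpha> x)) (at x within {lft T \<alpha>..rgt T \<alpha>}) \<and>
      (F \<alpha> has_real_derivative \<psi> \<alpha> x) (at x within {lft T \<alpha>..rgt T \<alpha>}) \<and> \<bar>F \<alpha> x\<bar> \<le> K \<and> \<bar>\<psi> \<alpha> x\<bar> \<le> K) \<and>
      (\<forall>\<alpha>. \<forall>x\<in>{lft T \<alpha>..rgt T \<alpha>}. \<forall>y\<in>{lft T \<alpha>..rgt T \<alpha>}. \<bar>\<psi> \<alpha> x - \<psi> \<alpha> y\<bar> \<le> K * \<bar>x - y\<bar> powr \<nu>)"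

lemma smooth0_ex:
  assumes C: "C2nu_branches \<nu> T" and nu: "\<nu> > 0" and b1: "b \<le> 1"
  shows "\<exists>g F \<psi> K. smooth0 g F \<psi> K (min \<nu> 1)"
proof -
  have "\<exists>g F \<psi> K. 0 \<le> K \<and> (\<forall>x\<in>{lft T \<alpha>..<rgt T \<alpha>}. g x = f x) \<and>
     (\<forall>x\<in>{lft T \<alpha>..rgt T \<alpha>}. (g has_real_derivative exp (F x)) (at x within {lft T \<alpha>..rgt T \<alpha>}) \<and>
      (F has_real_derivative \<psi> x) (at x within {lft T \<alpha>..rgt T \<alpha>}) \<and> \<bar>F x\<bar> \<le> K \<and> \<bar>\<psi> x\<bar> \<le> K) \<and>
      (\<forall>x\<in>{lft T \<alpha>..rgt T \<alpha>}. \<forall>y\<in>{lft T \<alpha>..rgt T \<alpha>}. \<bar>\<psi> x - \<psi> y\<bar> \<le> K * \<bar>x - y\<bar> powr (min \<nu> 1))" for \<alpha>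
  proof -
    have cl: "closure (gpart T \<alpha>) = {lft T \<alpha>..rgt T \<alpha>}" unfolding part using lft_less[of \<alpha>] by simp
    obtain g g1 g2 H where g: "\<forall>x\<in>gpart T \<alpha>. g x = f x"
      "\<forall>x\<in>closure (gpart T \<alpha>).
        (g has_real_derivative g1 x) (at x within closure (gpart T \<alpha>)) \<and>
        (g1 has_real_derivative g2 x) (at x within closure (gpart T \<alpha>)) \<and> g1 x > 0"
      "\<forall>x\<in>closure (gpart T \<alpha>). \<forall>y\<in>closure (gpart T \<alpha>). \<bar>g2 x - g2 y\<bar> \<le> H * \<bar>x - y\<bar> powr \<nu>"
      using C[unfolded C2nu_branches_def, rule_format, of \<alpha>] by blast
    have len: "rgt T \<alpha> - lft T \<alpha> \<le> 1"
      using ipart_L_ge[OF ipart_top, of \<alpha>] ipart_R_le[OF ipart_top, of \<alpha>] b1 by linarith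
    from smooth_data[OF lft_less len nu, of g g1 g2 H] g(2,3) obtain F \<psi> K where
      "0 \<le> K \<and> (\<forall>x\<in>{lft T \<alpha>..rgt T \<alpha>}. (g has_real_derivative exp (F x)) (at x within {lft T \<alpha>..rgt T \<alpha>}) \<and>
      (F has_real_derivative \<psi> x) (at x within {lft T \<alpha>..rgt T \<alpha>}) \<and> \<bar>F x\<bar> \<le> K \<and> \<bar>\<psi> x\<bar> \<le> K) \<and>
      (\<forall>x\<in>{lft T \<alpha>..rgt T \<alpha>}. \<forall>y\<in>{lft T \<alpha>..rgt T \<alpha>}. \<bar>\<psi> x - \<psi> y\<bar> \<le> K * \<bar>x - y\<bar> powr (min \<nu> 1))"
      unfolding cl by blast
    then show ?thesis using g(1) unfolding part by blast
  qed
  then obtain g F \<psi> K where s: "\<And>\<alpha>. 0 \<le> K \<alpha> \<and> (\<forall>x\<in>{lft T \<alpha>..<rgt T \<alpha>}. g \<alpha> x = f x) \<and>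
     (\<forall>x\<in>{lft T \<alpha>..rgt T \<alpha>}. (g \<alpha> has_real_derivative exp (F \<alpha> x)) (at x within {lft T \<alpha>..rgt T \<alpha>}) \<and>
      (F \<alpha> has_real_derivative \<psi> \<alpha> x) (at x within {lft T \<alpha>..rgt T \<alpha>}) \<and> \<bar>F \<alpha> x\<bar> \<le> K \<alpha> \<and> \<bar>\<psi> \<alpha> x\<bar> \<le> K \<alpha>) \<and>
      (\<forall>x\<in>{lft T \<alpha>..rgt T \<alpha>}. \<forall>y\<in>{lft T \<alpha>..rgt T \<alpha>}. \<bar>\<psi> \<alpha> x - \<psi> \<alpha> y\<bar> \<le> K \<alpha> * \<bar>x - y\<bar> powr (min \<nu> 1))"
    by metis
  define KK where "KK = (\<Sum>\<alpha>\<in>UNIV. K \<alpha>)"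
  have le: "K \<alpha> \<le> KK" for \<alpha> unfolding KK_def using s by (intro member_le_sum) auto
  have KK: "0 \<le> KK" unfolding KK_def using s by (intro sum_nonneg) auto
  have "smooth0 g F \<psi> KK (min \<nu> 1)" unfolding smooth0_def
  proof (intro conjI allI ballI)
    fix \<alpha> x y assume x: "x \<in> {lft T \<alpha>..rgt T \<alpha>}" and y: "y \<in> {lft T \<alpha>..rgt T \<alpha>}"
    have "\<bar>\<psi> \<alpha> x - \<psi> \<alpha> y\<bar> \<le> K \<alpha> * \<bar>x - y\<bar> powr (min \<nu> 1)" using s x y by blast
    also have "\<dots> \<le> KK * \<bar>x - y\<bar> powr (min \<nu> 1)" using le by (intro mult_right_mono) auto
    finally show "\<bar>\<psi> \<alpha> x - \<psi> \<alpha> y\<bar> \<le> KK * \<bar>x - y\<bar> powr (min \<nu> 1)" .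
  next
    fix \<alpha> x assume x: "x \<in> {lft T \<alpha>..rgt T \<alpha>}"
    show "\<bar>F \<alpha> x\<bar> \<le> KK" "\<bar>\<psi> \<alpha> x\<bar> \<le> KK" using s[of \<alpha>] x le[of \<alpha>] by (meson order_trans)+
  qed (use s KK in auto)
  then show ?thesis by blast
qed

end

section \<open>Genus one: discontinuities and blocks of continuity\<close>

context rv_step
begin

lemma disc_not_interior:
  assumes x: "lft T \<alpha> < x" "x < rgt T \<alpha>"
  shows "continuous (at x within {0..<b}) f"
proof -
  have "continuous_on {lft T \<alpha>..<rgt T \<alpha>} f" by (rule cont)
  then have "(f \<longlongrightarrow> f x) (at x within {lft T \<alpha>..<rgt T \<alpha>})"
    using x unfolding continuous_on_def by auto
  moreover have "at x within {0..<b} = at x within {lft T \<alpha>..<rgt T \<alpha>}"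
    by (rule at_within_nhd[of x "{lft T \<alpha><..<rgt T \<alpha>}"])
       (use x ipart_L_ge[OF ipart_top, of \<alpha>] ipart_R_le[OF ipart_top, of \<alpha>] in auto)
  ultimately show ?thesis by (simp add: continuous_within)
qed

lemma jump:
  assumes eta: "rgt T \<eta> = z" "z < b" and c: "continuous (at z within {0..<b}) f"
  shows "irgt T \<eta> = f z"
proof -
  have l: "lft T \<eta> < z" "0 \<le> lft T \<eta>" using lft_less[of \<eta>] eta ipart_L_ge[OF ipart_top, of \<eta>] by auto
  have "(f \<longlongrightarrow> f z) (at z within {0..<b})" using c by (simp add: continuous_within)
  then have 1: "(f \<longlongrightarrow> f z) (at z within {lft T \<eta>..<z})"
    by (rule tendsto_within_subset) (use l eta in auto)
  have sm: "strict_mono_on {lft T \<eta>..<z} f"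
    unfolding strict_mono_on_def using mono[of \<eta>] eta by auto
  have 2: "(f \<longlongrightarrow> irgt T \<eta>) (at z within {lft T \<eta>..<z})"
    by (rule left_limit[OF l(1) sm]) (use img[of \<eta>] eta in \<open>auto simp: ilft_def\<close>)
  have "at z within {lft T \<eta>..<z} \<noteq> bot"
    using l by (simp add: at_within_eq_bot_iff)
  then show ?thesis using tendsto_unique[OF _ 2 1] by simp
qed

text \<open>\<open>uu\<close> is the preimage of 0, and at \<open>vv\<close> the map climbs to b
  from the left. Continuity at \<open>uu\<close> would give the neighbouring interval an image
  ending at 0, continuity at \<open>vv\<close> would give f the value b. So these two points, if
  distinct, exhaust the discontinuities that genus one allows.\<close>

definition "uu = lft T (SOME \<zeta>. ilft T \<zeta> = 0)"
definition "vv = rgt T a1"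

lemma uu: "f uu = 0" "0 < uu" "uu < b" "\<exists>\<zeta>. lft T \<zeta> = uu \<and> ilft T \<zeta> = 0" and f0: "0 < f 0"
proof -
  obtain \<zeta> where z: "ilft T \<zeta> = 0" "lft T \<zeta> = uu"
    using someI_ex[OF ipart_first[OF ipart_bot]] unfolding uu_def by blast
  then show "f uu = 0" "\<exists>\<zeta>. lft T \<zeta> = uu \<and> ilft T \<zeta> = 0" by (auto simp: ilft_def)
  show "uu < b" using ipart_L_ge[OF ipart_top, of \<zeta>] z by auto
  obtain \<xi> where xi: "lft T \<xi> = 0" using ipart_first[OF ipart_top] by blast
  \<comment> \<open>Otherwise the first letter would be first in both orders, and its singleton
    would contradict irreducibility.\<close>
  have "f 0 \<noteq> 0"
  proof
    assume "f 0 = 0"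
    then have e: "ilft T \<xi> = 0" using xi by (simp add: ilft_def)
    have "lft T \<xi> < lft T \<beta>" "ilft T \<xi> < ilft T \<beta>" if "\<beta> \<noteq> \<xi>" for \<beta>
    proof -
      have "lft T \<xi> \<noteq> lft T \<beta>" "ilft T \<xi> \<noteq> ilft T \<beta>"
        using ipart_inj[OF ipart_top, of \<xi> \<beta>] ipart_inj[OF ipart_bot, of \<xi> \<beta>] that by metis+
      then show "lft T \<xi> < lft T \<beta>" "ilft T \<xi> < ilft T \<beta>"
        using ipart_L_ge[OF ipart_top, of \<beta>] ipart_L_ge[OF ipart_bot, of \<beta>] xi e by linarith+
    qed
    then have "down (lft T) {\<xi>}" "down (ilft T) {\<xi>}" unfolding down_def by simp_all
    moreover have "{\<xi>} \<noteq> UNIV" using other[of \<xi>] by auto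
    ultimately show False using irred[unfolded irred_def, THEN spec, of "{\<xi>}"] by simp
  qed
  moreover have "0 \<le> f 0" using maps[of 0] b'_pos b'_less by auto
  ultimately show "0 < f 0" by auto
  then have "uu \<noteq> 0" using \<open>f uu = 0\<close> by auto
  then show "0 < uu" using ipart_L_ge[OF ipart_top, of \<zeta>] z by auto
qed

lemma vv: "0 < vv" "vv < b"
  using lft_less[of a1] ipart_L_ge[OF ipart_top, of a1] rgt_a1_le ipart_L_ge[OF ipart_top, of a0]
  unfolding vv_def by auto

lemma disc_uu: "\<not> continuous (at uu within {0..<b}) f"
proof
  assume c: "continuous (at uu within {0..<b}) f"
  obtain \<zeta> where z: "lft T \<zeta> = uu" using uu by auto
  obtain \<eta> where "rgt T \<eta> = uu" using ipart_prev[OF ipart_top, of \<zeta>] z uu by auto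
  from jump[OF this uu(3) c] have "irgt T \<eta> = 0" using uu by auto
  then show False using ilft_less[of \<eta>] ipart_L_ge[OF ipart_bot, of \<eta>] by auto
qed

lemma disc_vv: "\<not> continuous (at vv within {0..<b}) f"
proof
  assume c: "continuous (at vv within {0..<b}) f"
  from jump[OF _ vv(2) c, of a1] have "f vv = b" using irgt_a1 by (auto simp: vv_def)
  then show False using maps[of vv] vv by auto
qed

lemma disc_lft: "\<not> continuous (at x within {0..<b}) f \<Longrightarrow> 0 \<le> x \<Longrightarrow> x < b \<Longrightarrow> \<exists>\<beta>. lft T \<beta> = x"
  using ipart_ex[OF ipart_top, of x] disc_not_interior[of _ x] by force

lemma block_cont:
  assumes pq: "0 \<le> p" "p < q" "q \<le> b" and c: "\<And>x. p < x \<Longrightarrow> x < q \<Longrightarrow> continuous (at x within {0..<b}) f"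
  shows "continuous_on {p..<q} f"
  unfolding continuous_on_def
proof
  fix x assume x: "x \<in> {p..<q}"
  show "(f \<longlongrightarrow> f x) (at x within {p..<q})"
  proof (cases "x = p")
    case False
    then have "(f \<longlongrightarrow> f x) (at x within {0..<b})" using c[of x] x by (auto simp: continuous_within)
    then show ?thesis by (rule tendsto_within_subset) (use pq in auto)
  next
    case True
    obtain \<alpha> where a: "lft T \<alpha> \<le> p" "p < rgt T \<alpha>" using ipart_ex[OF ipart_top, of p] pq by auto
    have "(f \<longlongrightarrow> f p) (at p within {lft T \<alpha>..<rgt T \<alpha>})" using cont[of \<alpha>] a unfolding continuous_on_def by auto
    then have "(f \<longlongrightarrow> f p) (at p within {p..<min q (rgt T \<alpha>)})"
      by (rule tendsto_within_subset) (use a in auto)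
    moreover have "at p within {p..<min q (rgt T \<alpha>)} = at p within {p..<q}"
      by (rule at_within_nhd[of p "{..<rgt T \<alpha>}"]) (use a in auto)
    ultimately show ?thesis using True by simp
  qed
qed

lemma same_letter:
  assumes "0 < x" "x < y" "y < b" "{x..y} \<inter> range (lft T) = {}"
  shows "\<exists>\<alpha>. lft T \<alpha> < x \<and> y < rgt T \<alpha>"
proof -
  obtain \<alpha> where a: "lft T \<alpha> \<le> x" "x < rgt T \<alpha>" using ipart_ex[OF ipart_top, of x] assms by auto
  have nm: "lft T \<beta> \<notin> {x..y}" for \<beta> using assms(4) by blast
  have "lft T \<alpha> \<noteq> x" using nm[of \<alpha>] assms(2) by auto
  moreover have "y < rgt T \<alpha>"
  proof (rule ccontr)
    assume n: "\<not> y < rgt T \<alpha>"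
    then obtain \<beta> where "lft T \<beta> = rgt T \<alpha>" using ipart_next[OF ipart_top, of \<alpha>] assms by auto
    then show False using nm[of \<beta>] a n by simp
  qed
  ultimately show ?thesis using a by (intro exI[of _ \<alpha>]) auto
qed

lemma deriv_interior:
  assumes s: "smooth0 g F \<psi> K \<nu>" and x: "lft T \<alpha> < x" "x < rgt T \<alpha>"
  shows "(f has_real_derivative exp (F \<alpha> x)) (at x)"
proof -
  have "(g \<alpha> has_real_derivative exp (F \<alpha> x)) (at x within {lft T \<alpha>..rgt T \<alpha>})"
    using s x unfolding smooth0_def by (meson atLeastAtMost_iff less_imp_le)
  then have "(g \<alpha> has_real_derivative exp (F \<alpha> x)) (at x within {lft T \<alpha><..<rgt T \<alpha>})"
    by (rule has_field_derivative_subset) auto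
  then have "(g \<alpha> has_real_derivative exp (F \<alpha> x)) (at x)"
    using at_within_open[of x "{lft T \<alpha><..<rgt T \<alpha>}"] x by auto
  then show ?thesis
  proof (rule has_field_derivative_transform_within_open[of _ _ _ "{lft T \<alpha><..<rgt T \<alpha>}"])
    fix y assume "y \<in> {lft T \<alpha><..<rgt T \<alpha>}"
    then show "g \<alpha> y = f y" using s unfolding smooth0_def by auto
  qed (use x in auto)
qed

definition "df x = deriv f x"

lemma df:
  assumes s: "smooth0 g F \<psi> K \<nu>"
  shows "0 < x \<Longrightarrow> x < b \<Longrightarrow> x \<notin> range (lft T) \<Longrightarrow>
       (f has_real_derivative df x) (at x) \<and> exp (- K) \<le> df x \<and> df x \<le> exp K"
    and "0 < x \<Longrightarrow> x < y \<Longrightarrow> y < b \<Longrightarrow> {x..y} \<inter> range (lft T) = {} \<Longrightarrow> \<bar>ln (df x) - ln (df y)\<bar> \<le> K * (y - x)"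
proof -
  have d: "df x = exp (F \<alpha> x)" if "lft T \<alpha> < x" "x < rgt T \<alpha>" for \<alpha> x
    using deriv_interior[OF s that] unfolding df_def by (rule DERIV_imp_deriv)
  have FK: "\<bar>F \<alpha> x\<bar> \<le> K" if "lft T \<alpha> < x" "x < rgt T \<alpha>" for \<alpha> x
    using s that unfolding smooth0_def by (meson atLeastAtMost_iff less_imp_le)
  show "(f has_real_derivative df x) (at x) \<and> exp (- K) \<le> df x \<and> df x \<le> exp K"
    if x: "0 < x" "x < b" "x \<notin> range (lft T)"
  proof -
    obtain \<alpha> where a: "lft T \<alpha> \<le> x" "x < rgt T \<alpha>" using ipart_ex[OF ipart_top, of x] x by auto
    have "lft T \<alpha> \<noteq> x" using x by auto
    then have a': "lft T \<alpha> < x" using a by auto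
    show ?thesis using deriv_interior[OF s a' a(2)] d[OF a' a(2)] FK[OF a' a(2)] by auto
  qed
  show "\<bar>ln (df x) - ln (df y)\<bar> \<le> K * (y - x)"
    if xy: "0 < x" "x < y" "y < b" "{x..y} \<inter> range (lft T) = {}"
  proof -
    obtain \<alpha> where a: "lft T \<alpha> < x" "y < rgt T \<alpha>" using same_letter[OF xy] by auto
    have "norm (F \<alpha> x - F \<alpha> y) \<le> K * norm (x - y)"
    proof (rule field_differentiable_bound[of "{lft T \<alpha>..rgt T \<alpha>}" "F \<alpha>" "\<psi> \<alpha>"])
      show "(F \<alpha> has_field_derivative \<psi> \<alpha> z) (at z within {lft T \<alpha>..rgt T \<alpha>})"
        "norm (\<psi> \<alpha> z) \<le> K" if "z \<in> {lft T \<alpha>..rgt T \<alpha>}" for z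
        using s that unfolding smooth0_def by auto
    qed (use a xy in auto)
    then show ?thesis using d[of \<alpha> x] d[of \<alpha> y] a xy by auto
  qed
qed

text \<open>A block of continuity may contain several letters. Continuity across their endpoints
  together with a positive derivative off this finite set makes f increase over the whole
  block.\<close>

lemma block_mono:
  assumes s: "smooth0 g F \<psi> K \<nu>" and pq: "0 \<le> p" "p < q" "q \<le> b" and c: "continuous_on {p..<q} f"
  shows "strict_mono_on {p..<q} f"
  unfolding strict_mono_on_def
proof (intro allI impI)
  fix x y assume xy: "x \<in> {p..<q} \<and> y \<in> {p..<q} \<and> x < y"
  have "slope_var f (\<lambda>t. K * t + 2 * K * real (card {\<mu> \<in> range (lft T). \<mu> < t})) x y"
  proof (rule slope_var_piecewise[where D = df])
    show "continuous_on {x..y} f" by (rule continuous_on_subset[OF c]) (use xy in auto)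
    show "0 \<le> K" "0 \<le> K" using s by (auto simp: smooth0_def)
    fix z assume "x < z" "z < y" "z \<notin> range (lft T)"
    then show "(f has_real_derivative df z) (at z) \<and> exp (- K) \<le> df z \<and> df z \<le> exp K"
      using df(1)[OF s, of z] xy pq by auto
  next
    fix z w assume "x < z" "z < w" "w < y" "{z..w} \<inter> range (lft T) = {}"
    then show "\<bar>ln (df z) - ln (df w)\<bar> \<le> K * (w - z)" using df(2)[OF s, of z w] xy pq by auto
  qed auto
  then show "f x < f y" by (rule slope_var_mono) (use xy in auto)
qed

lemma block:
  assumes s: "smooth0 g F \<psi> K \<nu>" and pq: "0 \<le> p" "p < q" "q \<le> b"
    and c: "\<And>x. p < x \<Longrightarrow> x < q \<Longrightarrow> continuous (at x within {0..<b}) f"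
  shows "continuous_on {p..<q} f \<and> strict_mono_on {p..<q} f \<and>
    f ` {p..<q} = {f p..<Sup (f ` {p..<q})} \<and> f p < Sup (f ` {p..<q}) \<and> Sup (f ` {p..<q}) \<le> b"
proof -
  have 1: "continuous_on {p..<q} f" by (rule block_cont[OF pq c])
  have 2: "strict_mono_on {p..<q} f" by (rule block_mono[OF s pq 1])
  have 3: "is_interval (f ` {p..<q})"
    using connected_continuous_image[OF 1] by (simp add: is_interval_connected_1 connected_Ico)
  have sub: "f ` {p..<q} \<subseteq> {0..<b}"
  proof
    fix z assume "z \<in> f ` {p..<q}"
    then obtain x where "x \<in> {p..<q}" "z = f x" by auto
    then show "z \<in> {0..<b}" using maps[of x] pq by auto
  qed
  then have 4: "bdd_above (f ` {p..<q})" by (meson bdd_above_Ico bdd_above_mono)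
  have 5: "Sup (f ` {p..<q}) \<le> b" using sub pq by (intro cSup_least) auto
  show ?thesis using strict_mono_image_half_open[OF pq(2) 2 3 4] 1 2 5 by blast
qed

text \<open>Serves to exclude further discontinuities: once the images of two adjacent blocks are
  seen to be adjacent in the same order, there is no jump between the blocks.\<close>

lemma cont_at_glue:
  assumes psq: "0 \<le> p" "p < s" "s < q" "q \<le> b"
    and c: "strict_mono_on {p..<s} f" "f ` {p..<s} = {f p..<f s}" "continuous_on {s..<q} f"
  shows "continuous (at s within {0..<b}) f"
proof -
  have "(f \<longlongrightarrow> f s) (at s within {p..<s})" by (rule left_limit[OF psq(2) c(1,2)])
  moreover have "(f \<longlongrightarrow> f s) (at s within {s..<q})" using c(3) psq unfolding continuous_on_def by auto
  ultimately have "(f \<longlongrightarrow> f s) (at s within ({p..<s} \<union> {s..<q}))" by (rule Lim_Un)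
  moreover have "at s within ({p..<s} \<union> {s..<q}) = at s within {0..<b}"
    by (rule at_within_nhd[of s "{p<..<q}"]) (use psq in auto)
  ultimately show ?thesis by (simp add: continuous_within)
qed

lemma sup_eq_b:
  assumes "p \<le> lft T a1" "0 \<le> p"
  shows "p < vv" "\<And>e. f ` {p..<vv} = {f p..<e} \<Longrightarrow> e \<le> b \<Longrightarrow> e = b"
proof -
  show "p < vv" using assms lft_less[of a1] by (auto simp: vv_def)
  fix e assume e: "f ` {p..<vv} = {f p..<e}" "e \<le> b"
  have "f ` {lft T a1..<vv} \<subseteq> f ` {p..<vv}" by (rule image_mono) (use assms in auto)
  then have sub: "{ilft T a1..<b} \<subseteq> {f p..<e}"
    unfolding e(1) using img[of a1] irgt_a1 by (simp add: vv_def)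
  show "e = b"
  proof (rule ccontr)
    assume "e \<noteq> b"
    then have "max e (ilft T a1) \<in> {ilft T a1..<b}" using e ilft_less[of a1] irgt_a1 by auto
    then have "max e (ilft T a1) \<in> {f p..<e}" using sub by blast
    then show False by auto
  qed
qed

lemma lft_le_a1: "lft T \<beta> < vv \<Longrightarrow> lft T \<beta> \<le> lft T a1"
  using ipart_order[OF ipart_top, of a1 \<beta>] unfolding vv_def by force

lemma blocks_partition:
  assumes "0 < s" "s < t" "t < b"
  shows "f ` {0..<s} \<union> f ` {s..<t} \<union> f ` {t..<b} = {0..<b}"
    "f ` {0..<s} \<inter> f ` {s..<t} = {}" "f ` {0..<s} \<inter> f ` {t..<b} = {}" "f ` {s..<t} \<inter> f ` {t..<b} = {}"
proof -
  have i: "inj_on f {0..<b}" using bij by (auto simp: bij_betw_def)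
  have "f ` {0..<s} \<union> f ` {s..<t} \<union> f ` {t..<b} = f ` ({0..<s} \<union> {s..<t} \<union> {t..<b})" by blast
  also have "{0..<s} \<union> {s..<t} \<union> {t..<b} = {0..<b}" using assms by auto
  finally show "f ` {0..<s} \<union> f ` {s..<t} \<union> f ` {t..<b} = {0..<b}" using bij by (auto simp: bij_betw_def)
  have dj: "f ` A \<inter> f ` B = {}" if "A \<subseteq> {0..<b}" "B \<subseteq> {0..<b}" "A \<inter> B = {}" for A B
    using inj_on_image_Int[OF i that(1,2)] that(3) by simp
  show "f ` {0..<s} \<inter> f ` {s..<t} = {}" "f ` {0..<s} \<inter> f ` {t..<b} = {}" "f ` {s..<t} \<inter> f ` {t..<b} = {}"
    by (rule dj; use assms in auto)+
qed

text \<open>The images of the blocks tile [0,b). One block has an image ending at b and one has an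
  image starting at 0; with at most three blocks this determines all the image endpoints.\<close>

lemma genus_one_blocks:
  assumes sm: "smooth0 g F \<psi> K \<nu>" and gen: "genus_one T"
  shows "\<exists>t. vv \<le> uu \<and> continuous_on {0..<vv} f \<and> strict_mono_on {0..<vv} f \<and> f ` {0..<vv} = {f 0..<b} \<and>
     continuous_on {uu..<b} f \<and> strict_mono_on {uu..<b} f \<and> f ` {uu..<b} = {0..<t} \<and>
     (vv < uu \<longrightarrow> t = f vv \<and> continuous_on {vv..<uu} f \<and> strict_mono_on {vv..<uu} f \<and> f ` {vv..<uu} = {f vv..<f 0}) \<and>
     (vv = uu \<longrightarrow> t = f 0)"
proof -
  define S where "S = {x \<in> {0..<b}. \<not> continuous (at x within {0..<b}) f}"
  have S: "finite S" "card S \<le> 2" using gen unfolding genus_one_def dom S_def by auto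
  have uS: "uu \<in> S" and vS: "vv \<in> S" using disc_uu disc_vv uu vv unfolding S_def by auto
  have cS: "continuous (at x within {0..<b}) f" if "0 \<le> x" "x < b" "x \<notin> S" for x
    using that unfolding S_def by auto
  have two: "S = {x, y}" if "x \<in> S" "y \<in> S" "x \<noteq> y" for x y
    using that S by (intro card_seteq[symmetric]) auto
  have lftS: "\<exists>\<beta>. lft T \<beta> = x" if "x \<in> S" for x using that disc_lft unfolding S_def by auto
  have f0b: "f 0 < b" using maps[of 0] vv by auto
  consider (lt) "vv < uu" | (gt) "uu < vv" | (eq) "uu = vv" by linarith
  then show ?thesis
  proof cases
    case lt
    have S2: "S = {uu, vv}" using two[OF uS vS] lt by auto
    have b1: "continuous_on {0..<vv} f \<and> strict_mono_on {0..<vv} f \<and>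
      f ` {0..<vv} = {f 0..<Sup (f ` {0..<vv})} \<and> f 0 < Sup (f ` {0..<vv}) \<and> Sup (f ` {0..<vv}) \<le> b"
      by (rule block[OF sm]) (use vv cS S2 lt in auto)
    have b2: "continuous_on {vv..<uu} f \<and> strict_mono_on {vv..<uu} f \<and>
      f ` {vv..<uu} = {f vv..<Sup (f ` {vv..<uu})} \<and> f vv < Sup (f ` {vv..<uu}) \<and> Sup (f ` {vv..<uu}) \<le> b"
      by (rule block[OF sm]) (use vv uu cS S2 lt in auto)
    have b3: "continuous_on {uu..<b} f \<and> strict_mono_on {uu..<b} f \<and>
      f ` {uu..<b} = {f uu..<Sup (f ` {uu..<b})} \<and> f uu < Sup (f ` {uu..<b}) \<and> Sup (f ` {uu..<b}) \<le> b"
      by (rule block[OF sm]) (use uu vv cS S2 lt in auto)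
    have e1: "Sup (f ` {0..<vv}) = b"
      by (rule sup_eq_b(2)[of 0]) (use b1 ipart_L_ge[OF ipart_top, of a1] in auto)
    have i1: "f ` {0..<vv} = {f 0..<b}" using b1 e1 by metis
    have i2: "f ` {vv..<uu} = {f vv..<Sup (f ` {vv..<uu})}" using b2 by blast
    have i3: "f ` {uu..<b} = {0..<Sup (f ` {uu..<b})}" using b3 uu(1) by metis
    note bp = blocks_partition[OF vv(1) lt uu(3)]
    define y1 where "y1 = Sup (f ` {vv..<uu})"
    define y2 where "y2 = Sup (f ` {uu..<b})"
    note i = i1 i2[folded y1_def] i3[folded y2_def]
    have "y2 = f vv \<and> y1 = f 0"
      using Ico_three[OF bp(1)[unfolded i] bp(2)[unfolded i] bp(3)[unfolded i] bp(4)[unfolded i]] b2 b3 uu(1) f0b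
      unfolding y1_def y2_def by auto
    then show ?thesis using b1 b2 b3 i lt by (intro exI[of _ y2]) auto
  next
    \<comment> \<open>Here the block from \<open>uu\<close> to \<open>vv\<close> would start at
      value 0 and climb to b, so its image would be everything and f 0 would be taken twice.\<close>
    case gt
    have S2: "S = {uu, vv}" using two[OF uS vS] gt by auto
    have b2: "continuous_on {uu..<vv} f \<and> strict_mono_on {uu..<vv} f \<and>
      f ` {uu..<vv} = {f uu..<Sup (f ` {uu..<vv})} \<and> f uu < Sup (f ` {uu..<vv}) \<and> Sup (f ` {uu..<vv}) \<le> b"
      by (rule block[OF sm]) (use vv uu cS S2 gt in auto)
    obtain \<beta> where "lft T \<beta> = uu" using lftS[OF uS] by auto
    then have "uu \<le> lft T a1" using lft_le_a1[of \<beta>] gt by auto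
    then have "Sup (f ` {uu..<vv}) = b" using sup_eq_b(2)[of uu] b2 uu by auto
    then have "f ` {uu..<vv} = {0..<b}" using b2 uu(1) by metis
    then have "f 0 \<in> f ` {uu..<vv}" using f0b f0 by auto
    then obtain x where "x \<in> {uu..<vv}" "f 0 = f x" by auto
    then have False using inj[of 0 x] uu vv by auto
    then show ?thesis ..
  next
    case eq
    \<comment> \<open>A further discontinuity s would split off a third block. On either side of
      \<open>uu\<close>, the tiling of [0,b) by the three images makes the images of the two blocks
      meeting at s adjacent, so f would be continuous at s.\<close>
    have S1: "S = {uu}"
    proof (rule ccontr)
      assume "S \<noteq> {uu}"
      then obtain s where s: "s \<in> S" "s \<noteq> uu" using uS by auto
      have S2: "S = {uu, s}" using two[OF uS s(1)] s by auto
      have sb: "0 \<le> s" "s < b" "\<not> continuous (at s within {0..<b}) f" using s unfolding S_def by auto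
      obtain \<beta> where be: "lft T \<beta> = s" using lftS[OF s(1)] by auto
      have s0: "0 < s"
      proof (rule ccontr)
        assume "\<not> 0 < s"
        then have "s = 0" using sb by auto
        have "continuous_on {0..<uu} f" by (rule block_cont) (use uu cS S2 \<open>s = 0\<close> in auto)
        then have "(f \<longlongrightarrow> f 0) (at 0 within {0..<uu})" using uu unfolding continuous_on_def by auto
        moreover have "at 0 within {0..<uu} = at 0 within {0..<b}"
          by (rule at_within_nhd[of 0 "{..<uu}"]) (use uu in auto)
        ultimately show False using sb(3) \<open>s = 0\<close> by (simp add: continuous_within)
      qed
      show False
      proof (cases "s < uu")
        case True
        have b1: "continuous_on {0..<s} f \<and> strict_mono_on {0..<s} f \<and>
          f ` {0..<s} = {f 0..<Sup (f ` {0..<s})} \<and> f 0 < Sup (f ` {0..<s}) \<and> Sup (f ` {0..<s}) \<le> b"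
          by (rule block[OF sm]) (use sb cS S2 s0 True in auto)
        have b2: "continuous_on {s..<uu} f \<and> strict_mono_on {s..<uu} f \<and>
          f ` {s..<uu} = {f s..<Sup (f ` {s..<uu})} \<and> f s < Sup (f ` {s..<uu}) \<and> Sup (f ` {s..<uu}) \<le> b"
          by (rule block[OF sm]) (use sb uu cS S2 True in auto)
        have b3: "continuous_on {uu..<b} f \<and> strict_mono_on {uu..<b} f \<and>
          f ` {uu..<b} = {f uu..<Sup (f ` {uu..<b})} \<and> f uu < Sup (f ` {uu..<b}) \<and> Sup (f ` {uu..<b}) \<le> b"
          by (rule block[OF sm]) (use uu cS S2 True in auto)
        have "s \<le> lft T a1" using lft_le_a1[of \<beta>] be True eq by auto
        then have e: "Sup (f ` {s..<uu}) = b" using sup_eq_b(2)[of s] b2 sb eq by auto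
        have i2: "f ` {s..<uu} = {f s..<b}" using b2 e by metis
        have i3: "f ` {uu..<b} = {0..<Sup (f ` {uu..<b})}" using b3 uu(1) by metis
        note bp = blocks_partition[OF s0 True uu(3)]
        define y1 where "y1 = Sup (f ` {0..<s})"
        define y2 where "y2 = Sup (f ` {uu..<b})"
        have i1: "f ` {0..<s} = {f 0..<y1}" using b1 y1_def by blast
        note i = i1 i2 i3[folded y2_def]
        have U: "{f s..<b} \<union> {f 0..<y1} \<union> {0..<y2} = {0..<b}" using bp(1) unfolding i by blast
        have d: "{f s..<b} \<inter> {f 0..<y1} = {}" "{f s..<b} \<inter> {0..<y2} = {}"
          using bp(2,4) unfolding i by blast+
        have "f 0 < y1" "0 < y2" "f s < b" using b1 b2 b3 e uu(1) unfolding y1_def y2_def by simp_all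
        then have "y1 = f s" by (rule Ico_three(2)[OF U d bp(3)[unfolded i]])
        then have "f ` {0..<s} = {f 0..<f s}" using i1 by simp
        then have "continuous (at s within {0..<b}) f"
          by (intro cont_at_glue[of 0 s uu]) (use b1 b2 s0 True uu in simp_all)
        then show False using sb(3) by contradiction
      next
        case False
        then have us: "uu < s" using s by auto
        have b1: "continuous_on {0..<uu} f \<and> strict_mono_on {0..<uu} f \<and>
          f ` {0..<uu} = {f 0..<Sup (f ` {0..<uu})} \<and> f 0 < Sup (f ` {0..<uu}) \<and> Sup (f ` {0..<uu}) \<le> b"
          by (rule block[OF sm]) (use sb uu cS S2 us in auto)
        have b2: "continuous_on {uu..<s} f \<and> strict_mono_on {uu..<s} f \<and>
          f ` {uu..<s} = {f uu..<Sup (f ` {uu..<s})} \<and> f uu < Sup (f ` {uu..<s}) \<and> Sup (f ` {uu..<s}) \<le> b"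
          by (rule block[OF sm]) (use sb uu cS S2 us in auto)
        have b3: "continuous_on {s..<b} f \<and> strict_mono_on {s..<b} f \<and>
          f ` {s..<b} = {f s..<Sup (f ` {s..<b})} \<and> f s < Sup (f ` {s..<b}) \<and> Sup (f ` {s..<b}) \<le> b"
          by (rule block[OF sm]) (use sb cS S2 us uu in auto)
        have e: "Sup (f ` {0..<uu}) = b"
          using sup_eq_b(2)[of 0] b1 eq ipart_L_ge[OF ipart_top, of a1] by auto
        have i1: "f ` {0..<uu} = {f 0..<b}" using b1 e by metis
        note bp = blocks_partition[OF uu(2) us sb(2)]
        define y1 where "y1 = Sup (f ` {uu..<s})"
        define y2 where "y2 = Sup (f ` {s..<b})"
        have i2: "f ` {uu..<s} = {0..<y1}" using b2 uu(1) y1_def by metis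
        have i3: "f ` {s..<b} = {f s..<y2}" using b3 y2_def by metis
        note i = i1 i2 i3
        have U: "{f 0..<b} \<union> {f s..<y2} \<union> {0..<y1} = {0..<b}" using bp(1) unfolding i by blast
        have d: "{f s..<y2} \<inter> {0..<y1} = {}" using bp(4) unfolding i by blast
        have "f s < y2" "0 < y1" using b2 b3 uu(1) unfolding y1_def y2_def by simp_all
        then have "y1 = f s" by (rule Ico_three(1)[OF U bp(3)[unfolded i] bp(2)[unfolded i] d _ _ f0b])
        then have "f ` {uu..<s} = {f uu..<f s}" using i2 uu(1) by simp
        then have "continuous (at s within {0..<b}) f"
          by (intro cont_at_glue[of uu s b]) (use b2 b3 us uu sb in simp_all)
        then show False using sb(3) by contradiction
      qed
    qed
    have b1: "continuous_on {0..<uu} f \<and> strict_mono_on {0..<uu} f \<and>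
      f ` {0..<uu} = {f 0..<Sup (f ` {0..<uu})} \<and> f 0 < Sup (f ` {0..<uu}) \<and> Sup (f ` {0..<uu}) \<le> b"
      by (rule block[OF sm]) (use uu cS S1 in auto)
    have b3: "continuous_on {uu..<b} f \<and> strict_mono_on {uu..<b} f \<and>
      f ` {uu..<b} = {f uu..<Sup (f ` {uu..<b})} \<and> f uu < Sup (f ` {uu..<b}) \<and> Sup (f ` {uu..<b}) \<le> b"
      by (rule block[OF sm]) (use uu cS S1 in auto)
    have e: "Sup (f ` {0..<uu}) = b"
      using sup_eq_b(2)[of 0] b1 eq ipart_L_ge[OF ipart_top, of a1] by auto
    have i1: "f ` {0..<uu} = {f 0..<b}" using b1 e by metis
    define y2 where "y2 = Sup (f ` {uu..<b})"
    have i3: "f ` {uu..<b} = {0..<y2}" using b3 uu(1) y2_def by metis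
    have ij: "inj_on f {0..<b}" using bij by (auto simp: bij_betw_def)
    have "f ` {0..<uu} \<union> f ` {uu..<b} = f ` ({0..<uu} \<union> {uu..<b})" by blast
    also have "{0..<uu} \<union> {uu..<b} = {0..<b}" using uu by auto
    finally have U: "{f 0..<b} \<union> {0..<y2} = {0..<b}" using bij i1 i3 by (auto simp: bij_betw_def)
    have "f ` {0..<uu} \<inter> f ` {uu..<b} = f ` ({0..<uu} \<inter> {uu..<b})"
      by (rule inj_on_image_Int[OF ij, symmetric]) (use uu in auto)
    then have d: "{f 0..<b} \<inter> {0..<y2} = {}" unfolding i1 i3 by auto
    have "y2 = f 0" using Ico_split(1)[OF U d] f0b b3 uu(1) y2_def by auto
    then show ?thesis using b1 b3 i1 i3 eq by (intro exI[of _ y2]) auto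
  qed
qed

end

section \<open>The circle map with two branches from which f is induced\<close>

context rv_step
begin

text \<open>If f has the two discontinuities \<open>vv < uu\<close>, the domain is enlarged by an interval of length \<open>uu - vv\<close> through
  which the middle block passes; with one discontinuity \<open>vv = uu\<close> nothing is added.\<close>
lemma coarse_initial:
  assumes sm: "smooth0 g F \<psi> K \<nu>" and gen: "genus_one T"
  shows "\<exists>V u a c g0 g1. coarse V f b u a c g0 g1"
proof -
  obtain t where vu: "vv \<le> uu" and
    X: "continuous_on {0..<vv} f" "strict_mono_on {0..<vv} f" "f ` {0..<vv} = {f 0..<b}" and
    Z: "continuous_on {uu..<b} f" "strict_mono_on {uu..<b} f" "f ` {uu..<b} = {0..<t}" and
    Y: "vv < uu \<longrightarrow> t = f vv \<and> continuous_on {vv..<uu} f \<and> strict_mono_on {vv..<uu} f \<and> f ` {vv..<uu} = {f vv..<f 0}" and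
    t: "vv = uu \<longrightarrow> t = f 0"
    using genus_one_blocks[OF sm gen] by blast
  have K: "0 \<le> K" using sm by (simp add: smooth0_def)
  have ex1: "exp (- K) \<le> 1" "1 \<le> exp K" using K by auto
  \<comment> \<open>c - b is the length of the middle block. \<open>g0\<close> translates this block
    to the interval from b to c, where \<open>g1\<close> applies f at the original position; the
    value a at c is the limit that makes \<open>g1\<close> continuous there.\<close>
  define a where "a = f 0"
  define c where "c = b + uu - vv"
  define g0 where "g0 x = (if x < vv then f x else b + (x - vv))" for x
  define g1 where "g1 x = (if x < b then f x else if x < c then f (x - b + vv) else a)" for x
  have bc: "b \<le> c" using vu by (simp add: c_def)
  have ab: "a < b" "0 < a" using maps[of 0] vv f0 by (auto simp: a_def)
  have "continuous_on ({0..vv} \<union> {vv..uu}) g0"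
  proof (rule continuous_on_closed_Un)
    have "continuous_on {0..vv} (\<lambda>x. if x < vv then f x else b)"
      by (rule continuous_on_extend_right[OF vv(1) X])
    then show "continuous_on {0..vv} g0"
      by (rule continuous_on_eq) (auto simp: g0_def)
    have "continuous_on {vv..uu} (\<lambda>x. b + (x - vv))" by (intro continuous_intros)
    then show "continuous_on {vv..uu} g0" by (rule continuous_on_eq) (auto simp: g0_def)
  qed auto
  moreover have "{0..vv} \<union> {vv..uu} = {0..uu}" using vv vu by auto
  ultimately have cg0: "continuous_on {0..uu} g0" by simp
  have "continuous_on ({uu..b} \<union> {b..c}) g1"
  proof (rule continuous_on_closed_Un)
    have Z3: "f ` {uu..<b} = {f uu..<t}" using Z(3) uu(1) by simp
    have "continuous_on {uu..b} (\<lambda>x. if x < b then f x else t)"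
      by (rule continuous_on_extend_right[OF uu(3) Z(1,2) Z3])
    then show "continuous_on {uu..b} g1"
    proof (rule continuous_on_eq)
      fix x assume x: "x \<in> {uu..b}"
      have "g1 b = t" using Y t vu unfolding g1_def c_def a_def by (cases "vv < uu") auto
      then show "(if x < b then f x else t) = g1 x" using x by (cases "x < b") (auto simp: g1_def)
    qed
    show "continuous_on {b..c} g1"
    proof (cases "vv < uu")
      case True
      have e: "continuous_on {vv..uu} (\<lambda>x. if x < uu then f x else a)"
        by (rule continuous_on_extend_right[OF True]) (use Y True in \<open>auto simp: a_def\<close>)
      have "continuous_on {b..c} (\<lambda>x. (\<lambda>x. if x < uu then f x else a) (x - b + vv))"
        by (rule continuous_on_compose2[OF e]) (auto intro!: continuous_intros simp: c_def)
      then show ?thesis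
        by (rule continuous_on_eq) (auto simp: g1_def c_def)
    next
      case False
      then have "c = b" using vu by (simp add: c_def)
      then show ?thesis unfolding \<open>c = b\<close> by simp
    qed
  qed auto
  moreover have "{uu..b} \<union> {b..c} = {uu..c}" using uu bc by auto
  ultimately have cg1: "continuous_on {uu..c} g1" by simp
  \<comment> \<open>Points where a derivative may jump: the endpoints of the letters, the junctions
    \<open>vv\<close> and b, and for \<open>g1\<close> also the endpoints translated by b -
    \<open>vv\<close> along with the middle block.\<close>
  define M0 where "M0 = insert vv (range (lft T))"
  define M1 where "M1 = insert b (range (lft T) \<union> range (\<lambda>\<alpha>. lft T \<alpha> + b - vv))"
  have M0: "lft T \<alpha> \<in> M0" "vv \<in> M0" for \<alpha> by (auto simp: M0_def)
  have M1: "lft T \<alpha> \<in> M1" "b \<in> M1" "lft T \<alpha> + b - vv \<in> M1" for \<alpha> by (auto simp: M1_def)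
  define m0 where "m0 = (\<lambda>t. K * t + 2 * K * real (card {\<mu> \<in> M0. \<mu> < t}))"
  define m1 where "m1 = (\<lambda>t. K * t + 2 * K * real (card {\<mu> \<in> M1. \<mu> < t}))"
  have s0: "slope_var g0 m0 0 uu" unfolding m0_def
  proof (rule slope_var_piecewise[OF cg0 _ K K, where D = "\<lambda>x. if x < vv then df x else 1"])
    show "finite M0" by (simp add: M0_def)
    fix x assume x: "0 < x" "x < uu" "x \<notin> M0"
    show "(g0 has_real_derivative (if x < vv then df x else 1)) (at x) \<and>
        exp (- K) \<le> (if x < vv then df x else 1) \<and> (if x < vv then df x else 1) \<le> exp K"
    proof (cases "x < vv")
      case True
      have d: "(f has_real_derivative df x) (at x) \<and> exp (- K) \<le> df x \<and> df x \<le> exp K"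
        by (rule df(1)[OF sm]) (use x True vv M0 in auto)
      have "(g0 has_real_derivative df x) (at x)"
        by (rule has_field_derivative_transform_within_open[of f _ _ "{..<vv}"]) (use d True in \<open>auto simp: g0_def\<close>)
      then show ?thesis using d True by simp
    next
      case False
      then have xv: "vv < x" using x M0 by (cases "x = vv") auto
      have "((\<lambda>x. b + (x - vv)) has_real_derivative 1) (at x)" by (auto intro!: derivative_eq_intros)
      then have "(g0 has_real_derivative 1) (at x)"
        by (rule has_field_derivative_transform_within_open[of _ _ _ "{vv<..}"]) (use xv in \<open>auto simp: g0_def\<close>)
      then show ?thesis using False ex1 by simp
    qed
  next
    fix x y assume xy: "0 < x" "x < y" "y < uu" "{x..y} \<inter> M0 = {}"
    have nm: "\<mu> \<notin> {x..y}" if "\<mu> \<in> M0" for \<mu> using xy that by blast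
    consider "y < vv" | "vv < x" using nm[OF M0(2)] by force
    then show "\<bar>ln (if x < vv then df x else 1) - ln (if y < vv then df y else 1)\<bar> \<le> K * (y - x)"
    proof cases
      case 1
      have "{x..y} \<inter> range (lft T) = {}" using nm M0(1) by blast
      then show ?thesis using df(2)[OF sm, of x y] xy 1 vv by auto
    next
      case 2
      then show ?thesis using K xy by auto
    qed
  qed
  have s1: "slope_var g1 m1 uu c" unfolding m1_def
  proof (rule slope_var_piecewise[OF cg1 _ K K, where D = "\<lambda>x. if x < b then df x else df (x - b + vv)"])
    show "finite M1" by (simp add: M1_def)
    fix x assume x: "uu < x" "x < c" "x \<notin> M1"
    show "(g1 has_real_derivative (if x < b then df x else df (x - b + vv))) (at x) \<and>
        exp (- K) \<le> (if x < b then df x else df (x - b + vv)) \<and> (if x < b then df x else df (x - b + vv)) \<le> exp K"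
    proof (cases "x < b")
      case True
      have d: "(f has_real_derivative df x) (at x) \<and> exp (- K) \<le> df x \<and> df x \<le> exp K"
        by (rule df(1)[OF sm]) (use x True uu M1 in auto)
      have "(g1 has_real_derivative df x) (at x)"
        by (rule has_field_derivative_transform_within_open[of f _ _ "{..<b}"]) (use d True in \<open>auto simp: g1_def\<close>)
      then show ?thesis using d True by simp
    next
      case False
      then have xb: "b < x" using x M1 by (cases "x = b") auto
      have nl: "x - b + vv \<noteq> lft T \<alpha>" for \<alpha>
      proof
        assume "x - b + vv = lft T \<alpha>"
        then have "x = lft T \<alpha> + b - vv" by simp
        then show False using M1(3)[of \<alpha>] x(3) by simp
      qed
      have d: "(f has_real_derivative df (x - b + vv)) (at (x - b + vv)) \<and> exp (- K) \<le> df (x - b + vv) \<and> df (x - b + vv) \<le> exp K"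
        by (rule df(1)[OF sm]) (use x xb uu vv nl in \<open>auto simp: c_def\<close>)
      have d1: "((\<lambda>x. x - b + vv) has_real_derivative 1) (at x)" by (auto intro!: derivative_eq_intros)
      have "((\<lambda>x. f (x - b + vv)) has_real_derivative df (x - b + vv) * 1) (at x)"
        using d d1 by (intro DERIV_chain2) auto
      then have "((\<lambda>x. f (x - b + vv)) has_real_derivative df (x - b + vv)) (at x)" by simp
      then have "(g1 has_real_derivative df (x - b + vv)) (at x)"
        by (rule has_field_derivative_transform_within_open[of _ _ _ "{b<..<c}"])
          (use xb x in \<open>auto simp: g1_def\<close>)
      then show ?thesis using d False by simp
    qed
  next
    fix x y assume xy: "uu < x" "x < y" "y < c" "{x..y} \<inter> M1 = {}"
    have nm: "\<mu> \<notin> {x..y}" if "\<mu> \<in> M1" for \<mu> using xy that by blast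
    consider "y < b" | "b < x" using nm[OF M1(2)] by force
    then show "\<bar>ln (if x < b then df x else df (x - b + vv)) - ln (if y < b then df y else df (y - b + vv))\<bar> \<le> K * (y - x)"
    proof cases
      case 1
      have "{x..y} \<inter> range (lft T) = {}" using nm M1(1) by blast
      then show ?thesis using df(2)[OF sm, of x y] xy 1 uu by auto
    next
      case 2
      have "{x - b + vv..y - b + vv} \<inter> range (lft T) = {}"
      proof -
        have "lft T \<alpha> \<notin> {x - b + vv..y - b + vv}" for \<alpha> using nm[OF M1(3)[of \<alpha>]] by auto
        then show ?thesis by blast
      qed
      then have "\<bar>ln (df (x - b + vv)) - ln (df (y - b + vv))\<bar> \<le> K * ((y - b + vv) - (x - b + vv))"
        by (intro df(2)[OF sm]) (use xy 2 vv uu in \<open>auto simp: c_def\<close>)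
      then show ?thesis using 2 xy by auto
    qed
  qed
  have "cpair ((m0 uu - m0 0) + (m1 c - m1 uu)) uu a c g0 g1 m0 m1"
    unfolding cpair_def using cg0 cg1 s0 s1 uu vv ab bc vu by (auto simp: g0_def g1_def a_def c_def)
  moreover have "induced f b uu g0 g1"
    unfolding induced_def
  proof (intro allI impI)
    fix x assume x: "0 \<le> x" "x < b"
    show "f x = (if x < uu then if g0 x < b then g0 x else g1 (g0 x) else g1 x)"
      using maps[OF x] x vu by (cases "x < vv"; cases "x < uu") (auto simp: g0_def g1_def c_def)
  qed
  ultimately have "coarse ((m0 uu - m0 0) + (m1 c - m1 uu)) f b uu a c g0 g1"
    unfolding coarse_def using uu ab bc by blast
  then show ?thesis by blast
qed

end

section \<open>Densities along the renormalization\<close>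

lemma MVT_within:
  fixes \<phi> \<phi>' :: "real \<Rightarrow> real"
  assumes pq: "p < q" and d: "\<And>x. x \<in> {p..q} \<Longrightarrow> (\<phi> has_real_derivative \<phi>' x) (at x within {p..q})"
  shows "\<exists>\<xi>. p < \<xi> \<and> \<xi> < q \<and> \<phi> q - \<phi> p = \<phi>' \<xi> * (q - p)"
proof -
  have "\<exists>x\<in>{p<..<q}. \<phi> q - \<phi> p = (\<lambda>y. \<phi>' x * y) (q - p)"
    by (rule mvt_simple[OF pq]) (use d in \<open>auto simp: has_field_derivative_def\<close>)
  then show ?thesis by auto
qed

lemma MVT_within_sub:
  fixes \<phi> \<phi>' :: "real \<Rightarrow> real"
  assumes d: "\<And>x. x \<in> {l..r} \<Longrightarrow> (\<phi> has_real_derivative \<phi>' x) (at x within {l..r})"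
    and pq: "l \<le> p" "p < q" "q \<le> r"
  shows "\<exists>\<xi>. p < \<xi> \<and> \<xi> < q \<and> \<phi> q - \<phi> p = \<phi>' \<xi> * (q - p)"
  by (rule MVT_within[OF pq(2)], rule has_field_derivative_subset[OF d]) (use pq in auto)

text \<open>A bound d on the difference of logarithms is a bound exp d on ratios, and such bounds
  survive addition. Thus the estimate for the logarithm of \<open>h\<close> survives when two
  densities are added.\<close>

lemma ln_sum_diff:
  fixes a b a' b' :: real
  assumes "0 < a" "0 < b" "0 < a'" "0 < b'" "\<bar>ln a - ln a'\<bar> \<le> d" "\<bar>ln b - ln b'\<bar> \<le> d"
  shows "\<bar>ln (a + b) - ln (a' + b')\<bar> \<le> d"
proof -
  have le: "x \<le> exp d * y" if "0 < x" "0 < y" "\<bar>ln x - ln y\<bar> \<le> d" for x y :: real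
  proof -
    have "ln x \<le> d + ln y" using that by linarith
    then have "exp (ln x) \<le> exp (d + ln y)" by simp
    then show ?thesis using that by (simp add: exp_add)
  qed
  have *: "ln x \<le> d + ln y" if "0 < x" "0 < y" "x \<le> exp d * y" for x y :: real
  proof -
    have "ln x \<le> ln (exp d * y)" using that by simp
    then show ?thesis using that by (simp add: ln_mult)
  qed
  have "a + b \<le> exp d * (a' + b')" "a' + b' \<le> exp d * (a + b)"
    using le[of a a'] le[of b b'] le[of a' a] le[of b' b] assms
    by (auto simp: algebra_simps abs_minus_commute)
  then show ?thesis using *[of "a + b" "a' + b'"] *[of "a' + b'" "a + b"] assms by auto
qed

lemma weighted_mean_abs_le:
  fixes p q s t C :: real
  assumes "0 < p" "0 < q" "\<bar>s\<bar> \<le> C" "\<bar>t\<bar> \<le> C"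
  shows "\<bar>(s * p + t * q) / (p + q)\<bar> \<le> C"
proof -
  have "\<bar>s * p\<bar> \<le> C * p" "\<bar>t * q\<bar> \<le> C * q"
    using assms by (auto simp: abs_mult intro!: mult_right_mono)
  then have "\<bar>s * p + t * q\<bar> \<le> C * (p + q)" by (simp add: distrib_left)
  then show ?thesis using assms by (simp add: abs_divide pos_divide_le_eq)
qed

text \<open>\<open>sb\<close> is what \<open>slopes_bounded\<close> provides, so from here on genus
  one enters only through the number \<open>Ks\<close>.\<close>

locale rvsmooth = rvseq T k for T :: "('a::finite) giem" and k +
  fixes g0 F0 psi0 :: "'a \<Rightarrow> real \<Rightarrow> real" and C1 \<nu> Ks :: real
  assumes sm: "giem.smooth0 T g0 F0 psi0 C1 \<nu>" and nu: "0 < \<nu>" "\<nu> \<le> 1"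
    and sb: "\<And>n \<alpha> x y. l n \<alpha> \<le> x \<Longrightarrow> x < y \<Longrightarrow> y < r n \<alpha> \<Longrightarrow> \<bar>sl (f n) x y\<bar> \<le> Ks"
begin

abbreviation "J n \<alpha> \<equiv> {l n \<alpha>..r n \<alpha>}"

text \<open>In both types the new branch of the loser is the branch of \<open>A1\<close> followed by that of \<open>A0\<close>. Here F is the
  logarithmic derivative of the branch, m a primitive of h, and psi times h the nonlinearity.\<close>
primrec G :: "nat \<Rightarrow> 'a \<Rightarrow> real \<Rightarrow> real" where
  "G 0 = g0"
| "G (Suc n) = (G n)(lose n := (\<lambda>x. G n (A0 n) (G n (A1 n) x)))"

primrec F :: "nat \<Rightarrow> 'a \<Rightarrow> real \<Rightarrow> real" where
  "F 0 = F0"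
| "F (Suc n) = (F n)(lose n := (\<lambda>x. F n (A1 n) x + F n (A0 n) (G n (A1 n) x)))"

primrec m :: "nat \<Rightarrow> 'a \<Rightarrow> real \<Rightarrow> real" where
  "m 0 = (\<lambda>\<alpha> x. x)"
| "m (Suc n) = (m n)(lose n := (\<lambda>x. m n (A1 n) x + m n (A0 n) (G n (A1 n) x)))"

primrec h :: "nat \<Rightarrow> 'a \<Rightarrow> real \<Rightarrow> real" where
  "h 0 = (\<lambda>\<alpha> x. 1)"
| "h (Suc n) = (h n)(lose n := (\<lambda>x. h n (A1 n) x + h n (A0 n) (G n (A1 n) x) * exp (F n (A1 n) x)))"

primrec psi :: "nat \<Rightarrow> 'a \<Rightarrow> real \<Rightarrow> real" where
  "psi 0 = psi0"
| "psi (Suc n) = (psi n)(lose n := (\<lambda>x. (psi n (A1 n) x * h n (A1 n) x +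
      psi n (A0 n) (G n (A1 n) x) * (h n (A0 n) (G n (A1 n) x) * exp (F n (A1 n) x))) /
      (h n (A1 n) x + h n (A0 n) (G n (A1 n) x) * exp (F n (A1 n) x))))"

lemma l_less: "l n \<alpha> < r n \<alpha>" by (rule ipart_less[OF top])

lemma J_lose: "l (Suc n) (lose n) = xc n" "r (Suc n) (lose n) = r n (A1 n)"
  using xc(4)[of n] A0_A1[of n] unfolding l_Suc r_Suc lose_eq by auto

lemma J_other: "\<alpha> \<noteq> lose n \<Longrightarrow> l (Suc n) \<alpha> = l n \<alpha> \<and> r (Suc n) \<alpha> \<le> r n \<alpha>"
  using xc(2)[of n] b_less[of n] r_A0[of n] unfolding l_Suc r_Suc lose_eq by (auto split: if_splits)

lemma J_sub: "\<alpha> \<noteq> lose n \<Longrightarrow> J (Suc n) \<alpha> \<subseteq> J n \<alpha>" "J (Suc n) (lose n) \<subseteq> J n (A1 n)"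
  using J_other[of \<alpha> n] J_lose[of n] xc(1)[of n] by auto

lemma C1: "0 \<le> C1"
proof -
  interpret S: rv_step "Rn 0 T" "b 0" by (rule step)
  show ?thesis using sm S.smooth0_def unfolding Rn_0 by auto
qed

text \<open>Derivatives are taken on closed intervals, but \<open>G\<close> agrees with f on
  half-open ones only: at the right end f has the value of another branch. The last clause measures
  by the increase of \<open>m\<close> and not by length; in this form the constant \<open>C1\<close>
  is the same at every level.\<close>

definition "smooth_at n \<longleftrightarrow> (\<forall>\<alpha>. (\<forall>x. l n \<alpha> \<le> x \<longrightarrow> x < r n \<alpha> \<longrightarrow> G n \<alpha> x = f n x) \<and>
   (\<forall>x\<in>J n \<alpha>. (G n \<alpha> has_real_derivative exp (F n \<alpha> x)) (at x within J n \<alpha>) \<and>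
      (F n \<alpha> has_real_derivative psi n \<alpha> x * h n \<alpha> x) (at x within J n \<alpha>) \<and>
      (m n \<alpha> has_real_derivative h n \<alpha> x) (at x within J n \<alpha>) \<and> 1 \<le> h n \<alpha> x \<and> \<bar>psi n \<alpha> x\<bar> \<le> C1) \<and>
   continuous_on (J n \<alpha>) (psi n \<alpha>) \<and> continuous_on (J n \<alpha>) (h n \<alpha>) \<and>
   (\<forall>x y. l n \<alpha> \<le> x \<longrightarrow> x \<le> y \<longrightarrow> y \<le> r n \<alpha> \<longrightarrow> \<bar>ln (h n \<alpha> x) - ln (h n \<alpha> y)\<bar> \<le> C1 * (m n \<alpha> y - m n \<alpha> x)))"

lemma invD:
  assumes "smooth_at n"
  shows "l n \<alpha> \<le> x \<Longrightarrow> x < r n \<alpha> \<Longrightarrow> G n \<alpha> x = f n x"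
    "x \<in> J n \<alpha> \<Longrightarrow> (G n \<alpha> has_real_derivative exp (F n \<alpha> x)) (at x within J n \<alpha>)"
    "x \<in> J n \<alpha> \<Longrightarrow> (F n \<alpha> has_real_derivative psi n \<alpha> x * h n \<alpha> x) (at x within J n \<alpha>)"
    "x \<in> J n \<alpha> \<Longrightarrow> (m n \<alpha> has_real_derivative h n \<alpha> x) (at x within J n \<alpha>)"
    "x \<in> J n \<alpha> \<Longrightarrow> 1 \<le> h n \<alpha> x" "x \<in> J n \<alpha> \<Longrightarrow> \<bar>psi n \<alpha> x\<bar> \<le> C1"
    "continuous_on (J n \<alpha>) (psi n \<alpha>)" "continuous_on (J n \<alpha>) (h n \<alpha>)"
    "l n \<alpha> \<le> x \<Longrightarrow> x \<le> y \<Longrightarrow> y \<le> r n \<alpha> \<Longrightarrow> \<bar>ln (h n \<alpha> x) - ln (h n \<alpha> y)\<bar> \<le> C1 * (m n \<alpha> y - m n \<alpha> x)"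
  using assms unfolding smooth_at_def by auto

lemma G_mono_inv:
  assumes "smooth_at n" "l n \<alpha> \<le> x" "x < y" "y \<le> r n \<alpha>" shows "G n \<alpha> x < G n \<alpha> y"
proof -
  obtain \<xi> where "x < \<xi>" "\<xi> < y" "G n \<alpha> y - G n \<alpha> x = exp (F n \<alpha> \<xi>) * (y - x)"
    using MVT_within_sub[OF invD(2)[OF assms(1)] assms(2-4)] by blast
  moreover have "0 < exp (F n \<alpha> \<xi>) * (y - x)" using assms by simp
  ultimately show ?thesis by linarith
qed

lemma m_mono_inv:
  assumes "smooth_at n" "l n \<alpha> \<le> x" "x \<le> y" "y \<le> r n \<alpha>" shows "m n \<alpha> x \<le> m n \<alpha> y"
proof (cases "x = y")
  case False
  then have lt: "x < y" using assms by auto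
  obtain \<xi> where xi: "x < \<xi>" "\<xi> < y" "m n \<alpha> y - m n \<alpha> x = h n \<alpha> \<xi> * (y - x)"
    using MVT_within_sub[OF invD(4)[OF assms(1)] assms(2) lt assms(4)] by blast
  have "1 \<le> h n \<alpha> \<xi>" using invD(5)[OF assms(1), of \<xi> \<alpha>] xi assms by auto
  then have "0 \<le> h n \<alpha> \<xi> * (y - x)" using lt by (intro mult_nonneg_nonneg) auto
  then show ?thesis using xi by linarith
qed auto

text \<open>The derivative of \<open>F\<close> is \<open>psi\<close> times \<open>h\<close>, at most
  \<open>C1\<close> times that of \<open>m\<close> in absolute value. The mean value theorem applied
  to \<open>C1\<close> times \<open>m\<close> minus or plus \<open>F\<close> (e = 1 or -1) then
  suffices, without integrals.\<close>

lemma F_diff_inv: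
  assumes "smooth_at n" "l n \<alpha> \<le> x" "x \<le> y" "y \<le> r n \<alpha>"
  shows "\<bar>F n \<alpha> x - F n \<alpha> y\<bar> \<le> C1 * (m n \<alpha> y - m n \<alpha> x)"
proof (cases "x = y")
  case False
  then have lt: "x < y" using assms by auto
  have *: "e * (F n \<alpha> y - F n \<alpha> x) \<le> C1 * (m n \<alpha> y - m n \<alpha> x)" if e: "\<bar>e\<bar> = 1" for e
  proof -
    have "((\<lambda>x. C1 * m n \<alpha> x - e * F n \<alpha> x) has_real_derivative
      C1 * h n \<alpha> x - e * (psi n \<alpha> x * h n \<alpha> x)) (at x within J n \<alpha>)" if "x \<in> J n \<alpha>" for x
      using invD(3)[OF assms(1) that] invD(4)[OF assms(1) that]
      by (intro DERIV_diff DERIV_cmult)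
    from MVT_within_sub[OF this assms(2) lt assms(4)] obtain \<xi> where xi: "x < \<xi>" "\<xi> < y"
      "(C1 * m n \<alpha> y - e * F n \<alpha> y) - (C1 * m n \<alpha> x - e * F n \<alpha> x) = (C1 * h n \<alpha> \<xi> - e * (psi n \<alpha> \<xi> * h n \<alpha> \<xi>)) * (y - x)"
      by blast
    have xJ: "\<xi> \<in> J n \<alpha>" using xi assms by auto
    have "e * psi n \<alpha> \<xi> \<le> \<bar>e * psi n \<alpha> \<xi>\<bar>" by simp
    also have "\<dots> \<le> C1" using invD(6)[OF assms(1) xJ] e by (simp add: abs_mult)
    finally have "0 \<le> (C1 - e * psi n \<alpha> \<xi>) * h n \<alpha> \<xi> * (y - x)"
      using invD(5)[OF assms(1) xJ] lt by (intro mult_nonneg_nonneg) auto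
    then show ?thesis using xi(3) by (simp add: algebra_simps)
  qed
  show ?thesis using *[of 1] *[of "-1"] by auto
qed (use C1 in auto)

lemma G_end_inv: assumes "smooth_at n" shows "G n (A1 n) (r n (A1 n)) = b n"
proof -
  interpret S: rv_step "Rn n T" "b n" by (rule step)
  let ?a = "A1 n"
  have sm: "strict_mono_on {l n ?a..<r n ?a} (f n)"
    unfolding strict_mono_on_def using f_mono[of n ?a] by auto
  have im: "f n ` {l n ?a..<r n ?a} = {f n (l n ?a)..<b n}"
    using S.img[of ?a] S.irgt_a1 by (simp add: ilft_def)
  have 1: "(f n \<longlongrightarrow> b n) (at (r n ?a) within {l n ?a..<r n ?a})"
    by (rule left_limit[OF l_less sm im])
  have "continuous_on (J n ?a) (G n ?a)" using invD(2)[OF assms] by (rule DERIV_continuous_on)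
  then have "(G n ?a \<longlongrightarrow> G n ?a (r n ?a)) (at (r n ?a) within J n ?a)"
    using l_less[of n ?a] unfolding continuous_on_def by auto
  then have "(G n ?a \<longlongrightarrow> G n ?a (r n ?a)) (at (r n ?a) within {l n ?a..<r n ?a})"
    by (rule tendsto_within_subset) auto
  moreover have "\<forall>\<^sub>F x in at (r n ?a) within {l n ?a..<r n ?a}. G n ?a x = f n x"
    unfolding eventually_at using invD(1)[OF assms, of ?a] by (intro exI[of _ 1]) auto
  ultimately have 2: "(f n \<longlongrightarrow> G n ?a (r n ?a)) (at (r n ?a) within {l n ?a..<r n ?a})"
    by (rule Lim_transform_eventually)
  have "at (r n ?a) within {l n ?a..<r n ?a} \<noteq> bot"
    using l_less[of n ?a] by (simp add: at_within_eq_bot_iff)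
  from tendsto_unique[OF this 2 1] show ?thesis .
qed

lemma G_xc_inv: assumes "smooth_at n" shows "G n (A1 n) (xc n) = b (Suc n)"
  using invD(1)[OF assms, of "A1 n" "xc n"] xc[of n] by auto

lemma G_lose_range_inv:
  assumes "smooth_at n" "x \<in> {xc n..r n (A1 n)}"
  shows "b (Suc n) \<le> G n (A1 n) x \<and> G n (A1 n) x \<le> b n"
  using G_mono_inv[OF assms(1), of "A1 n" "xc n" x] G_mono_inv[OF assms(1), of "A1 n" x "r n (A1 n)"]
    G_end_inv[OF assms(1)] G_xc_inv[OF assms(1)] xc(1,2)[of n] assms(2)
  by (cases "x = xc n"; cases "x = r n (A1 n)") auto

lemma G_lose_in_inv:
  assumes "smooth_at n" "x \<in> {xc n..r n (A1 n)}"
  shows "G n (A1 n) x \<in> J n (A0 n)"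
  using G_lose_range_inv[OF assms] r_A0[of n] b_Suc[of n] by auto

lemma inv_0: "smooth_at 0"
proof -
  interpret S: rv_step "Rn 0 T" "b 0" by (rule step)
  have s: "S.smooth0 g0 F0 psi0 C1 \<nu>" using sm Rn_0 by simp
  have Ho: "\<bar>psi0 \<alpha> x - psi0 \<alpha> y\<bar> \<le> C1 * \<bar>x - y\<bar> powr \<nu>" if "x \<in> J 0 \<alpha>" "y \<in> J 0 \<alpha>" for \<alpha> x y
    using s that unfolding S.smooth0_def by blast
  have "continuous_on (J 0 \<alpha>) (psi0 \<alpha>)" for \<alpha>
    unfolding continuous_on_def
  proof
    fix x assume x: "x \<in> J 0 \<alpha>"
    have "((\<lambda>y. C1 * \<bar>y - x\<bar> powr \<nu>) \<longlongrightarrow> C1 * \<bar>x - x\<bar> powr \<nu>) (at x within J 0 \<alpha>)"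
      using nu by (intro tendsto_intros) auto
    then have z: "((\<lambda>y. C1 * \<bar>y - x\<bar> powr \<nu>) \<longlongrightarrow> 0) (at x within J 0 \<alpha>)" by simp
    have "\<forall>\<^sub>F y in at x within J 0 \<alpha>. norm (psi0 \<alpha> y - psi0 \<alpha> x) \<le> C1 * \<bar>y - x\<bar> powr \<nu>"
      unfolding eventually_at using Ho x by (intro exI[of _ 1]) auto
    from Lim_null_comparison[OF this z] show "(psi0 \<alpha> \<longlongrightarrow> psi0 \<alpha> x) (at x within J 0 \<alpha>)"
      by (simp add: Lim_null[symmetric])
  qed
  moreover have "(F0 \<alpha> has_real_derivative psi0 \<alpha> x) (at x within J 0 \<alpha>)" "\<bar>psi0 \<alpha> x\<bar> \<le> C1"
    "(g0 \<alpha> has_real_derivative exp (F0 \<alpha> x)) (at x within J 0 \<alpha>)" if "x \<in> J 0 \<alpha>" for \<alpha> x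
    using s that unfolding S.smooth0_def by blast+
  moreover have "g0 \<alpha> x = f 0 x" if "l 0 \<alpha> \<le> x" "x < r 0 \<alpha>" for \<alpha> x
    using s that unfolding S.smooth0_def by auto
  ultimately show ?thesis unfolding smooth_at_def using C1 by auto
qed

text \<open>Only the loser changes. Its derivatives come from the chain rule, and its
  \<open>psi\<close> is a mean of old values with positive weights, so the bound \<open>C1\<close>
  persists.\<close>

lemma inv_Suc:
  assumes i: "smooth_at n" shows "smooth_at (Suc n)"
  unfolding smooth_at_def
proof
  fix \<alpha>
  let ?b = "b (Suc n)"
  show "(\<forall>x. l (Suc n) \<alpha> \<le> x \<longrightarrow> x < r (Suc n) \<alpha> \<longrightarrow> G (Suc n) \<alpha> x = f (Suc n) x) \<and>
   (\<forall>x\<in>J (Suc n) \<alpha>. (G (Suc n) \<alpha> has_real_derivative exp (F (Suc n) \<alpha> x)) (at x within J (Suc n) \<alpha>) \<and>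
      (F (Suc n) \<alpha> has_real_derivative psi (Suc n) \<alpha> x * h (Suc n) \<alpha> x) (at x within J (Suc n) \<alpha>) \<and>
      (m (Suc n) \<alpha> has_real_derivative h (Suc n) \<alpha> x) (at x within J (Suc n) \<alpha>) \<and> 1 \<le> h (Suc n) \<alpha> x \<and> \<bar>psi (Suc n) \<alpha> x\<bar> \<le> C1) \<and>
   continuous_on (J (Suc n) \<alpha>) (psi (Suc n) \<alpha>) \<and> continuous_on (J (Suc n) \<alpha>) (h (Suc n) \<alpha>) \<and>
   (\<forall>x y. l (Suc n) \<alpha> \<le> x \<longrightarrow> x \<le> y \<longrightarrow> y \<le> r (Suc n) \<alpha> \<longrightarrow> \<bar>ln (h (Suc n) \<alpha> x) - ln (h (Suc n) \<alpha> y)\<bar> \<le> C1 * (m (Suc n) \<alpha> y - m (Suc n) \<alpha> x))"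
  proof (cases "\<alpha> = lose n")
    case False
    interpret S: rv_step "Rn n T" "b n" by (rule step)
    have sub: "J (Suc n) \<alpha> \<subseteq> J n \<alpha>" and lr: "l (Suc n) \<alpha> = l n \<alpha>" "r (Suc n) \<alpha> \<le> r n \<alpha>"
      using J_sub(1)[OF False] J_other[OF False] by auto
    have ff: "f (Suc n) x = f n x" if "l (Suc n) \<alpha> \<le> x" "x < r (Suc n) \<alpha>" for x
    proof -
      have "f n x < ?b" using S.not_loser_lt[OF False, of x] that unfolding Rn_Suc S.lft_RV S.rgt_RV b'_eq by auto
      then show ?thesis using f_Suc[of x n] ipart_mem[OF top[of "Suc n"] that] by auto
    qed
    have new: "G (Suc n) \<alpha> = G n \<alpha>" "F (Suc n) \<alpha> = F n \<alpha>" "m (Suc n) \<alpha> = m n \<alpha>" "h (Suc n) \<alpha> = h n \<alpha>"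
      "psi (Suc n) \<alpha> = psi n \<alpha>" using False by auto
    show ?thesis unfolding new
    proof (intro conjI allI impI ballI)
      fix x assume x: "x \<in> J (Suc n) \<alpha>"
      then have xJ: "x \<in> J n \<alpha>" using sub by blast
      show "(G n \<alpha> has_real_derivative exp (F n \<alpha> x)) (at x within J (Suc n) \<alpha>)"
        "(F n \<alpha> has_real_derivative psi n \<alpha> x * h n \<alpha> x) (at x within J (Suc n) \<alpha>)"
        "(m n \<alpha> has_real_derivative h n \<alpha> x) (at x within J (Suc n) \<alpha>)"
        using invD(2,3,4)[OF i xJ] sub by (blast intro: has_field_derivative_subset)+
      show "1 \<le> h n \<alpha> x" "\<bar>psi n \<alpha> x\<bar> \<le> C1" using invD(5,6)[OF i xJ] by auto
    next
      show "continuous_on (J (Suc n) \<alpha>) (psi n \<alpha>)" "continuous_on (J (Suc n) \<alpha>) (h n \<alpha>)"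
        using invD(7,8)[OF i, of \<alpha>] sub by (blast intro: continuous_on_subset)+
    next
      fix x assume "l (Suc n) \<alpha> \<le> x" "x < r (Suc n) \<alpha>"
      then show "G n \<alpha> x = f (Suc n) x" using ff[of x] lr invD(1)[OF i, of \<alpha> x] by auto
    next
      fix x y assume "l (Suc n) \<alpha> \<le> x" "x \<le> y" "y \<le> r (Suc n) \<alpha>"
      then show "\<bar>ln (h n \<alpha> x) - ln (h n \<alpha> y)\<bar> \<le> C1 * (m n \<alpha> y - m n \<alpha> x)"
        using invD(9)[OF i, of \<alpha> x y] lr by auto
    qed
  next
    case True
    let ?a = "A1 n" and ?c = "A0 n"
    let ?J = "{xc n..r n (A1 n)}"
    have JJ: "J (Suc n) \<alpha> = ?J" "l (Suc n) \<alpha> = xc n" "r (Suc n) \<alpha> = r n (A1 n)" using J_lose True by auto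
    have sub: "?J \<subseteq> J n ?a" using xc(1)[of n] by auto
    have into: "G n ?a x \<in> J n ?c" if "x \<in> ?J" for x using G_lose_in_inv[OF i that] .
    have into': "G n ?a ` ?J \<subseteq> J n ?c" using into by blast
    have Gd: "(G n ?a has_real_derivative exp (F n ?a x)) (at x within ?J)"
      and Fd: "(F n ?a has_real_derivative psi n ?a x * h n ?a x) (at x within ?J)"
      and md: "(m n ?a has_real_derivative h n ?a x) (at x within ?J)" if "x \<in> ?J" for x
      using invD(2,3,4)[OF i, of x ?a] sub that by (blast intro: has_field_derivative_subset)+
    have ch: "((\<lambda>x. q (G n ?a x)) has_real_derivative q' * exp (F n ?a x)) (at x within ?J)"
      if x: "x \<in> ?J" and q: "(q has_real_derivative q') (at (G n ?a x) within J n ?c)" for x q q'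
    proof -
      have "(q has_real_derivative q') (at (G n ?a x) within G n ?a ` ?J)"
        by (rule has_field_derivative_subset[OF q into'])
      from DERIV_image_chain[OF this Gd[OF x]] show ?thesis by (simp add: o_def)
    qed
    have hp: "1 \<le> h n ?a x" "1 \<le> h n ?c (G n ?a x)" "0 < h n ?c (G n ?a x) * exp (F n ?a x)" if "x \<in> ?J" for x
    proof -
      show "1 \<le> h n ?a x" "1 \<le> h n ?c (G n ?a x)" using invD(5)[OF i] sub that into by blast+
      then show "0 < h n ?c (G n ?a x) * exp (F n ?a x)" by (intro mult_pos_pos) auto
    qed
    have new: "G (Suc n) \<alpha> = (\<lambda>x. G n ?c (G n ?a x))" "F (Suc n) \<alpha> = (\<lambda>x. F n ?a x + F n ?c (G n ?a x))"
      "m (Suc n) \<alpha> = (\<lambda>x. m n ?a x + m n ?c (G n ?a x))"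
      "h (Suc n) \<alpha> = (\<lambda>x. h n ?a x + h n ?c (G n ?a x) * exp (F n ?a x))"
      "psi (Suc n) \<alpha> = (\<lambda>x. (psi n ?a x * h n ?a x + psi n ?c (G n ?a x) * (h n ?c (G n ?a x) * exp (F n ?a x))) /
         (h n ?a x + h n ?c (G n ?a x) * exp (F n ?a x)))"
      using True by auto
    have cG: "continuous_on ?J (G n ?a)" using Gd by (rule DERIV_continuous_on)
    have cF: "continuous_on ?J (F n ?a)" using Fd by (rule DERIV_continuous_on)
    have cp: "continuous_on ?J (\<lambda>x. psi n ?c (G n ?a x))" "continuous_on ?J (\<lambda>x. h n ?c (G n ?a x))"
      using invD(7,8)[OF i, of ?c] cG into' by (auto intro: continuous_on_compose2)
    have ca: "continuous_on ?J (psi n ?a)" "continuous_on ?J (h n ?a)"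
      using invD(7,8)[OF i, of ?a] sub by (auto intro: continuous_on_subset)
    show ?thesis unfolding JJ
    proof (intro conjI allI impI ballI)
      fix x assume x: "xc n \<le> x" "x < r n ?a"
      interpret S: rv_step "Rn n T" "b n" by (rule step)
      have ge: "?b \<le> f n x" using S.ret_conv[OF x] b'_eq by simp
      have "0 \<le> x" "x < b n" using ipart_mem[OF top, of n ?a x] x xc(1)[of n] by auto
      then have r: "x < ?b" "f n x < b n" using S.ret[of x] ge b'_eq[of n] by auto
      have "G n ?a x = f n x" using invD(1)[OF i, of ?a x] x xc(1)[of n] by auto
      moreover have "G n ?c (f n x) = f n (f n x)"
        using invD(1)[OF i, of ?c "f n x"] r ge r_A0[of n] b_Suc[of n] by auto
      ultimately show "G (Suc n) \<alpha> x = f (Suc n) x"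
        unfolding new using f_Suc[of x n] r ge \<open>0 \<le> x\<close> by auto
    next
      fix x assume x: "x \<in> ?J"
      show "(G (Suc n) \<alpha> has_real_derivative exp (F (Suc n) \<alpha> x)) (at x within ?J)"
        using ch[OF x invD(2)[OF i into[OF x]]] unfolding new by (simp add: exp_add mult.commute)
      show "(m (Suc n) \<alpha> has_real_derivative h (Suc n) \<alpha> x) (at x within ?J)"
        using DERIV_add[OF md[OF x] ch[OF x invD(4)[OF i into[OF x]]]] unfolding new .
      have nz: "h n ?a x + h n ?c (G n ?a x) * exp (F n ?a x) \<noteq> 0" using hp[OF x] by linarith
      show "(F (Suc n) \<alpha> has_real_derivative psi (Suc n) \<alpha> x * h (Suc n) \<alpha> x) (at x within ?J)"
        using DERIV_add[OF Fd[OF x] ch[OF x invD(3)[OF i into[OF x]]]] nz unfolding new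
        by (simp add: mult.assoc)
      show "1 \<le> h (Suc n) \<alpha> x" unfolding new using hp[OF x] by linarith
      show "\<bar>psi (Suc n) \<alpha> x\<bar> \<le> C1"
        unfolding new by (rule weighted_mean_abs_le) (use invD(6)[OF i, of x ?a] invD(6)[OF i into[OF x]] sub x hp[OF x] in auto)
    next
      have nz: "\<forall>x\<in>?J. h n ?a x + h n ?c (G n ?a x) * exp (F n ?a x) \<noteq> 0" using hp by (smt (verit))
      show "continuous_on ?J (psi (Suc n) \<alpha>)" "continuous_on ?J (h (Suc n) \<alpha>)"
        unfolding new using nz by (auto intro!: continuous_intros cp ca cF)
    next
      fix x y assume xy: "xc n \<le> x" "x \<le> y" "y \<le> r n ?a"
      have xJ: "x \<in> ?J" and yJ: "y \<in> ?J" using xy by auto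
      have gle: "G n ?a x \<le> G n ?a y" using G_mono_inv[OF i, of ?a x y] xy xc(1)[of n] by (cases "x = y") auto
      have Gi: "l n ?c \<le> G n ?a x" "G n ?a y \<le> r n ?c" using into[OF xJ] into[OF yJ] by auto
      have 1: "\<bar>ln (h n ?a x) - ln (h n ?a y)\<bar> \<le> C1 * (m n ?a y - m n ?a x)"
        by (rule invD(9)[OF i]) (use xy xc(1)[of n] in auto)
      have 2: "\<bar>ln (h n ?c (G n ?a x)) - ln (h n ?c (G n ?a y))\<bar> \<le> C1 * (m n ?c (G n ?a y) - m n ?c (G n ?a x))"
        by (rule invD(9)[OF i Gi(1) gle Gi(2)])
      have 3: "\<bar>F n ?a x - F n ?a y\<bar> \<le> C1 * (m n ?a y - m n ?a x)"
        by (rule F_diff_inv[OF i]) (use xy xc(1)[of n] in auto)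
      have m1: "0 \<le> C1 * (m n ?c (G n ?a y) - m n ?c (G n ?a x))"
        using m_mono_inv[OF i Gi(1) gle Gi(2)] C1 by auto
      have e: "ln (h n ?c (G n ?a z) * exp (F n ?a z)) = ln (h n ?c (G n ?a z)) + F n ?a z" if "z \<in> ?J" for z
        using hp[OF that] by (subst ln_mult) auto
      \<comment> \<open>The logarithm of the first summand varies by at most \<open>1\<close>, that
        of the second by \<open>2\<close> and \<open>3\<close> together. The sum of both increases
        bounds either one, and it is the increase of the new \<open>m\<close>.\<close>
      have "\<bar>ln (h n ?a x + h n ?c (G n ?a x) * exp (F n ?a x)) - ln (h n ?a y + h n ?c (G n ?a y) * exp (F n ?a y))\<bar>
        \<le> C1 * (m n ?a y - m n ?a x) + C1 * (m n ?c (G n ?a y) - m n ?c (G n ?a x))"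
        by (rule ln_sum_diff) (use hp[OF xJ] hp[OF yJ] 1 2 3 m1 e[OF xJ] e[OF yJ] in linarith)+
      then show "\<bar>ln (h (Suc n) \<alpha> x) - ln (h (Suc n) \<alpha> y)\<bar> \<le> C1 * (m (Suc n) \<alpha> y - m (Suc n) \<alpha> x)"
        unfolding new by (simp add: algebra_simps)
    qed
  qed
qed

lemma smooth_at: "smooth_at n"
  by (induction n) (use inv_0 inv_Suc in auto)

lemmas G_f = invD(1)[OF smooth_at]
lemmas G_deriv = invD(2)[OF smooth_at]
lemmas F_deriv = invD(3)[OF smooth_at]
lemmas m_deriv = invD(4)[OF smooth_at]
lemmas h_ge1 = invD(5)[OF smooth_at]
lemmas psi_le = invD(6)[OF smooth_at]
lemmas psi_cont = invD(7)[OF smooth_at]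
lemmas h_cont = invD(8)[OF smooth_at]
lemmas lnh_diff = invD(9)[OF smooth_at]
lemmas G_mono = G_mono_inv[OF smooth_at]
lemmas m_mono = m_mono_inv[OF smooth_at]
lemmas F_diff = F_diff_inv[OF smooth_at]
lemmas G_end = G_end_inv[OF smooth_at]
lemmas G_xc = G_xc_inv[OF smooth_at]
lemmas G_lose_in = G_lose_in_inv[OF smooth_at]

text \<open>The increases over \<open>A0\<close> and \<open>A1\<close> are only regrouped. The end
  cut off from the winner is traversed by one of the two factors of the loser's composite branch: by
  the second, applied after the first, in type 0, and by the first in type 1. For \<open>m\<close>
  this conserves the total length, for \<open>F\<close> the total nonlinearity.\<close>

lemma cocycle_sum:
  fixes Q :: "nat \<Rightarrow> 'a \<Rightarrow> real \<Rightarrow> real"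
  assumes Q: "\<And>n. Q (Suc n) = (Q n)(lose n := (\<lambda>x. Q n (A1 n) x + Q n (A0 n) (G n (A1 n) x)))"
  shows "(\<Sum>\<alpha>\<in>UNIV. Q n \<alpha> (r n \<alpha>) - Q n \<alpha> (l n \<alpha>)) = (\<Sum>\<alpha>\<in>UNIV. Q 0 \<alpha> (r 0 \<alpha>) - Q 0 \<alpha> (l 0 \<alpha>))"
proof (induction n)
  case (Suc n)
  let ?S = "\<lambda>n \<alpha>. Q n \<alpha> (r n \<alpha>) - Q n \<alpha> (l n \<alpha>)"
  have split: "sum (?S i) UNIV = ?S i (A0 n) + ?S i (A1 n) + sum (?S i) (UNIV - {A0 n, A1 n})" for i
    using A0_A1[of n] sum.subset_diff[of "{A0 n, A1 n}" UNIV "?S i"] by simp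
  have rest: "sum (?S (Suc n)) (UNIV - {A0 n, A1 n}) = sum (?S n) (UNIV - {A0 n, A1 n})"
    by (rule sum.cong) (use l_Suc[of n] r_Suc[of n] lose_eq[of n] in \<open>auto simp: Q\<close>)
  have "?S (Suc n) (A0 n) + ?S (Suc n) (A1 n) = ?S n (A0 n) + ?S n (A1 n)"
  proof (cases "ty n")
    case True
    have "b (Suc n) = il n (A1 n)" using True b_Suc[of n] by auto
    moreover have "G n (A1 n) (l n (A1 n)) = b (Suc n)" using G_xc[of n] xc(4)[OF True] by simp
    ultimately show ?thesis
      using True A0_A1[of n] lose_eq[of n] l_Suc[of n] r_Suc[of n] G_end[of n] r_A0[of n] by (simp add: Q)
  next
    case False
    have "b (Suc n) = l n (A0 n)" using False b_Suc[of n] by auto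
    then show ?thesis
      using False A0_A1[of n] lose_eq[of n] l_Suc[of n] r_Suc[of n] G_end[of n] r_A0[of n] G_xc[of n] by (simp add: Q)
  qed
  then show ?case using Suc split[of n] split[of "Suc n"] rest by linarith
qed auto

lemma m_sum: "(\<Sum>\<alpha>\<in>UNIV. m n \<alpha> (r n \<alpha>) - m n \<alpha> (l n \<alpha>)) = 1"
  using cocycle_sum[of m n] ipart_sum[OF top[of 0]] b_0 by simp

lemma F_sum: "(\<Sum>\<alpha>\<in>UNIV. F n \<alpha> (r n \<alpha>) - F n \<alpha> (l n \<alpha>)) = (\<Sum>\<alpha>\<in>UNIV. F0 \<alpha> (r 0 \<alpha>) - F0 \<alpha> (l 0 \<alpha>))"
  using cocycle_sum[of F n] by simp

end

section \<open>Bounded geometry\<close>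

lemma sum_ge_ex:
  fixes u v :: "'a::finite \<Rightarrow> real"
  assumes "sum v UNIV \<le> sum u UNIV"
  shows "\<exists>\<alpha>. v \<alpha> \<le> u \<alpha>"
proof (rule ccontr)
  assume "\<nexists>\<alpha>. v \<alpha> \<le> u \<alpha>"
  then have "\<And>\<alpha>. u \<alpha> < v \<alpha>" by (meson not_le)
  then have "sum u UNIV < sum v UNIV" by (intro sum_strict_mono) auto
  then show False using assms by linarith
qed

context rvsmooth
begin

text \<open>The chain starts with a win of \<open>\<beta>\<close> and ends with a loss of
  \<open>\<gamma>\<close>, and each loser in between wins the next step. P travels along it from
  winner to loser; monotonicity carries it over the waiting times before and after.\<close>

lemma spread:
  assumes mono: "\<And>n \<alpha>. N \<le> n \<Longrightarrow> P n \<alpha> \<Longrightarrow> P (Suc n) \<alpha>"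
    and step: "\<And>n. N \<le> n \<Longrightarrow> P n (win n) \<Longrightarrow> P (Suc n) (lose n)"
    and init: "P N \<beta>"
  shows "P (N + 2 * k) \<gamma>"
proof -
  have up: "P n' \<alpha>" if "N \<le> n" "n \<le> n'" "P n \<alpha>" for n n' \<alpha>
    using that(2) by (induction n' rule: dec_induct) (use that mono in auto)
  obtain n1 p where c: "N \<le> n1" "n1 + p < N + 2 * k" "win n1 = \<beta>" "lose (n1 + p) = \<gamma>"
     "\<forall>i<p. lose (n1 + i) = win (n1 + i + 1)" using chain by blast
  have "i \<le> p \<Longrightarrow> P (Suc (n1 + i)) (lose (n1 + i))" for i
  proof (induction i)
    case 0
    show ?case using step[of n1] up[of N n1 \<beta>] init c by auto
  next
    case (Suc i)
    then have "P (Suc (n1 + i)) (win (Suc (n1 + i)))" using c(5) by auto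
    then show ?case using step[of "Suc (n1 + i)"] c(1) by auto
  qed
  from this[of p] have "P (Suc (n1 + p)) \<gamma>" using c by auto
  then show ?thesis using up[of "Suc (n1 + p)" "N + 2 * k" \<gamma>] c by auto
qed

text \<open>\<open>Ks\<close> bounds \<open>F\<close> at one point of each interval, found by the
  mean value theorem from a secant slope; \<open>C1\<close> bounds the oscillation of
  \<open>F\<close>.\<close>

definition "K = Ks + C1"
abbreviation "E \<equiv> exp K"
definition "len n \<alpha> = r n \<alpha> - l n \<alpha>"

lemma len_pos: "0 < len n \<alpha>" using l_less by (simp add: len_def)

lemma len_le: "len n \<alpha> \<le> b n"
  using ipart_L_ge[OF top, of n \<alpha>] ipart_R_le[OF top, of n \<alpha>] by (simp add: len_def)

lemma Ks: "0 \<le> Ks"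
proof -
  fix \<alpha> :: 'a
  have "l 0 \<alpha> < (l 0 \<alpha> + r 0 \<alpha>) / 2" "(l 0 \<alpha> + r 0 \<alpha>) / 2 < r 0 \<alpha>" using l_less[of 0 \<alpha>] by auto
  then show ?thesis using sb[of 0 \<alpha> "l 0 \<alpha>" "(l 0 \<alpha> + r 0 \<alpha>) / 2"] by auto
qed

lemma K: "0 \<le> K" using Ks C1 by (simp add: K_def)
lemma E1: "1 \<le> E" using K by simp
lemma eK: "exp (- K) \<le> 1" "0 < exp (- K)" using K by auto

lemma m_range_le: "l n \<alpha> \<le> x \<Longrightarrow> x \<le> y \<Longrightarrow> y \<le> r n \<alpha> \<Longrightarrow> m n \<alpha> y - m n \<alpha> x \<le> 1"
proof -
  assume a: "l n \<alpha> \<le> x" "x \<le> y" "y \<le> r n \<alpha>"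
  have "m n \<alpha> (r n \<alpha>) - m n \<alpha> (l n \<alpha>) \<le> (\<Sum>\<alpha>\<in>UNIV. m n \<alpha> (r n \<alpha>) - m n \<alpha> (l n \<alpha>))"
  proof (rule member_le_sum)
    fix \<beta> show "0 \<le> m n \<beta> (r n \<beta>) - m n \<beta> (l n \<beta>)"
      using m_mono[of n \<beta> "l n \<beta>" "r n \<beta>"] l_less[of n \<beta>] by auto
  qed auto
  then show ?thesis using m_sum[of n] m_mono[of n \<alpha> "l n \<alpha>" x] m_mono[of n \<alpha> y "r n \<alpha>"] a by auto
qed

lemma F_osc: assumes "x \<in> J n \<alpha>" "y \<in> J n \<alpha>" shows "\<bar>F n \<alpha> x - F n \<alpha> y\<bar> \<le> C1"
proof -
  have *: "\<bar>F n \<alpha> x - F n \<alpha> y\<bar> \<le> C1" if "l n \<alpha> \<le> x" "x \<le> y" "y \<le> r n \<alpha>" for x y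
    using F_diff[OF that] mult_left_mono[OF m_range_le[OF that] C1] by linarith
  show ?thesis using *[of x y] *[of y x] assms by (cases "x \<le> y") auto
qed

lemma lnh_osc: assumes "x \<in> J n \<alpha>" "y \<in> J n \<alpha>" shows "\<bar>ln (h n \<alpha> x) - ln (h n \<alpha> y)\<bar> \<le> C1"
proof -
  have *: "\<bar>ln (h n \<alpha> x) - ln (h n \<alpha> y)\<bar> \<le> C1" if "l n \<alpha> \<le> x" "x \<le> y" "y \<le> r n \<alpha>" for x y
    using lnh_diff[OF that] mult_left_mono[OF m_range_le[OF that] C1] by linarith
  show ?thesis using *[of x y] *[of y x] assms by (cases "x \<le> y") auto
qed

lemma F_le: assumes x: "x \<in> J n \<alpha>" shows "\<bar>F n \<alpha> x\<bar> \<le> K"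
proof -
  define q where "q = (l n \<alpha> + r n \<alpha>) / 2"
  have q: "l n \<alpha> < q" "q < r n \<alpha>" using l_less[of n \<alpha>] by (auto simp: q_def)
  obtain \<xi> where xi: "l n \<alpha> < \<xi>" "\<xi> < q" "G n \<alpha> q - G n \<alpha> (l n \<alpha>) = exp (F n \<alpha> \<xi>) * (q - l n \<alpha>)"
    using MVT_within_sub[OF G_deriv, of n \<alpha> "l n \<alpha>" q] q by auto
  have "G n \<alpha> q = f n q" "G n \<alpha> (l n \<alpha>) = f n (l n \<alpha>)" using G_f[of n \<alpha>] q by auto
  then have "sl (f n) (l n \<alpha>) q = F n \<alpha> \<xi>" using xi q by (simp add: sl_def)
  then have "\<bar>F n \<alpha> \<xi>\<bar> \<le> Ks" using sb[of n \<alpha> "l n \<alpha>" q] q by auto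
  moreover have "\<bar>F n \<alpha> x - F n \<alpha> \<xi>\<bar> \<le> C1" using F_osc[of x n \<alpha> \<xi>] x xi q by auto
  ultimately show ?thesis unfolding K_def by linarith
qed

lemma G_bounds:
  assumes "l n \<alpha> \<le> x" "x \<le> y" "y \<le> r n \<alpha>"
  shows "exp (- K) * (y - x) \<le> G n \<alpha> y - G n \<alpha> x" "G n \<alpha> y - G n \<alpha> x \<le> E * (y - x)"
proof -
  have "exp (- K) * (y - x) \<le> G n \<alpha> y - G n \<alpha> x \<and> G n \<alpha> y - G n \<alpha> x \<le> E * (y - x)"
  proof (cases "x = y")
    case False
    then have lt: "x < y" using assms by auto
    obtain \<xi> where xi: "x < \<xi>" "\<xi> < y" "G n \<alpha> y - G n \<alpha> x = exp (F n \<alpha> \<xi>) * (y - x)"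
      using MVT_within_sub[OF G_deriv, of n \<alpha> x y] lt assms by auto
    have "\<bar>F n \<alpha> \<xi>\<bar> \<le> K" using F_le[of \<xi> n \<alpha>] xi assms by auto
    then have "exp (- K) \<le> exp (F n \<alpha> \<xi>)" "exp (F n \<alpha> \<xi>) \<le> E" by auto
    then show ?thesis unfolding xi(3) using lt by (auto intro!: mult_right_mono)
  qed auto
  then show "exp (- K) * (y - x) \<le> G n \<alpha> y - G n \<alpha> x" "G n \<alpha> y - G n \<alpha> x \<le> E * (y - x)" by auto
qed

text \<open>The removed end of the domain, from \<open>b (Suc n)\<close> to \<open>b n\<close>, is
  the image of the loser's new interval under the branch of \<open>A1\<close>.\<close>

lemma b_diff: "exp (- K) * len (Suc n) (lose n) \<le> b n - b (Suc n)" "b n - b (Suc n) \<le> E * len (Suc n) (lose n)"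
  using G_bounds[of n "A1 n" "xc n" "r n (A1 n)"] xc(1,2)[of n] J_lose[of n] G_end[of n] G_xc[of n]
  by (auto simp: len_def)

lemma b_le_Suc: "b n \<le> (1 + E) * b (Suc n)"
proof -
  have "E * len (Suc n) (lose n) \<le> E * b (Suc n)" using len_le by (intro mult_left_mono) auto
  then have "b n \<le> b (Suc n) + E * b (Suc n)" using b_diff(2)[of n] by linarith
  then show ?thesis by (simp add: distrib_right)
qed

lemma b_le_add: "b n \<le> (1 + E) ^ j * b (n + j)"
proof (induction j)
  case (Suc j)
  have "(1 + E) ^ j * b (n + j) \<le> (1 + E) ^ j * ((1 + E) * b (Suc (n + j)))"
    using b_le_Suc[of "n + j"] by (intro mult_left_mono) (auto simp: add_nonneg_nonneg)
  then show ?case using Suc by (simp add: mult.assoc mult.left_commute)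
qed auto

lemma b_antimono: "n \<le> n' \<Longrightarrow> b n' \<le> b n"
  by (induction n' rule: dec_induct) (auto intro: order_trans[OF less_imp_le[OF b_less]])

text \<open>Lower bounds on lengths are passed backwards in time, for each letter and from the loser
  to the winner. The factor is the slope lost when the loser's new interval is compared with its
  image, the removed end.\<close>

lemma len_back: "exp (- K) * len (Suc n) \<alpha> \<le> len n \<alpha>" "exp (- K) * len (Suc n) (lose n) \<le> len n (win n)"
proof -
  have le: "exp (- K) * len (Suc n) \<beta> \<le> len (Suc n) \<beta>" for \<beta>
    using mult_right_mono[OF eK(1), of "len (Suc n) \<beta>"] len_pos[of "Suc n" \<beta>] by simp
  show "exp (- K) * len (Suc n) \<alpha> \<le> len n \<alpha>"
  proof (cases "\<alpha> = lose n")
    case False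
    then have "len (Suc n) \<alpha> \<le> len n \<alpha>" using J_other[of \<alpha> n] by (auto simp: len_def)
    then show ?thesis using le[of \<alpha>] by linarith
  next
    case True
    show ?thesis
    proof (cases "ty n")
      case t: True
      then have "lose n = A1 n" using lose_eq by auto
      then have "len (Suc n) \<alpha> = len n \<alpha>" using True t J_lose[of n] xc(4)[OF t] by (simp add: len_def)
      then show ?thesis using le[of \<alpha>] by linarith
    next
      case t: False
      then have "lose n = A0 n" "b (Suc n) = l n (A0 n)" using lose_eq b_Suc by auto
      then have "len n \<alpha> = b n - b (Suc n)" using True r_A0[of n] by (simp add: len_def)
      then show ?thesis using b_diff(1)[of n] True by simp
    qed
  qed
  show "exp (- K) * len (Suc n) (lose n) \<le> len n (win n)"
  proof (cases "ty n")
    case t: True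
    then have "win n = A0 n" using win_eq by auto
    then have "b n - b (Suc n) \<le> len n (win n)" using r_A0[of n] b_Suc[of n] by (auto simp: len_def)
    then show ?thesis using b_diff(1)[of n] by linarith
  next
    case t: False
    then have "win n = A1 n" using win_eq by auto
    then have "len (Suc n) (lose n) \<le> len n (win n)" using J_lose[of n] xc(1)[of n] by (auto simp: len_def)
    then show ?thesis using le[of "lose n"] by linarith
  qed
qed

text \<open>At level N + 2k some letter has at least the average length, hence the cardinality. Each
  of the 2k steps back costs exp (- K) in the length of a letter and 1 + \<open>E\<close> in the
  length of the domain.\<close>

definition "c0 = exp (- K) ^ (2 * k) / (real CARD('a) * (1 + E) ^ (2 * k))"

lemma card_pos: "0 < real CARD('a)" by (simp add: card_gt_0_iff)

lemma c0_pos: "0 < c0"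
  unfolding c0_def using card_pos by (intro divide_pos_pos mult_pos_pos zero_less_power) (auto simp: add_pos_pos)

lemma len_ge: "c0 * b N \<le> len N \<beta>"
proof -
  have all: "exp (- K) ^ (2 * k) * len (N + 2 * k) \<gamma> \<le> len N \<beta>" for \<gamma>
  proof -
    \<comment> \<open>\<open>spread\<close> runs forward although the bound is passed backwards: the
      statement transported is that the fixed \<open>len N \<beta>\<close> dominates the discounted
      later length, which is trivial for \<open>\<beta>\<close> at N.\<close>
    have "exp (- K) ^ (N + 2 * k - N) * len (N + 2 * k) \<gamma> \<le> len N \<beta>"
    proof (rule spread[where P = "\<lambda>n \<gamma>. exp (- K) ^ (n - N) * len n \<gamma> \<le> len N \<beta>" and N = N and \<beta> = \<beta>])
      fix n \<alpha> assume n: "N \<le> n"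
      have e: "exp (- K) ^ (Suc n - N) = exp (- K) ^ (n - N) * exp (- K)" using n by (simp add: Suc_diff_le)
      { assume P: "exp (- K) ^ (n - N) * len n \<alpha> \<le> len N \<beta>"
        have "exp (- K) ^ (n - N) * (exp (- K) * len (Suc n) \<alpha>) \<le> exp (- K) ^ (n - N) * len n \<alpha>"
          using len_back(1) by (intro mult_left_mono) auto
        then show "exp (- K) ^ (Suc n - N) * len (Suc n) \<alpha> \<le> len N \<beta>" using P unfolding e mult.assoc by linarith }
      { assume P: "exp (- K) ^ (n - N) * len n (win n) \<le> len N \<beta>"
        have "exp (- K) ^ (n - N) * (exp (- K) * len (Suc n) (lose n)) \<le> exp (- K) ^ (n - N) * len n (win n)"
          using len_back(2) by (intro mult_left_mono) auto
        then show "exp (- K) ^ (Suc n - N) * len (Suc n) (lose n) \<le> len N \<beta>" using P unfolding e mult.assoc by linarith }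
    qed auto
    then show ?thesis by simp
  qed
  have "(\<Sum>\<alpha>\<in>(UNIV::'a set). b (N + 2 * k) / real CARD('a)) \<le> (\<Sum>\<alpha>\<in>UNIV. len (N + 2 * k) \<alpha>)"
    using ipart_sum[OF top[of "N + 2 * k"]] by (simp add: len_def)
  from sum_ge_ex[OF this] obtain \<gamma> where g: "b (N + 2 * k) / real CARD('a) \<le> len (N + 2 * k) \<gamma>" by blast
  have "c0 * b N \<le> c0 * ((1 + E) ^ (2 * k) * b (N + 2 * k))"
    using b_le_add[of N "2 * k"] c0_pos by (intro mult_left_mono) auto
  also have "\<dots> = exp (- K) ^ (2 * k) * (b (N + 2 * k) / real CARD('a))"
  proof -
    have "(1 + E) ^ (2 * k) \<noteq> 0" using zero_less_power[of "1 + E" "2 * k"] add_pos_pos[of 1 E] by simp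
    moreover have "e / (d * Z) * (Z * y) = e * (y / d)" if "Z \<noteq> 0" "d \<noteq> 0" for e d Z y :: real
      using that by simp
    ultimately show ?thesis unfolding c0_def using card_pos by (metis less_irrefl)
  qed
  also have "\<dots> \<le> exp (- K) ^ (2 * k) * len (N + 2 * k) \<gamma>" using g by (intro mult_left_mono) auto
  also have "\<dots> \<le> len N \<beta>" by (rule all)
  finally show ?thesis .
qed

text \<open>The end removed at step n has length at least exp (- K) times \<open>c0\<close> times
  \<open>b (Suc n)\<close>, so the domain shrinks at least by the factor \<open>th\<close>.\<close>

definition "th = 1 / (1 + exp (- K) * c0)"

lemma th: "0 < th" "th < 1" unfolding th_def using c0_pos eK by (auto simp: add_pos_pos)

lemma b_contract: "b (n + j) \<le> th ^ j * b n"
proof (induction j)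
  case (Suc j)
  have "exp (- K) * (c0 * b (Suc (n + j))) \<le> exp (- K) * len (Suc (n + j)) (lose (n + j))"
    using len_ge by (intro mult_left_mono) auto
  also have "\<dots> \<le> b (n + j) - b (Suc (n + j))" by (rule b_diff(1))
  finally have "exp (- K) * (c0 * b (Suc (n + j))) \<le> b (n + j) - b (Suc (n + j))" .
  then have "(1 + exp (- K) * c0) * b (Suc (n + j)) \<le> b (n + j)" by (simp add: algebra_simps)
  then have "b (Suc (n + j)) \<le> th * b (n + j)"
    unfolding th_def using c0_pos eK by (simp add: field_simps add_pos_pos)
  also have "\<dots> \<le> th * (th ^ j * b n)" using Suc th by (intro mult_left_mono) auto
  finally show ?case by (simp add: mult.assoc)
qed auto

text \<open>As \<open>m\<close> increases by at most 1, \<open>h\<close> times the length is at most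
  1 at some point of each interval; exp \<open>C1\<close> is the distortion of \<open>h\<close>, and
  \<open>c0\<close> the relative length of a letter.\<close>

definition "C2 = exp C1 / c0"

lemma C2_pos: "0 < C2" unfolding C2_def using c0_pos by simp

lemma h_upper: assumes x: "x \<in> J n \<alpha>" shows "h n \<alpha> x \<le> C2 / b n"
proof -
  obtain \<xi> where xi: "l n \<alpha> < \<xi>" "\<xi> < r n \<alpha>" "m n \<alpha> (r n \<alpha>) - m n \<alpha> (l n \<alpha>) = h n \<alpha> \<xi> * (r n \<alpha> - l n \<alpha>)"
    using MVT_within[OF l_less m_deriv] by blast
  have xJ: "\<xi> \<in> J n \<alpha>" using xi by auto
  have pos: "0 < h n \<alpha> x" "0 < h n \<alpha> \<xi>" using h_ge1[OF x] h_ge1[OF xJ] by auto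
  have "ln (h n \<alpha> x) \<le> C1 + ln (h n \<alpha> \<xi>)" using lnh_osc[OF x xJ] by linarith
  then have "exp (ln (h n \<alpha> x)) \<le> exp (C1 + ln (h n \<alpha> \<xi>))" by simp
  then have 1: "h n \<alpha> x \<le> exp C1 * h n \<alpha> \<xi>" using pos by (simp add: exp_add)
  have "h n \<alpha> \<xi> * len n \<alpha> \<le> 1" using xi m_range_le[of n \<alpha> "l n \<alpha>" "r n \<alpha>"] l_less[of n \<alpha>] by (auto simp: len_def)
  moreover have "h n \<alpha> \<xi> * (c0 * b n) \<le> h n \<alpha> \<xi> * len n \<alpha>" using len_ge pos by (intro mult_left_mono) auto
  ultimately have "h n \<alpha> \<xi> \<le> 1 / (c0 * b n)" using c0_pos b_pos[of n] by (simp add: field_simps)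
  then have "exp C1 * h n \<alpha> \<xi> \<le> exp C1 * (1 / (c0 * b n))" by (intro mult_left_mono) auto
  also have "\<dots> = C2 / b n" unfolding C2_def by simp
  finally show ?thesis using 1 by linarith
qed

lemma m_diff_le:
  assumes "l n \<alpha> \<le> x" "x \<le> y" "y \<le> r n \<alpha>" shows "m n \<alpha> y - m n \<alpha> x \<le> C2 * ((y - x) / b n)"
proof (cases "x = y")
  case False
  then have lt: "x < y" using assms by auto
  obtain \<xi> where xi: "x < \<xi>" "\<xi> < y" "m n \<alpha> y - m n \<alpha> x = h n \<alpha> \<xi> * (y - x)"
    using MVT_within_sub[OF m_deriv, of n \<alpha> x y] lt assms by auto
  have "h n \<alpha> \<xi> * (y - x) \<le> C2 / b n * (y - x)"
    using h_upper[of \<xi> n \<alpha>] xi assms by (intro mult_right_mono) auto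
  then show ?thesis using xi by simp
qed auto

lemma h_Suc_lose:
  assumes x: "x \<in> J (Suc n) (lose n)"
  shows "h (Suc n) (lose n) x = h n (A1 n) x + h n (A0 n) (G n (A1 n) x) * exp (F n (A1 n) x)"
    and "x \<in> J n (A1 n)" "G n (A1 n) x \<in> J n (A0 n)" "exp (- K) \<le> exp (F n (A1 n) x)"
    "1 \<le> h n (A1 n) x" "1 \<le> h n (A0 n) (G n (A1 n) x)" "0 < h n (A0 n) (G n (A1 n) x) * exp (F n (A1 n) x)"
proof -
  show "h (Suc n) (lose n) x = h n (A1 n) x + h n (A0 n) (G n (A1 n) x) * exp (F n (A1 n) x)" by simp
  show 1: "x \<in> J n (A1 n)" using J_sub(2)[of n] x by blast
  show 2: "G n (A1 n) x \<in> J n (A0 n)" by (rule G_lose_in) (use x J_lose[of n] in simp)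
  show "exp (- K) \<le> exp (F n (A1 n) x)" using F_le[OF 1] by auto
  show "1 \<le> h n (A1 n) x" by (rule h_ge1[OF 1])
  show "1 \<le> h n (A0 n) (G n (A1 n) x)" by (rule h_ge1[OF 2])
  then show "0 < h n (A0 n) (G n (A1 n) x) * exp (F n (A1 n) x)" by (intro mult_pos_pos) auto
qed

lemma h_step_lower:
  assumes "0 \<le> v" and "(\<forall>x\<in>J n (A0 n). v \<le> h n (A0 n) x) \<or> (\<forall>x\<in>J n (A1 n). v \<le> h n (A1 n) x)"
    and x: "x \<in> J (Suc n) (lose n)"
  shows "v * exp (- K) \<le> h (Suc n) (lose n) x"
proof -
  note s = h_Suc_lose[OF x]
  have v1: "v * exp (- K) \<le> v" using mult_left_mono[OF eK(1) assms(1)] by simp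
  show ?thesis
  proof (cases "\<forall>x\<in>J n (A1 n). v \<le> h n (A1 n) x")
    case True
    then have "v \<le> h n (A1 n) x" using s by blast
    then show ?thesis using s(1,7) v1 by linarith
  next
    case False
    then have "v \<le> h n (A0 n) (G n (A1 n) x)" using assms s by blast
    then have "v * exp (- K) \<le> h n (A0 n) (G n (A1 n) x) * exp (F n (A1 n) x)"
      using s assms by (intro mult_mono) auto
    then show ?thesis using s(1,5) by linarith
  qed
qed

text \<open>The first entry covers the levels below 2k, where \<open>h\<close> at least 1 is enough.
  The second collects the distortion of \<open>h\<close>, 2k steps of \<open>spread\<close>, and the
  shrinking of the domain over these steps.\<close>

definition "c3 = min (b (2 * k)) (exp (- K) ^ (2 * k) * exp (- C1) / (1 + E) ^ (2 * k))"

lemma c3_pos: "0 < c3" unfolding c3_def using b_pos by (auto intro!: divide_pos_pos zero_less_power simp: add_pos_pos)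

text \<open>Relative lengths and increases of \<open>m\<close> both sum to 1 over the letters, so at
  level n - 2k some letter has \<open>h\<close> of order 1 / b at a point, and by bounded distortion
  on its whole interval. A new density is a sum containing each old one up to a slope, so the bound
  spreads to all letters.\<close>

lemma h_lower: assumes x: "x \<in> J n \<gamma>" shows "c3 / b n \<le> h n \<gamma> x"
proof (cases "n < 2 * k")
  case True
  then have "c3 \<le> b n" using b_antimono[of n "2 * k"] unfolding c3_def by linarith
  then have "c3 / b n \<le> 1" using b_pos[of n] by (simp add: divide_le_eq)
  then show ?thesis using h_ge1[OF x] by linarith
next
  case False
  define N where "N = n - 2 * k"
  have n: "n = N + 2 * k" using False by (simp add: N_def)
  have "(\<Sum>\<alpha>\<in>UNIV. len N \<alpha> / b N) \<le> (\<Sum>\<alpha>\<in>UNIV. m N \<alpha> (r N \<alpha>) - m N \<alpha> (l N \<alpha>))"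
    unfolding sum_divide_distrib[symmetric] m_sum using ipart_sum[OF top[of N]] b_pos[of N] by (simp add: len_def)
  from sum_ge_ex[OF this] obtain \<beta> where be: "len N \<beta> / b N \<le> m N \<beta> (r N \<beta>) - m N \<beta> (l N \<beta>)" by blast
  obtain \<xi> where xi: "l N \<beta> < \<xi>" "\<xi> < r N \<beta>" "m N \<beta> (r N \<beta>) - m N \<beta> (l N \<beta>) = h N \<beta> \<xi> * (r N \<beta> - l N \<beta>)"
    using MVT_within[OF l_less m_deriv] by blast
  have "len N \<beta> / b N \<le> h N \<beta> \<xi> * len N \<beta>" using be xi by (simp add: len_def)
  then have hx: "1 / b N \<le> h N \<beta> \<xi>" using len_pos[of N \<beta>] b_pos[of N] by (simp add: field_simps)
  define v where "v = exp (- C1) / b N"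
  have v0: "0 \<le> v" using b_pos[of N] by (simp add: v_def less_imp_le)
  have init: "v \<le> h N \<beta> y" if y: "y \<in> J N \<beta>" for y
  proof -
    have xJ: "\<xi> \<in> J N \<beta>" using xi by auto
    have "ln (h N \<beta> \<xi>) \<le> C1 + ln (h N \<beta> y)" using lnh_osc[OF y xJ] by linarith
    then have "exp (ln (h N \<beta> \<xi>)) \<le> exp (C1 + ln (h N \<beta> y))" by simp
    then have "h N \<beta> \<xi> \<le> exp C1 * h N \<beta> y" using h_ge1[OF y] h_ge1[OF xJ] by (simp add: exp_add)
    then have "exp (- C1) * h N \<beta> \<xi> \<le> exp (- C1) * (exp C1 * h N \<beta> y)" by (intro mult_left_mono) auto
    also have "\<dots> = h N \<beta> y" by (simp add: exp_minus)
    finally have "exp (- C1) * h N \<beta> \<xi> \<le> h N \<beta> y" .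
    moreover have "exp (- C1) * (1 / b N) \<le> exp (- C1) * h N \<beta> \<xi>" using hx by (intro mult_left_mono) auto
    moreover have "v = exp (- C1) * (1 / b N)" unfolding v_def by simp
    ultimately show ?thesis by linarith
  qed
  have "\<forall>y\<in>J (N + 2 * k) \<gamma>. v * exp (- K) ^ (N + 2 * k - N) \<le> h (N + 2 * k) \<gamma> y"
  proof (rule spread[where P = "\<lambda>n \<gamma>. \<forall>y\<in>J n \<gamma>. v * exp (- K) ^ (n - N) \<le> h n \<gamma> y" and N = N and \<beta> = \<beta>])
    show "\<forall>y\<in>J N \<beta>. v * exp (- K) ^ (N - N) \<le> h N \<beta> y" using init by simp
    fix n \<alpha> assume n: "N \<le> n"
    have e: "v * exp (- K) ^ (Suc n - N) = v * exp (- K) ^ (n - N) * exp (- K)" using n by (simp add: Suc_diff_le)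
    have w0: "0 \<le> v * exp (- K) ^ (n - N)" using v0 by auto
    have le: "v * exp (- K) ^ (Suc n - N) \<le> v * exp (- K) ^ (n - N)"
      unfolding e using mult_left_mono[OF eK(1) w0] by simp
    { assume P: "\<forall>y\<in>J n \<alpha>. v * exp (- K) ^ (n - N) \<le> h n \<alpha> y"
      show "\<forall>y\<in>J (Suc n) \<alpha>. v * exp (- K) ^ (Suc n - N) \<le> h (Suc n) \<alpha> y"
      proof (cases "\<alpha> = lose n")
        case True
        then have "\<alpha> = A0 n \<or> \<alpha> = A1 n" using lose_eq by auto
        then have "(\<forall>x\<in>J n (A0 n). v * exp (- K) ^ (n - N) \<le> h n (A0 n) x) \<or> (\<forall>x\<in>J n (A1 n). v * exp (- K) ^ (n - N) \<le> h n (A1 n) x)"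
          using P by metis
        from h_step_lower[OF w0 this] show ?thesis unfolding e True by blast
      next
        case False
        then have "\<forall>y\<in>J (Suc n) \<alpha>. v * exp (- K) ^ (n - N) \<le> h (Suc n) \<alpha> y" using P J_sub(1)[OF False] by auto
        then show ?thesis using le by (meson order_trans)
      qed }
    { assume P: "\<forall>y\<in>J n (win n). v * exp (- K) ^ (n - N) \<le> h n (win n) y"
      have "win n = A0 n \<or> win n = A1 n" using win_eq by auto
      then have "(\<forall>x\<in>J n (A0 n). v * exp (- K) ^ (n - N) \<le> h n (A0 n) x) \<or> (\<forall>x\<in>J n (A1 n). v * exp (- K) ^ (n - N) \<le> h n (A1 n) x)"
        using P by metis
      from h_step_lower[OF w0 this]
      show "\<forall>y\<in>J (Suc n) (lose n). v * exp (- K) ^ (Suc n - N) \<le> h (Suc n) (lose n) y" unfolding e by blast }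
  qed
  then have "v * exp (- K) ^ (2 * k) \<le> h n \<gamma> x" using x unfolding n by simp
  moreover have "c3 / b n \<le> v * exp (- K) ^ (2 * k)"
  proof -
    have p: "0 < (1 + E) ^ (2 * k)" by (intro zero_less_power) (auto simp: add_pos_pos)
    have "c3 / b n \<le> exp (- K) ^ (2 * k) * exp (- C1) / (1 + E) ^ (2 * k) / b n"
      using b_pos[of n] by (intro divide_right_mono) (auto simp: c3_def)
    also have "\<dots> = exp (- K) ^ (2 * k) * exp (- C1) * (1 / ((1 + E) ^ (2 * k) * b n))" by simp
    also have "\<dots> \<le> exp (- K) ^ (2 * k) * exp (- C1) * (1 / b N)"
    proof (rule mult_left_mono)
      show "1 / ((1 + E) ^ (2 * k) * b n) \<le> 1 / b N"
        using b_le_add[of N "2 * k"] b_pos[of N] unfolding n[symmetric] by (intro divide_left_mono) (auto simp: p b_pos)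
    qed auto
    finally show ?thesis unfolding v_def by (simp add: mult.commute)
  qed
  ultimately show ?thesis by linarith
qed

definition "wt n x = h n (A1 n) x / (h n (A1 n) x + h n (A0 n) (G n (A1 n) x) * exp (F n (A1 n) x))"
text \<open>Lower bound for both averaging weights: each summand of the new density is at least c3
  exp (- K) / \<open>b n\<close>, and their sum is at most \<open>C2\<close> /
  \<open>b (Suc n)\<close>, hence at most \<open>C2\<close> (1 + \<open>E\<close>) /
  \<open>b n\<close>.\<close>

definition "dl = c3 * exp (- K) / (C2 * (1 + E))"

lemma dl_pos: "0 < dl" unfolding dl_def using c3_pos C2_pos by (auto intro!: divide_pos_pos mult_pos_pos simp: add_pos_pos)

lemma psi_Suc_lose:
  assumes x: "x \<in> J (Suc n) (lose n)"
  shows "psi (Suc n) (lose n) x = wt n x * psi n (A1 n) x + (1 - wt n x) * psi n (A0 n) (G n (A1 n) x)"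
    and "dl \<le> wt n x" "dl \<le> 1 - wt n x"
proof -
  note s = h_Suc_lose[OF x]
  let ?p = "h n (A1 n) x" and ?q = "h n (A0 n) (G n (A1 n) x) * exp (F n (A1 n) x)"
  have pq: "0 < ?p + ?q" using s by linarith
  have w: "wt n x = ?p / (?p + ?q)" "1 - wt n x = ?q / (?p + ?q)" using pq unfolding wt_def by (auto simp: field_simps)
  show "psi (Suc n) (lose n) x = wt n x * psi n (A1 n) x + (1 - wt n x) * psi n (A0 n) (G n (A1 n) x)"
    unfolding w(2) unfolding w(1) by (simp add: add_divide_distrib mult.commute)
  have "?p + ?q \<le> C2 / b (Suc n)" using h_upper[OF x] s(1) by simp
  also have "\<dots> \<le> C2 * (1 + E) / b n"
    using mult_left_mono[OF b_le_Suc[of n], of C2] C2_pos b_pos[of n] b_pos[of "Suc n"] by (simp add: field_simps)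
  finally have up: "?p + ?q \<le> C2 * (1 + E) / b n" .
  have lo: "c3 / b n \<le> ?p" "c3 / b n \<le> h n (A0 n) (G n (A1 n) x)" using h_lower s by auto
  have cb: "0 < c3 / b n" using c3_pos b_pos[of n] by simp
  have q: "c3 / b n * exp (- K) \<le> ?q" using lo s cb by (intro mult_mono) auto
  have p: "c3 / b n * exp (- K) \<le> ?p"
    using lo(1) mult_left_mono[OF eK(1), of "c3 / b n"] cb by simp
  have CE: "0 < C2 * (1 + E)" using C2_pos by (auto intro!: mult_pos_pos simp: add_pos_pos)
  have d: "dl = (c3 / b n * exp (- K)) / (C2 * (1 + E) / b n)"
    unfolding dl_def using b_pos[of n] CE by (simp add: field_simps)
  show "dl \<le> wt n x" "dl \<le> 1 - wt n x" unfolding d w(2) unfolding w(1)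
    by (rule frac_le; use p q s up pq cb in auto)+
qed

lemma dl_le1: "dl \<le> 1"
proof -
  have "xc 0 \<in> J (Suc 0) (lose 0)" using J_lose[of 0] xc(2)[of 0] by simp
  from psi_Suc_lose(2,3)[OF this] show ?thesis using dl_pos by linarith
qed

text \<open>A weight is the logistic function of a difference of logarithms, and this function has
  Lipschitz constant at most 1. So the variation bounds for ln \<open>h\<close> and \<open>F\<close>
  carry over to the weights.\<close>

lemma logistic_diff:
  fixes a b a' b' :: real
  assumes "0 < a" "0 < b" "0 < a'" "0 < b'"
  shows "\<bar>a / (a + b) - a' / (a' + b')\<bar> \<le> \<bar>(ln b - ln a) - (ln b' - ln a')\<bar>"
proof -
  have e: "p / (p + q) = 1 / (1 + exp (ln q - ln p))" if "0 < p" "0 < q" for p q :: real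
    using that by (simp add: exp_diff field_simps)
  have "norm (1 / (1 + exp z) - 1 / (1 + exp w)) \<le> 1 * norm (z - w)" for z w :: real
  proof (rule field_differentiable_bound[of UNIV "\<lambda>z. 1 / (1 + exp z)" "\<lambda>z. - (exp z) / (1 + exp z)^2"])
    fix z :: real
    have p: "1 + exp z \<noteq> 0" using exp_gt_zero[of z] by linarith
    show "((\<lambda>z. 1 / (1 + exp z)) has_field_derivative - (exp z) / (1 + exp z)^2) (at z within UNIV)"
      using p by (auto intro!: derivative_eq_intros simp: power2_eq_square)
    have "exp z \<le> (1 + exp z)^2" by (simp add: power2_eq_square algebra_simps)
    then show "norm (- (exp z) / (1 + exp z)^2) \<le> 1" by (simp add: divide_le_eq)
  qed auto
  from this[of "ln b - ln a" "ln b' - ln a'"] show ?thesis using e[of a b] e[of a' b'] assms by simp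
qed

lemma wt_diff:
  assumes x: "x \<in> J (Suc n) (lose n)" and y: "y \<in> J (Suc n) (lose n)" and xy: "x \<le> y"
  shows "\<bar>wt n x - wt n y\<bar> \<le> 2 * C1 * C2 * ((y - x) / b (Suc n))"
proof -
  note s = h_Suc_lose[OF x] and t = h_Suc_lose[OF y]
  let ?a = "A1 n" and ?c = "A0 n"
  have gle: "G n ?a x \<le> G n ?a y" using G_mono[of n ?a x y] s t xy by (cases "x = y") auto
  have 1: "\<bar>ln (h n ?a x) - ln (h n ?a y)\<bar> \<le> C1 * (m n ?a y - m n ?a x)"
    by (rule lnh_diff) (use s t xy in auto)
  have 2: "\<bar>ln (h n ?c (G n ?a x)) - ln (h n ?c (G n ?a y))\<bar> \<le> C1 * (m n ?c (G n ?a y) - m n ?c (G n ?a x))"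
    by (rule lnh_diff) (use s t gle in auto)
  have 3: "\<bar>F n ?a x - F n ?a y\<bar> \<le> C1 * (m n ?a y - m n ?a x)"
    by (rule F_diff) (use s t xy in auto)
  have mc: "0 \<le> C1 * (m n ?c (G n ?a y) - m n ?c (G n ?a x))"
    using m_mono[of n ?c "G n ?a x" "G n ?a y"] s t gle C1 by auto
  have e: "ln (h n ?c (G n ?a z) * exp (F n ?a z)) = ln (h n ?c (G n ?a z)) + F n ?a z" if "1 \<le> h n ?c (G n ?a z)" for z
    using that by (subst ln_mult) auto
  have "\<bar>wt n x - wt n y\<bar> \<le> \<bar>(ln (h n ?c (G n ?a x) * exp (F n ?a x)) - ln (h n ?a x)) -
      (ln (h n ?c (G n ?a y) * exp (F n ?a y)) - ln (h n ?a y))\<bar>"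
    unfolding wt_def by (rule logistic_diff) (use s t in auto)
  also have "\<dots> \<le> 2 * (C1 * (m n ?a y - m n ?a x) + C1 * (m n ?c (G n ?a y) - m n ?c (G n ?a x)))"
  proof -
    have "\<bar>(v + w - u) - (v' + w' - u')\<bar> \<le> 2 * (p + q)"
      if "\<bar>u - u'\<bar> \<le> p" "\<bar>v - v'\<bar> \<le> q" "\<bar>w - w'\<bar> \<le> p" "0 \<le> q" for u u' v v' w w' p q :: real
      using that by auto
    from this[OF 1 2 3 mc] show ?thesis unfolding e[OF s(6)] e[OF t(6)] .
  qed
  also have "\<dots> = 2 * C1 * (m (Suc n) (lose n) y - m (Suc n) (lose n) x)" by (simp add: algebra_simps)
  also have "\<dots> \<le> 2 * C1 * (C2 * ((y - x) / b (Suc n)))"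
    using m_diff_le[of "Suc n" "lose n" x y] x y xy C1 by (intro mult_left_mono) auto
  finally show ?thesis by (simp add: mult.assoc)
qed

end

section \<open>Contraction of the oscillation\<close>

lemma mix_upper:
  fixes p a c S D e :: real
  assumes "0 \<le> e" "e \<le> p" "p \<le> 1" "a \<le> S - D" "c \<le> S" "0 \<le> D"
  shows "p * a + (1 - p) * c \<le> S - e * D"
proof -
  have "p * a \<le> p * (S - D)" "(1 - p) * c \<le> (1 - p) * S" "e * D \<le> p * D"
    using assms by (auto intro!: mult_left_mono mult_right_mono)
  then show ?thesis by (simp add: algebra_simps)
qed

lemma mix_lower:
  fixes p a c S D e :: real
  assumes "0 \<le> e" "e \<le> p" "p \<le> 1" "S + D \<le> a" "S \<le> c" "0 \<le> D"
  shows "S + e * D \<le> p * a + (1 - p) * c"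
  using mix_upper[of e p "- a" "- S" D "- c"] assms by auto

lemma slope_var_weaken:
  assumes "slope_var g m1 p q" "mono_on {p..q} m2"
  shows "slope_var g (\<lambda>x. m1 x + m2 x) p q"
  unfolding slope_var_def
proof (intro conjI allI impI)
  show "strict_mono_on {p..q} g" using assms by (auto simp: slope_var_def)
  show "mono_on {p..q} (\<lambda>x. m1 x + m2 x)" using assms by (auto simp: slope_var_def mono_on_def intro: add_mono)
  fix x y x' y' assume a: "p \<le> x" "x < y" "y \<le> q" "p \<le> x'" "x' < y'" "y' \<le> q"
  have "m2 (min x x') \<le> m2 (max y y')" by (rule mono_onD[OF assms(2)]) (use a in auto)
  then show "\<bar>sl g x y - sl g x' y'\<bar> \<le> m1 (max y y') + m2 (max y y') - (m1 (min x x') + m2 (min x x'))"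
    using slope_varD[OF assms(1) a] by linarith
qed

lemma slope_var_ratio:
  assumes "slope_var q M p s" "M s - M p \<le> C" "p \<le> x" "x < y" "y \<le> s" "p \<le> x'" "x' < y'" "y' \<le> s"
  shows "(q y - q x) / (y - x) \<le> exp C * ((q y' - q x') / (y' - x'))"
proof -
  have pos: "0 < (q y - q x) / (y - x)" "0 < (q y' - q x') / (y' - x')"
    using slope_var_mono[OF assms(1)] assms by auto
  have "\<bar>sl q x y - sl q x' y'\<bar> \<le> C" using slope_var_total[OF assms(1,3-8)] assms(2) by linarith
  then have "sl q x y \<le> C + sl q x' y'" by linarith
  then have "exp (sl q x y) \<le> exp (C + sl q x' y')" by simp
  then show ?thesis using pos unfolding sl_def exp_add by simp
qed

text \<open>By bounded distortion the image of the complementary piece is at least c exp (- C) times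
  the image of the given piece, which therefore takes up only a definite fraction of the
  whole.\<close>

lemma slope_var_cut:
  assumes sv: "slope_var q M p s" "M s - M p \<le> C" and y: "p < y" "y < s" and c: "0 \<le> c"
  shows "c * (y - p) \<le> s - y \<Longrightarrow> (1 + c * exp (- C)) * (q y - q p) \<le> q s - q p"
    and "c * (s - y) \<le> y - p \<Longrightarrow> (1 + c * exp (- C)) * (q s - q y) \<le> q s - q p"
proof -
  have inc: "q p < q y" "q y < q s" using slope_var_mono[OF sv(1)] y by auto
  have gen: "c * exp (- C) * u \<le> v" if "u / d \<le> exp C * (v / e)" "c * d \<le> e" "0 < d" "0 < e" "0 < v" for u v d e :: real
  proof -
    have "u \<le> exp C * (v / e) * d" using that by (simp add: divide_le_eq)
    then have "c * exp (- C) * u \<le> c * exp (- C) * (exp C * (v / e) * d)" using c by (intro mult_left_mono) auto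
    also have "\<dots> = (c * d) * (v / e) * (exp (- C) * exp C)" by (simp add: ac_simps)
    also have "\<dots> = (c * d) * (v / e)" by (simp add: exp_minus)
    also have "\<dots> \<le> e * (v / e)" using that by (intro mult_right_mono) auto
    also have "\<dots> = v" using that by simp
    finally show ?thesis .
  qed
  {
    assume a: "c * (y - p) \<le> s - y"
    have "c * exp (- C) * (q y - q p) \<le> q s - q y"
      by (rule gen[OF slope_var_ratio[OF sv, of p y y s] a]) (use y inc in auto)
    then show "(1 + c * exp (- C)) * (q y - q p) \<le> q s - q p" by (simp add: distrib_right)
  next
    assume a: "c * (s - y) \<le> y - p"
    have "c * exp (- C) * (q s - q y) \<le> q y - q p"
      by (rule gen[OF slope_var_ratio[OF sv, of y s p y] a]) (use y inc in auto)
    then show "(1 + c * exp (- C)) * (q s - q y) \<le> q s - q p" by (simp add: distrib_right)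
  }
qed

context rvsmooth
begin

definition "osc n s S \<longleftrightarrow> (\<forall>\<alpha>. \<forall>x\<in>J n \<alpha>. s \<le> psi n \<alpha> x \<and> psi n \<alpha> x \<le> S)"

lemma osc_Suc: assumes o: "osc n s S" shows "osc (Suc n) s S"
  unfolding osc_def
proof (intro allI ballI)
  fix \<alpha> x assume x: "x \<in> J (Suc n) \<alpha>"
  show "s \<le> psi (Suc n) \<alpha> x \<and> psi (Suc n) \<alpha> x \<le> S"
  proof (cases "\<alpha> = lose n")
    case False
    then have "psi (Suc n) \<alpha> x = psi n \<alpha> x" "x \<in> J n \<alpha>" using J_sub(1)[OF False] x by auto
    then show ?thesis using o unfolding osc_def by auto
  next
    case True
    have x': "x \<in> J (Suc n) (lose n)" using x True by simp
    note p = psi_Suc_lose[OF x'] and hh = h_Suc_lose(2,3)[OF x']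
    have ab: "s \<le> psi n (A1 n) x" "psi n (A1 n) x \<le> S" "s \<le> psi n (A0 n) (G n (A1 n) x)" "psi n (A0 n) (G n (A1 n) x) \<le> S"
      using o hh unfolding osc_def by blast+
    show ?thesis unfolding True p(1)
      using mix_upper[of 0 "wt n x" "psi n (A1 n) x" S 0 "psi n (A0 n) (G n (A1 n) x)"]
        mix_lower[of 0 "wt n x" s 0 "psi n (A1 n) x" "psi n (A0 n) (G n (A1 n) x)"] p(2,3) ab dl_pos by auto
  qed
qed

lemma osc_mono: "n \<le> n' \<Longrightarrow> osc n s S \<Longrightarrow> osc n' s S"
  by (induction n' rule: dec_induct) (use osc_Suc in auto)

text \<open>When a letter takes part in an average, its distance from the global bounds is handed to
  the new loser, reduced by the weight, which is at least \<open>dl\<close>. By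
  \<open>spread\<close> every letter has received its share after 2k steps.\<close>

lemma osc_spread:
  assumes o: "osc N s S" and B: "B1 \<le> S" "s \<le> B2" and be: "\<forall>x\<in>J N \<beta>. B2 \<le> psi N \<beta> x \<and> psi N \<beta> x \<le> B1"
  shows "osc (N + 2 * k) (s + dl ^ (2 * k) * (B2 - s)) (S - dl ^ (2 * k) * (S - B1))"
proof -
  define P where "P n \<alpha> \<longleftrightarrow> (\<forall>x\<in>J n \<alpha>. s + dl ^ (n - N) * (B2 - s) \<le> psi n \<alpha> x \<and> psi n \<alpha> x \<le> S - dl ^ (n - N) * (S - B1))" for n \<alpha>
  have lose: "P (Suc n) (lose n)" if n: "N \<le> n" and c: "P n (A0 n) \<or> P n (A1 n)" for n
    unfolding P_def
  proof (intro ballI)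
    fix x assume x: "x \<in> J (Suc n) (lose n)"
    note p = psi_Suc_lose[OF x] and hh = h_Suc_lose(2,3)[OF x]
    let ?a = "psi n (A1 n) x" and ?c = "psi n (A0 n) (G n (A1 n) x)" and ?w = "wt n x"
    define d1 where "d1 = dl ^ (n - N) * (B2 - s)"
    define d2 where "d2 = dl ^ (n - N) * (S - B1)"
    have d: "0 \<le> d1" "0 \<le> d2" using B dl_pos by (auto simp: d1_def d2_def)
    have e: "dl ^ (Suc n - N) * (B2 - s) = dl * d1" "dl ^ (Suc n - N) * (S - B1) = dl * d2"
      using n by (simp_all add: Suc_diff_le d1_def d2_def)
    have ab: "s \<le> ?a" "?a \<le> S" "s \<le> ?c" "?c \<le> S"
      using osc_mono[OF n o] hh unfolding osc_def by blast+
    have w: "0 \<le> dl" "dl \<le> ?w" "?w \<le> 1" "dl \<le> 1 - ?w" "1 - ?w \<le> 1" using p(2,3) dl_pos by auto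
    show "s + dl ^ (Suc n - N) * (B2 - s) \<le> psi (Suc n) (lose n) x \<and> psi (Suc n) (lose n) x \<le> S - dl ^ (Suc n - N) * (S - B1)"
      using c
    proof
      assume "P n (A1 n)"
      then have "s + d1 \<le> ?a" "?a \<le> S - d2" using hh unfolding P_def d1_def d2_def by blast+
      then show ?thesis unfolding e p(1) using mix_upper[OF w(1,2,3), of ?a S d2 ?c] mix_lower[OF w(1,2,3), of s d1 ?a ?c] ab d by auto
    next
      assume "P n (A0 n)"
      then have "s + d1 \<le> ?c" "?c \<le> S - d2" using hh unfolding P_def d1_def d2_def by blast+
      then show ?thesis unfolding e p(1) using mix_upper[OF w(1,4,5), of ?c S d2 ?a] mix_lower[OF w(1,4,5), of s d1 ?c ?a] ab d by auto
    qed
  qed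
  have all: "P (N + 2 * k) \<gamma>" for \<gamma>
  proof (rule spread[where P = P and N = N and \<beta> = \<beta>])
    show "P N \<beta>" using be unfolding P_def by simp
    fix n \<alpha> assume n: "N \<le> n"
    { assume P: "P n \<alpha>"
      show "P (Suc n) \<alpha>"
      proof (cases "\<alpha> = lose n")
        case True
        then have "P n (A0 n) \<or> P n (A1 n)" using P lose_eq[of n] by (auto split: if_splits)
        then show ?thesis using lose[OF n] True by simp
      next
        case False
        have "dl ^ (Suc n - N) \<le> dl ^ (n - N)" using dl_pos dl_le1 n by (intro power_decreasing) auto
        then have "dl ^ (Suc n - N) * (B2 - s) \<le> dl ^ (n - N) * (B2 - s)" "dl ^ (Suc n - N) * (S - B1) \<le> dl ^ (n - N) * (S - B1)"
          using B by (auto intro!: mult_right_mono)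
        moreover have "psi (Suc n) \<alpha> = psi n \<alpha>" using False by simp
        moreover have "J (Suc n) \<alpha> \<subseteq> J n \<alpha>" by (rule J_sub(1)[OF False])
        ultimately show ?thesis using P unfolding P_def by (smt (verit) subset_iff)
      qed }
    { assume "P n (win n)"
      then have "P n (A0 n) \<or> P n (A1 n)" using win_eq[of n] by (auto split: if_splits)
      then show "P (Suc n) (lose n)" by (rule lose[OF n]) }
  qed
  show ?thesis unfolding osc_def using all unfolding P_def by simp
qed

text \<open>One of the two values averaged is taken at x itself. Following this term back for t
  steps keeps the base point x and collects a weight of at least \<open>dl\<close> per step.\<close>

lemma psi_descend:
  assumes o: "osc n s S"
  shows "\<exists>\<beta>. J (n + t) \<gamma> \<subseteq> J n \<beta> \<and> (\<forall>x\<in>J (n + t) \<gamma>. s + dl ^ t * (psi n \<beta> x - s) \<le> psi (n + t) \<gamma> x \<and>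
     psi (n + t) \<gamma> x \<le> S - dl ^ t * (S - psi n \<beta> x))"
proof (induction t arbitrary: \<gamma>)
  case 0
  show ?case by (intro exI[of _ \<gamma>]) auto
next
  case (Suc t)
  let ?i = "n + t"
  show ?case
  proof (cases "\<gamma> = lose ?i")
    case False
    obtain \<beta> where be: "J ?i \<gamma> \<subseteq> J n \<beta>" "\<forall>x\<in>J ?i \<gamma>. s + dl ^ t * (psi n \<beta> x - s) \<le> psi ?i \<gamma> x \<and>
     psi ?i \<gamma> x \<le> S - dl ^ t * (S - psi n \<beta> x)" using Suc by blast
    have sub: "J (Suc ?i) \<gamma> \<subseteq> J ?i \<gamma>" by (rule J_sub(1)[OF False])
    show ?thesis
    proof (intro exI[of _ \<beta>] conjI ballI)
      show "J (n + Suc t) \<gamma> \<subseteq> J n \<beta>" using sub be by auto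
      fix x assume x: "x \<in> J (n + Suc t) \<gamma>"
      have xi: "x \<in> J ?i \<gamma>" and xn: "x \<in> J n \<beta>" using x sub be(1) by auto
      have ab: "s \<le> psi n \<beta> x" "psi n \<beta> x \<le> S" using o xn unfolding osc_def by blast+
      have "dl ^ Suc t \<le> dl ^ t" using dl_pos dl_le1 by (intro power_decreasing) auto
      then have "dl ^ Suc t * (psi n \<beta> x - s) \<le> dl ^ t * (psi n \<beta> x - s)" "dl ^ Suc t * (S - psi n \<beta> x) \<le> dl ^ t * (S - psi n \<beta> x)"
        using ab by (auto intro!: mult_right_mono simp del: power_Suc)
      moreover have "psi (n + Suc t) \<gamma> x = psi ?i \<gamma> x" using False by simp
      ultimately show "s + dl ^ Suc t * (psi n \<beta> x - s) \<le> psi (n + Suc t) \<gamma> x" "psi (n + Suc t) \<gamma> x \<le> S - dl ^ Suc t * (S - psi n \<beta> x)"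
        using be(2) xi by (smt (verit))+
    qed
  next
    case True
    obtain \<beta> where be: "J ?i (A1 ?i) \<subseteq> J n \<beta>" "\<forall>x\<in>J ?i (A1 ?i). s + dl ^ t * (psi n \<beta> x - s) \<le> psi ?i (A1 ?i) x \<and>
     psi ?i (A1 ?i) x \<le> S - dl ^ t * (S - psi n \<beta> x)" using Suc by blast
    show ?thesis
    proof (intro exI[of _ \<beta>] conjI ballI)
      show "J (n + Suc t) \<gamma> \<subseteq> J n \<beta>" unfolding True add_Suc_right by (rule subset_trans[OF J_sub(2) be(1)])
      fix x assume "x \<in> J (n + Suc t) \<gamma>"
      then have x: "x \<in> J (Suc ?i) (lose ?i)" using True by simp
      note p = psi_Suc_lose[OF x] and hh = h_Suc_lose(2,3)[OF x]
      have w: "0 \<le> dl" "dl \<le> wt ?i x" "wt ?i x \<le> 1" using p(2,3) dl_pos by auto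
      have cc: "s \<le> psi ?i (A0 ?i) (G ?i (A1 ?i) x)" "psi ?i (A0 ?i) (G ?i (A1 ?i) x) \<le> S"
        using osc_mono[of n ?i s S] o hh(2) unfolding osc_def by auto
      have xn: "x \<in> J n \<beta>" using hh(1) be(1) by blast
      have ab: "s \<le> psi n \<beta> x" "psi n \<beta> x \<le> S" using o xn unfolding osc_def by blast+
      have d: "0 \<le> dl ^ t * (psi n \<beta> x - s)" "0 \<le> dl ^ t * (S - psi n \<beta> x)" using ab dl_pos by auto
      have a: "s + dl ^ t * (psi n \<beta> x - s) \<le> psi ?i (A1 ?i) x" "psi ?i (A1 ?i) x \<le> S - dl ^ t * (S - psi n \<beta> x)"
        using be(2) hh(1) by blast+
      have e: "psi (n + Suc t) \<gamma> x = wt ?i x * psi ?i (A1 ?i) x + (1 - wt ?i x) * psi ?i (A0 ?i) (G ?i (A1 ?i) x)"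
        using p(1) True by simp
      show "s + dl ^ Suc t * (psi n \<beta> x - s) \<le> psi (n + Suc t) \<gamma> x" "psi (n + Suc t) \<gamma> x \<le> S - dl ^ Suc t * (S - psi n \<beta> x)"
        unfolding e using mix_lower[OF w a(1) cc(1) d(1)] mix_upper[OF w a(2) cc(2) d(2)] by (simp_all add: mult.assoc)
    qed
  qed
qed

text \<open>Distances are measured in units of the domain length, so constants at different levels
  are comparable.\<close>

definition "hol n H \<longleftrightarrow> (\<forall>\<alpha>. \<forall>x\<in>J n \<alpha>. \<forall>y\<in>J n \<alpha>. \<bar>psi n \<alpha> x - psi n \<alpha> y\<bar> \<le> H * (\<bar>x - y\<bar> / b n) powr \<nu>)"

text \<open>An interval of level n + t is so short compared with level n that the old
  \<open>psi\<close> is nearly a constant c on it. The new \<open>psi\<close> there contains this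
  near constant with weight \<open>dl ^ t\<close>, which moves it away from whichever extreme c is
  far from; \<open>osc_spread\<close> extends the gain to all letters.\<close>

lemma osc_contract:
  assumes o: "osc n s S" and sS: "s \<le> S" and H: "hol n H" "0 \<le> H" and t: "(th ^ t) powr \<nu> \<le> \<eta>"
  shows "\<exists>s' S'. osc (n + t + 2 * k) s' S' \<and> s' \<le> S' \<and>
     S' - s' \<le> (1 - dl ^ (t + 2 * k)) * (S - s) + 2 * dl ^ (t + 2 * k) * (\<eta> * H)"
proof -
  fix \<gamma> :: 'a
  obtain \<beta> where be: "J (n + t) \<gamma> \<subseteq> J n \<beta>" "\<forall>x\<in>J (n + t) \<gamma>. s + dl ^ t * (psi n \<beta> x - s) \<le> psi (n + t) \<gamma> x \<and>
     psi (n + t) \<gamma> x \<le> S - dl ^ t * (S - psi n \<beta> x)" using psi_descend[OF o] by blast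
  define x0 where "x0 = l (n + t) \<gamma>"
  define c where "c = psi n \<beta> x0"
  have x0: "x0 \<in> J (n + t) \<gamma>" "x0 \<in> J n \<beta>" using l_less[of "n + t" \<gamma>] be(1) by (auto simp: x0_def)
  have near: "\<bar>psi n \<beta> x - c\<bar> \<le> \<eta> * H" if x: "x \<in> J (n + t) \<gamma>" for x
  proof -
    have "x \<in> J n \<beta>" using be(1) x by blast
    then have "\<bar>psi n \<beta> x - c\<bar> \<le> H * (\<bar>x - x0\<bar> / b n) powr \<nu>" using H(1) x0(2) unfolding hol_def c_def by blast
    also have "\<dots> \<le> H * \<eta>"
    proof (rule mult_left_mono[OF _ H(2)])
      have "\<bar>x - x0\<bar> \<le> len (n + t) \<gamma>" using x by (auto simp: x0_def len_def)
      also have "\<dots> \<le> th ^ t * b n" using len_le[of "n + t" \<gamma>] b_contract[of n t] by linarith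
      finally have "\<bar>x - x0\<bar> / b n \<le> th ^ t" using b_pos[of n] by (simp add: divide_le_eq)
      then have "(\<bar>x - x0\<bar> / b n) powr \<nu> \<le> (th ^ t) powr \<nu>" using nu b_pos[of n] by (intro powr_mono2) auto
      then show "(\<bar>x - x0\<bar> / b n) powr \<nu> \<le> \<eta>" using t by linarith
    qed
    finally show ?thesis by (simp add: mult.commute)
  qed
  \<comment> \<open>Clamping to the global bounds keeps \<open>osc_spread\<close> applicable even
    when the Hoelder error exceeds the distance from c to s or S.\<close>
  define B1 where "B1 = min S (c + \<eta> * H)"
  define B2 where "B2 = max s (c - \<eta> * H)"
  have B: "B1 \<le> S" "s \<le> B2" "B1 \<le> c + \<eta> * H" "c - \<eta> * H \<le> B2" by (auto simp: B1_def B2_def)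
  have ob: "s \<le> psi n \<beta> x" "psi n \<beta> x \<le> S" if "x \<in> J (n + t) \<gamma>" for x using o be(1) that unfolding osc_def by blast+
  define d where "d = dl ^ t"
  have d0: "0 \<le> d" "d \<le> 1" using dl_pos dl_le1 by (auto simp: d_def power_le_one)
  have pB: "\<forall>x\<in>J (n + t) \<gamma>. s + d * (B2 - s) \<le> psi (n + t) \<gamma> x \<and> psi (n + t) \<gamma> x \<le> S - d * (S - B1)"
  proof
    fix x assume x: "x \<in> J (n + t) \<gamma>"
    have "psi n \<beta> x \<le> B1" "B2 \<le> psi n \<beta> x" using near[OF x] ob[OF x] by (auto simp: B1_def B2_def)
    then have "d * (B2 - s) \<le> d * (psi n \<beta> x - s)" "d * (S - B1) \<le> d * (S - psi n \<beta> x)"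
      using d0 by (auto intro!: mult_left_mono)
    then show "s + d * (B2 - s) \<le> psi (n + t) \<gamma> x \<and> psi (n + t) \<gamma> x \<le> S - d * (S - B1)"
      using be(2) x unfolding d_def by (smt (verit))
  qed
  have on: "osc (n + t) s S" using osc_mono[OF _ o, of "n + t"] by auto
  have dB: "0 \<le> d * (S - B1)" "0 \<le> d * (B2 - s)" using d0 B by auto
  from osc_spread[OF on _ _ pB] dB
  have "osc (n + t + 2 * k) (s + dl ^ (2 * k) * (d * (B2 - s))) (S - dl ^ (2 * k) * (d * (S - B1)))" by simp
  moreover have e: "dl ^ (2 * k) * (d * y) = dl ^ (t + 2 * k) * y" for y by (simp add: d_def power_add)
  ultimately have o2: "osc (n + t + 2 * k) (s + dl ^ (t + 2 * k) * (B2 - s)) (S - dl ^ (t + 2 * k) * (S - B1))" by simp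
  moreover have "s + dl ^ (t + 2 * k) * (B2 - s) \<le> S - dl ^ (t + 2 * k) * (S - B1)"
  proof -
    fix \<gamma> :: 'a
    have "l (n + t + 2 * k) \<gamma> \<in> J (n + t + 2 * k) \<gamma>" using l_less[of "n + t + 2 * k" \<gamma>] by auto
    then show ?thesis using o2 unfolding osc_def by (meson order_trans)
  qed
  moreover have "(S - dl ^ (t + 2 * k) * (S - B1)) - (s + dl ^ (t + 2 * k) * (B2 - s)) \<le>
      (1 - dl ^ (t + 2 * k)) * (S - s) + 2 * dl ^ (t + 2 * k) * (\<eta> * H)"
  proof -
    have "dl ^ (t + 2 * k) * (B1 - B2) \<le> dl ^ (t + 2 * k) * (2 * (\<eta> * H))"
      using B dl_pos by (intro mult_left_mono) auto
    then show ?thesis by (simp add: algebra_simps)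
  qed
  ultimately show ?thesis by blast
qed

text \<open>The iterates of the n-th map that carry a letter of level n + j through the letters of level n.\<close>
primrec PS :: "nat \<Rightarrow> nat \<Rightarrow> 'a \<Rightarrow> (real \<Rightarrow> real) set" where
  "PS n 0 = (\<lambda>\<alpha>. {\<lambda>x. x})"
| "PS n (Suc j) = (PS n j)(lose (n + j) := PS n j (A1 (n + j)) \<union> (\<lambda>q x. q (G (n + j) (A1 (n + j)) x)) ` PS n j (A0 (n + j)))"

lemma C1m_mono: "mono_on (J n \<alpha>) (\<lambda>x. C1 * m n \<alpha> x)"
  unfolding mono_on_def using m_mono[of n \<alpha>] C1 by (auto intro!: mult_left_mono)

lemma G_slope_var: "slope_var (G n \<alpha>) (\<lambda>x. C1 * m n \<alpha> x) (l n \<alpha>) (r n \<alpha>)"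
  unfolding slope_var_def
proof (intro conjI allI impI)
  show "strict_mono_on (J n \<alpha>) (G n \<alpha>)" unfolding strict_mono_on_def using G_mono[of n \<alpha>] by auto
  show "mono_on (J n \<alpha>) (\<lambda>x. C1 * m n \<alpha> x)" by (rule C1m_mono)
  have mv: "\<exists>\<xi>. x < \<xi> \<and> \<xi> < y \<and> sl (G n \<alpha>) x y = F n \<alpha> \<xi>" if "l n \<alpha> \<le> x" "x < y" "y \<le> r n \<alpha>" for x y
  proof -
    obtain \<xi> where "x < \<xi>" "\<xi> < y" "G n \<alpha> y - G n \<alpha> x = exp (F n \<alpha> \<xi>) * (y - x)"
      using MVT_within_sub[OF G_deriv \<open>l n \<alpha> \<le> x\<close> \<open>x < y\<close> \<open>y \<le> r n \<alpha>\<close>] by blast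
    then show ?thesis using that by (intro exI[of _ \<xi>]) (simp add: sl_def)
  qed
  fix x y x' y' assume a: "l n \<alpha> \<le> x" "x < y" "y \<le> r n \<alpha>" and a': "l n \<alpha> \<le> x'" "x' < y'" "y' \<le> r n \<alpha>"
  obtain \<xi> where xi: "x < \<xi>" "\<xi> < y" "sl (G n \<alpha>) x y = F n \<alpha> \<xi>" using mv[OF a] by blast
  obtain \<xi>' where xi': "x' < \<xi>'" "\<xi>' < y'" "sl (G n \<alpha>) x' y' = F n \<alpha> \<xi>'" using mv[OF a'] by blast
  have *: "\<bar>F n \<alpha> u - F n \<alpha> v\<bar> \<le> C1 * m n \<alpha> (max y y') - C1 * m n \<alpha> (min x x')"
    if "u \<le> v" "min x x' \<le> u" "v \<le> max y y'" for u v
  proof -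
    have "\<bar>F n \<alpha> u - F n \<alpha> v\<bar> \<le> C1 * (m n \<alpha> v - m n \<alpha> u)" using F_diff[of n \<alpha> u v] that a a' by auto
    moreover have "C1 * m n \<alpha> v \<le> C1 * m n \<alpha> (max y y')" "C1 * m n \<alpha> (min x x') \<le> C1 * m n \<alpha> u"
      using m_mono[of n \<alpha> v "max y y'"] m_mono[of n \<alpha> "min x x'" u] that a a' C1 by (auto intro!: mult_left_mono)
    ultimately show ?thesis by (simp add: algebra_simps)
  qed
  show "\<bar>sl (G n \<alpha>) x y - sl (G n \<alpha>) x' y'\<bar> \<le> C1 * m n \<alpha> (max y y') - C1 * m n \<alpha> (min x x')"
    unfolding xi xi' using *[of \<xi> \<xi>'] *[of \<xi>' \<xi>] xi xi' by (cases "\<xi> \<le> \<xi>'") (auto simp: abs_minus_commute)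
qed

text \<open>\<open>m (n + j)\<close> collects the contributions of every iterate along the orbit, so
  it dominates the slope variation of each partial composition. Its increase being at most 1, the
  distortion is bounded by exp \<open>C1\<close> for all j.\<close>

lemma PS_slope_var:
  "q \<in> PS n j \<alpha> \<Longrightarrow> slope_var q (\<lambda>x. C1 * m (n + j) \<alpha> x) (l (n + j) \<alpha>) (r (n + j) \<alpha>)"
proof (induction j arbitrary: \<alpha> q)
  case 0
  then have q: "q = (\<lambda>x. x)" by simp
  have s: "sl q x y = 0" if "x < y" for x y using that unfolding q sl_def by simp
  have mm: "C1 * m n \<alpha> (min x x') \<le> C1 * m n \<alpha> (max y y')"
    if "l n \<alpha> \<le> x" "x < y" "y \<le> r n \<alpha>" "l n \<alpha> \<le> x'" "x' < y'" "y' \<le> r n \<alpha>" for x y x' y'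
    by (rule mono_onD[OF C1m_mono]) (use that in auto)
  show ?case unfolding slope_var_def
  proof (intro conjI allI impI)
    show "strict_mono_on (J (n + 0) \<alpha>) q" unfolding q by (simp add: strict_mono_on_def)
    show "mono_on (J (n + 0) \<alpha>) (\<lambda>x. C1 * m (n + 0) \<alpha> x)" using C1m_mono by simp
  qed (use s mm in simp)
next
  case (Suc j)
  let ?i = "n + j"
  show ?case
  proof (cases "\<alpha> = lose ?i")
    case False
    then have "slope_var q (\<lambda>x. C1 * m ?i \<alpha> x) (l ?i \<alpha>) (r ?i \<alpha>)" using Suc by auto
    from slope_var_subset[OF this] show ?thesis using J_other[OF False] False by simp
  next
    case True
    have l': "l (Suc ?i) \<alpha> = xc ?i" "r (Suc ?i) \<alpha> = r ?i (A1 ?i)" using True J_lose by auto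
    have m': "m (Suc ?i) \<alpha> = (\<lambda>x. m ?i (A1 ?i) x + m ?i (A0 ?i) (G ?i (A1 ?i) x))" using True by simp
    have Gsv: "slope_var (G ?i (A1 ?i)) (\<lambda>x. C1 * m ?i (A1 ?i) x) (xc ?i) (r ?i (A1 ?i))"
      by (rule slope_var_subset[OF G_slope_var]) (use xc(1)[of ?i] in auto)
    have into: "l ?i (A0 ?i) \<le> G ?i (A1 ?i) (xc ?i)" "G ?i (A1 ?i) (r ?i (A1 ?i)) \<le> r ?i (A0 ?i)"
      using G_xc[of ?i] G_end[of ?i] r_A0[of ?i] b_Suc[of ?i] by auto
    consider "q \<in> PS n j (A1 ?i)" | q0 where "q0 \<in> PS n j (A0 ?i)" "q = (\<lambda>x. q0 (G ?i (A1 ?i) x))"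
      using Suc(2) True by auto
    then have "slope_var q (\<lambda>x. C1 * m ?i (A1 ?i) x + C1 * m ?i (A0 ?i) (G ?i (A1 ?i) x)) (xc ?i) (r ?i (A1 ?i))"
    proof cases
      case 1
      have "slope_var q (\<lambda>x. C1 * m ?i (A1 ?i) x) (xc ?i) (r ?i (A1 ?i))"
        by (rule slope_var_subset[OF Suc(1)[OF 1]]) (use xc(1)[of ?i] in auto)
      moreover have "mono_on {xc ?i..r ?i (A1 ?i)} (\<lambda>x. C1 * m ?i (A0 ?i) (G ?i (A1 ?i) x))"
        unfolding mono_on_def
      proof (intro allI impI)
        fix x y assume "x \<in> {xc ?i..r ?i (A1 ?i)} \<and> y \<in> {xc ?i..r ?i (A1 ?i)} \<and> x \<le> y"
        then have xy: "x \<in> {xc ?i..r ?i (A1 ?i)}" "y \<in> {xc ?i..r ?i (A1 ?i)}" "x \<le> y" by auto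
        have "G ?i (A1 ?i) x \<le> G ?i (A1 ?i) y"
          using slope_var_mono[OF Gsv, of x y] xy by (cases "x = y") auto
        then show "C1 * m ?i (A0 ?i) (G ?i (A1 ?i) x) \<le> C1 * m ?i (A0 ?i) (G ?i (A1 ?i) y)"
          using m_mono[of ?i "A0 ?i"] G_lose_in[OF xy(1)] G_lose_in[OF xy(2)] C1 by (auto intro!: mult_left_mono)
      qed
      ultimately show ?thesis by (rule slope_var_weaken)
    next
      case 2
      show ?thesis unfolding 2(2) by (rule slope_var_comp[OF Gsv Suc(1)[OF 2(1)] into])
    qed
    then show ?thesis using l' m' by (simp add: distrib_left)
  qed
qed

text \<open>Both pieces into which step i cuts an interval are at least \<open>cc * b i\<close>
  long: each is a new interval or the removed end of the domain. \<open>kp\<close> is the resulting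
  fraction from \<open>slope_var_cut\<close> with distortion \<open>C1\<close>.\<close>

definition "cc = exp (- K) * c0 / (1 + E)"
definition "kp = 1 / (1 + cc * exp (- C1))"

lemma cc_pos: "0 < cc" unfolding cc_def using c0_pos by (auto intro!: divide_pos_pos simp: add_pos_pos)

lemma kp: "0 < kp" "kp < 1" unfolding kp_def using cc_pos by (auto simp: add_pos_pos)

lemma cc_parts: "cc * b i \<le> len (Suc i) \<alpha>" "cc * b i \<le> b i - b (Suc i)"
proof -
  have p: "0 < 1 + E" by (simp add: add_pos_pos)
  have "cc * b i \<le> cc * ((1 + E) * b (Suc i))" using b_le_Suc cc_pos by (intro mult_left_mono) auto
  also have "\<dots> = exp (- K) * (c0 * b (Suc i))"
  proof -
    have "x / z * (z * y) = x * y" if "0 < z" for x y z :: real using that by simp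
    from this[OF p, of "exp (- K) * c0"] show ?thesis unfolding cc_def by simp
  qed
  finally have 1: "cc * b i \<le> exp (- K) * (c0 * b (Suc i))" .
  have 2: "exp (- K) * (c0 * b (Suc i)) \<le> exp (- K) * len (Suc i) \<beta>" for \<beta>
    using len_ge by (intro mult_left_mono) auto
  have 3: "exp (- K) * len (Suc i) \<alpha> \<le> len (Suc i) \<alpha>"
    using mult_right_mono[OF eK(1), of "len (Suc i) \<alpha>"] len_pos[of "Suc i" \<alpha>] by simp
  show "cc * b i \<le> len (Suc i) \<alpha>" using 1 2[of \<alpha>] 3 by linarith
  show "cc * b i \<le> b i - b (Suc i)" using 1 2[of "lose i"] b_diff(1)[of i] by linarith
qed

definition "small n j \<alpha> B \<longleftrightarrow> (\<forall>q\<in>PS n j \<alpha>. q (r (n + j) \<alpha>) - q (l (n + j) \<alpha>) \<le> B)"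

lemma PS_cut:
  assumes q: "q \<in> PS n j \<alpha>" and y: "l (n + j) \<alpha> < y" "y < r (n + j) \<alpha>" and B: "small n j \<alpha> B"
    and len: "cc * b (n + j) \<le> y - l (n + j) \<alpha>" "cc * b (n + j) \<le> r (n + j) \<alpha> - y"
  shows "q y - q (l (n + j) \<alpha>) \<le> kp * B" "q (r (n + j) \<alpha>) - q y \<le> kp * B"
proof -
  let ?i = "n + j"
  note sv = PS_slope_var[OF q]
  have tot: "C1 * m ?i \<alpha> (r ?i \<alpha>) - C1 * m ?i \<alpha> (l ?i \<alpha>) \<le> C1"
    using mult_left_mono[OF m_range_le[of ?i \<alpha> "l ?i \<alpha>" "r ?i \<alpha>"] C1] l_less[of ?i \<alpha>] by (simp add: algebra_simps)
  have lb: "y - l ?i \<alpha> \<le> b ?i" "r ?i \<alpha> - y \<le> b ?i" using len_le[of ?i \<alpha>] y by (auto simp: len_def)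
  have "cc * (y - l ?i \<alpha>) \<le> cc * b ?i" "cc * (r ?i \<alpha> - y) \<le> cc * b ?i"
    using lb cc_pos by (auto intro!: mult_left_mono)
  then have c: "cc * (y - l ?i \<alpha>) \<le> r ?i \<alpha> - y" "cc * (r ?i \<alpha> - y) \<le> y - l ?i \<alpha>" using len by linarith+
  have cut: "(1 + cc * exp (- C1)) * (q y - q (l ?i \<alpha>)) \<le> q (r ?i \<alpha>) - q (l ?i \<alpha>)"
    "(1 + cc * exp (- C1)) * (q (r ?i \<alpha>) - q y) \<le> q (r ?i \<alpha>) - q (l ?i \<alpha>)"
    using slope_var_cut[OF sv tot y, of cc] c cc_pos by auto
  have le: "q (r ?i \<alpha>) - q (l ?i \<alpha>) \<le> B" using B q unfolding small_def by blast
  have pos: "0 < 1 + cc * exp (- C1)" using cc_pos by (simp add: add_pos_pos)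
  have kk: "u \<le> kp * B" if "(1 + cc * exp (- C1)) * u \<le> B" for u
    using that pos unfolding kp_def by (simp add: pos_le_divide_eq mult.commute)
  show "q y - q (l ?i \<alpha>) \<le> kp * B" "q (r ?i \<alpha>) - q y \<le> kp * B"
    by (rule kk, use cut le in linarith)+
qed

text \<open>The winner is cut, so by bounded distortion each image of either piece shrinks by
  \<open>kp\<close>. The loser's new images are its old ones, up to shortening by the cut, together
  with images of a piece of the winner; hence a bound D no smaller than \<open>kp * B\<close> is
  kept.\<close>

lemma small_step:
  assumes B: "\<And>\<alpha>. small n j \<alpha> B"
  shows "small n (Suc j) (win (n + j)) (kp * B)"
    and "kp * B \<le> D \<Longrightarrow> small n j \<alpha> D \<Longrightarrow> small n (Suc j) \<alpha> D"
proof -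
  let ?i = "n + j"
  have cut0: "q (b (Suc ?i)) - q (l ?i (A0 ?i)) \<le> kp * B" "q (b ?i) - q (b (Suc ?i)) \<le> kp * B"
    if "ty ?i" "q \<in> PS n j (A0 ?i)" for q
  proof -
    have r': "r (Suc ?i) (A0 ?i) = b (Suc ?i)" "l (Suc ?i) (A0 ?i) = l ?i (A0 ?i)" using that by (auto simp: r_Suc l_Suc)
    show "q (b (Suc ?i)) - q (l ?i (A0 ?i)) \<le> kp * B" "q (b ?i) - q (b (Suc ?i)) \<le> kp * B"
      using PS_cut[OF that(2), of "b (Suc ?i)" B] B r_A0[of ?i] b_less[of ?i] b_Suc[of ?i] that(1)
        cc_parts(1)[of ?i "A0 ?i"] cc_parts(2)[of ?i] r' by (auto simp: len_def)
  qed
  have cut1: "q (xc ?i) - q (l ?i (A1 ?i)) \<le> kp * B" "q (r ?i (A1 ?i)) - q (xc ?i) \<le> kp * B"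
    if "\<not> ty ?i" "q \<in> PS n j (A1 ?i)" for q
  proof -
    have r': "r (Suc ?i) (A1 ?i) = xc ?i" "l (Suc ?i) (A1 ?i) = l ?i (A1 ?i)" "r (Suc ?i) (A0 ?i) = r ?i (A1 ?i)" "l (Suc ?i) (A0 ?i) = xc ?i"
      using that A0_A1[of ?i] by (auto simp: r_Suc l_Suc)
    show "q (xc ?i) - q (l ?i (A1 ?i)) \<le> kp * B" "q (r ?i (A1 ?i)) - q (xc ?i) \<le> kp * B"
      using PS_cut[OF that(2), of "xc ?i" B] B xc(2)[of ?i] xc(5)[OF that(1)] 
        cc_parts(1)[of ?i "A0 ?i"] cc_parts(1)[of ?i "A1 ?i"] r' by (auto simp: len_def)
  qed
  show "small n (Suc j) (win ?i) (kp * B)"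
  proof (cases "ty ?i")
    case True
    then have w: "win ?i = A0 ?i" "lose ?i = A1 ?i" using win_eq[of ?i] lose_eq[of ?i] by auto
    show ?thesis unfolding small_def w
      using cut0(1)[OF True] A0_A1[of ?i] True by (auto simp: r_Suc l_Suc w)
  next
    case False
    then have w: "win ?i = A1 ?i" "lose ?i = A0 ?i" using win_eq[of ?i] lose_eq[of ?i] by auto
    show ?thesis unfolding small_def w
      using cut1(1)[OF False] A0_A1[of ?i] False by (auto simp: r_Suc l_Suc w)
  qed
  show "small n (Suc j) \<alpha> D" if D: "kp * B \<le> D" and s: "small n j \<alpha> D"
    unfolding small_def
  proof
    fix q assume q: "q \<in> PS n (Suc j) \<alpha>"
    show "q (r (n + Suc j) \<alpha>) - q (l (n + Suc j) \<alpha>) \<le> D"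
    proof (cases "\<alpha> = lose ?i")
      case False
      then have q': "q \<in> PS n j \<alpha>" using q by auto
      have "q (r (Suc ?i) \<alpha>) \<le> q (r ?i \<alpha>)"
        using slope_var_mono[OF PS_slope_var[OF q'], of "r (Suc ?i) \<alpha>" "r ?i \<alpha>"] J_other[OF False] l_less[of "Suc ?i" \<alpha>]
        by (cases "r (Suc ?i) \<alpha> = r ?i \<alpha>") auto
      moreover have "q (r ?i \<alpha>) - q (l ?i \<alpha>) \<le> D" using s q' unfolding small_def by blast
      ultimately show ?thesis using J_other[OF False] by simp
    next
      case True
      have lr: "l (n + Suc j) \<alpha> = xc ?i" "r (n + Suc j) \<alpha> = r ?i (A1 ?i)" using J_lose[of ?i] True by auto
      consider "q \<in> PS n j (A1 ?i)" | q0 where "q0 \<in> PS n j (A0 ?i)" "q = (\<lambda>x. q0 (G ?i (A1 ?i) x))"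
        using q True by auto
      then show ?thesis
      proof cases
        case 1
        show ?thesis
        proof (cases "ty ?i")
          case t: True
          then have "\<alpha> = A1 ?i" "xc ?i = l ?i (A1 ?i)" using True lose_eq[of ?i] xc(4)[OF t] by auto
          then show ?thesis unfolding lr using s 1 unfolding small_def by auto
        next
          case t: False
          then show ?thesis unfolding lr using cut1(2)[OF t 1] D by linarith
        qed
      next
        case 2
        have e: "q (r (n + Suc j) \<alpha>) - q (l (n + Suc j) \<alpha>) = q0 (b ?i) - q0 (b (Suc ?i))"
          unfolding lr 2(2) using G_xc[of ?i] G_end[of ?i] by simp
        show ?thesis
        proof (cases "ty ?i")
          case t: True
          then show ?thesis unfolding e using cut0(2)[OF t 2(1)] D by linarith
        next
          case t: False
          then have "\<alpha> = A0 ?i" "b (Suc ?i) = l ?i (A0 ?i)" using True lose_eq[of ?i] b_Suc[of ?i] by auto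
          then show ?thesis unfolding e using s 2(1) r_A0[of ?i] unfolding small_def by auto
        qed
      qed
    qed
  qed
qed

lemma small_mono:
  assumes "0 \<le> B" "\<And>\<alpha>. small n j \<alpha> B" shows "small n (j + i) \<alpha> B"
proof (induction i arbitrary: \<alpha>)
  case (Suc i)
  have "kp * B \<le> B" using kp assms mult_right_mono[of kp 1 B] by auto
  then show ?case using small_step(2)[OF Suc] Suc by auto
qed (use assms in auto)

text \<open>Every letter wins once within 2k steps, which gives it the factor \<open>kp\<close>; the
  second part of \<open>small_step\<close> preserves this until the window ends.\<close>

lemma small_window:
  assumes B: "0 \<le> B" "\<And>\<alpha>. small n j \<alpha> B" shows "small n (j + 2 * k) \<alpha> (kp * B)"
proof -
  obtain i where i: "n + j \<le> i" "i < n + j + 2 * k" "win i = \<alpha>" using wins by blast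
  define i' where "i' = i - (n + j)"
  have ii: "i = n + (j + i')" "i' < 2 * k" using i by (auto simp: i'_def)
  have sB: "small n (j + a) \<beta> B" for a \<beta> by (rule small_mono[OF B])
  have 1: "small n (j + Suc i') \<alpha> (kp * B)" using small_step(1)[OF sB, of i'] i(3) ii(1) by simp
  have "small n (j + Suc i' + a) \<alpha> (kp * B)" for a
  proof (induction a)
    case (Suc a)
    have "small n (j + Suc i' + a) \<beta> B" for \<beta> using sB[of "Suc i' + a"] by (simp add: add.assoc)
    from small_step(2)[OF this order_refl Suc] show ?case by simp
  qed (use 1 in simp)
  from this[of "2 * k - Suc i'"] show ?thesis using ii(2) by simp
qed

lemma small_pieces: "small n (2 * k * i) \<alpha> (kp ^ i * b n)"
proof (induction i arbitrary: \<alpha>)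
  case 0
  show ?case using len_le[of n \<alpha>] unfolding small_def by (simp add: len_def)
next
  case (Suc i)
  have "0 \<le> kp ^ i * b n" using kp b_pos[of n] by simp
  from small_window[OF this Suc] show ?case by (simp add: mult.assoc add.commute)
qed

end

lemma wmean_diff:
  fixes w w' a a' c c' R D :: real
  assumes "0 \<le> w" "w \<le> 1" "\<bar>a - a'\<bar> \<le> R" "\<bar>c - c'\<bar> \<le> R" "\<bar>a' - c'\<bar> \<le> D"
  shows "\<bar>(w * a + (1 - w) * c) - (w' * a' + (1 - w') * c')\<bar> \<le> R + \<bar>w - w'\<bar> * D"
proof -
  have "(w * a + (1 - w) * c) - (w' * a' + (1 - w') * c') = w * (a - a') + (1 - w) * (c - c') + (w - w') * (a' - c')"
    by (simp add: algebra_simps)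
  moreover have "\<bar>w * (a - a')\<bar> \<le> w * R" "\<bar>(1 - w) * (c - c')\<bar> \<le> (1 - w) * R" "\<bar>(w - w') * (a' - c')\<bar> \<le> \<bar>w - w'\<bar> * D"
    using assms by (auto simp: abs_mult intro!: mult_left_mono)
  moreover have "w * R + (1 - w) * R = R" by (simp add: algebra_simps)
  ultimately show ?thesis by linarith
qed

lemma power_powr_small:
  fixes x :: real
  assumes "0 < x" "x < 1" "0 < \<nu>" "0 < e" "0 < c"
  shows "\<exists>i>0. (c * x ^ i) powr \<nu> \<le> e"
proof -
  have "0 < e powr (1 / \<nu>) / c" using assms by simp
  then obtain i where i: "x ^ i < e powr (1 / \<nu>) / c" using real_arch_pow_inv assms by blast
  have "x ^ Suc i \<le> x ^ i" using assms by (intro power_decreasing) auto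
  then have "x ^ Suc i \<le> e powr (1 / \<nu>) / c" using i by linarith
  then have "c * x ^ Suc i \<le> e powr (1 / \<nu>)" using assms(5) by (simp add: pos_le_divide_eq mult.commute)
  then have "(c * x ^ Suc i) powr \<nu> \<le> (e powr (1 / \<nu>)) powr \<nu>" using assms by (intro powr_mono2) auto
  also have "\<dots> = e" using assms by (simp add: powr_powr)
  finally show ?thesis by (intro exI[of _ "Suc i"]) auto
qed

section \<open>Hoelder estimate and exponential decay\<close>

context rvsmooth
begin

text \<open>Accumulated effect of the varying weights: a step adds the Lipschitz constant of
  \<open>wt_diff\<close>, and earlier contributions grow by at most \<open>E\<close> because the
  branch stretches distances.\<close>

primrec DD :: "nat \<Rightarrow> real" where
  "DD 0 = 0"
| "DD (Suc j) = E * DD j + 2 * C1 * C2"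

lemma DD_nonneg: "0 \<le> DD j"
  by (induction j) (use C1 C2_pos in auto)

lemma DD_le_Suc: "E * DD j \<le> DD (Suc j)" using C1 C2_pos by simp

lemma b_div_mono: "0 \<le> d \<Longrightarrow> d / b n \<le> d / b (Suc n)"
  using b_less[of n] b_pos[of n] b_pos[of "Suc n"] by (intro divide_left_mono) auto

text \<open>The Lasota--Yorke estimate. Unfolding j steps writes the new \<open>psi\<close> as an
  average of old values at points q x with q in \<open>PS n j \<alpha>\<close>. Moving these points
  costs the Hoelder term with \<open>\<theta>\<close>; changing the weights costs their variation
  times the oscillation S - s.\<close>

lemma holder_block:
  assumes o: "osc n s S" and sS: "s \<le> S" and H: "hol n H" "0 \<le> H"
  shows "x \<in> J (n + j) \<alpha> \<Longrightarrow> y \<in> J (n + j) \<alpha> \<Longrightarrow> x \<le> y \<Longrightarrow> (\<And>q. q \<in> PS n j \<alpha> \<Longrightarrow> q y - q x \<le> \<theta>) \<Longrightarrow>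
    \<bar>psi (n + j) \<alpha> x - psi (n + j) \<alpha> y\<bar> \<le> H * (\<theta> / b n) powr \<nu> + (S - s) * (DD j * ((y - x) / b (n + j)))"
proof (induction j arbitrary: \<alpha> x y)
  case 0
  have "y - x \<le> \<theta>" using 0(4)[of "\<lambda>x. x"] by simp
  then have "\<bar>x - y\<bar> / b n \<le> \<theta> / b n" using 0(3) b_pos[of n] by (intro divide_right_mono) auto
  then have "H * (\<bar>x - y\<bar> / b n) powr \<nu> \<le> H * (\<theta> / b n) powr \<nu>"
    using nu H b_pos[of n] by (intro mult_left_mono powr_mono2) auto
  moreover have "\<bar>psi n \<alpha> x - psi n \<alpha> y\<bar> \<le> H * (\<bar>x - y\<bar> / b n) powr \<nu>" using H(1) 0(1,2) unfolding hol_def by simp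
  ultimately show ?case by simp
next
  case (Suc j)
  let ?i = "n + j"
  let ?T = "H * (\<theta> / b n) powr \<nu>"
  have d: "0 \<le> (y - x) / b (Suc ?i)" using Suc.prems(3) b_pos[of "Suc ?i"] by simp
  have mono: "DD j * (z / b ?i) \<le> DD j * (z / b (Suc ?i))" if "0 \<le> z" for z
    using b_div_mono[OF that] DD_nonneg by (intro mult_left_mono) auto
  show ?case
  proof (cases "\<alpha> = lose ?i")
    case False
    have J: "x \<in> J ?i \<alpha>" "y \<in> J ?i \<alpha>" using Suc.prems(1,2) J_sub(1)[OF False] by auto
    have "\<bar>psi ?i \<alpha> x - psi ?i \<alpha> y\<bar> \<le> ?T + (S - s) * (DD j * ((y - x) / b ?i))"
      by (rule Suc.IH[OF J Suc.prems(3)]) (use Suc.prems(4) False in auto)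
    also have "\<dots> \<le> ?T + (S - s) * (DD (Suc j) * ((y - x) / b (Suc ?i)))"
    proof -
      have "DD j \<le> E * DD j" using mult_right_mono[OF E1 DD_nonneg[of j]] by simp
      then have "DD j \<le> DD (Suc j)" using DD_le_Suc[of j] by linarith
      then have "DD j * ((y - x) / b (Suc ?i)) \<le> DD (Suc j) * ((y - x) / b (Suc ?i))" using d by (intro mult_right_mono) auto
      then have "DD j * ((y - x) / b ?i) \<le> DD (Suc j) * ((y - x) / b (Suc ?i))" using mono[of "y - x"] Suc.prems(3) by linarith
      then have "(S - s) * (DD j * ((y - x) / b ?i)) \<le> (S - s) * (DD (Suc j) * ((y - x) / b (Suc ?i)))"
        using sS by (intro mult_left_mono) auto
      then show ?thesis by linarith
    qed
    finally show ?thesis using False by simp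
  next
    case True
    let ?a = "A1 ?i" and ?c = "A0 ?i"
    have x: "x \<in> J (Suc ?i) (lose ?i)" and y: "y \<in> J (Suc ?i) (lose ?i)" using Suc.prems True by auto
    note hx = h_Suc_lose(2,3)[OF x] and hy = h_Suc_lose(2,3)[OF y]
    note px = psi_Suc_lose[OF x] and py = psi_Suc_lose[OF y]
    define g where "g = G ?i ?a"
    have gle: "g x \<le> g y" using G_mono[of ?i ?a x y] hx hy Suc.prems(3) unfolding g_def by (cases "x = y") auto
    have gE: "g y - g x \<le> E * (y - x)" using G_bounds(2)[of ?i ?a x y] hx hy Suc.prems(3) unfolding g_def by auto
    have PS1: "q \<in> PS n (Suc j) \<alpha>" if "q \<in> PS n j ?a" for q using that True by simp
    have PS2: "(\<lambda>x. q (g x)) \<in> PS n (Suc j) \<alpha>" if "q \<in> PS n j ?c" for q using that True unfolding g_def by auto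
    \<comment> \<open>A common bound for the differences of both averaged terms; the factor
      \<open>E\<close> pays for the distance between g x and g y in the second one.\<close>
    define R where "R = ?T + (S - s) * (E * DD j * ((y - x) / b (Suc ?i)))"
    have a: "\<bar>psi ?i ?a x - psi ?i ?a y\<bar> \<le> R"
    proof -
      have "\<bar>psi ?i ?a x - psi ?i ?a y\<bar> \<le> ?T + (S - s) * (DD j * ((y - x) / b ?i))"
        by (rule Suc.IH[OF hx(1) hy(1) Suc.prems(3)]) (use Suc.prems(4) PS1 in auto)
      also have "\<dots> \<le> R"
      proof -
        have "DD j \<le> E * DD j" using mult_right_mono[OF E1 DD_nonneg[of j]] by simp
        then have "DD j * ((y - x) / b (Suc ?i)) \<le> E * DD j * ((y - x) / b (Suc ?i))" using d by (intro mult_right_mono) auto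
        then have "DD j * ((y - x) / b ?i) \<le> E * DD j * ((y - x) / b (Suc ?i))" using mono[of "y - x"] Suc.prems(3) by linarith
        then have "(S - s) * (DD j * ((y - x) / b ?i)) \<le> (S - s) * (E * DD j * ((y - x) / b (Suc ?i)))"
          using sS by (intro mult_left_mono) auto
        then show ?thesis unfolding R_def by linarith
      qed
      finally show ?thesis .
    qed
    have c: "\<bar>psi ?i ?c (g x) - psi ?i ?c (g y)\<bar> \<le> R"
    proof -
      have "\<bar>psi ?i ?c (g x) - psi ?i ?c (g y)\<bar> \<le> ?T + (S - s) * (DD j * ((g y - g x) / b ?i))"
        by (rule Suc.IH[OF hx(2)[folded g_def] hy(2)[folded g_def] gle]) (use Suc.prems(4)[OF PS2] in auto)
      also have "\<dots> \<le> R"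
      proof -
        have "DD j * ((g y - g x) / b ?i) \<le> DD j * ((g y - g x) / b (Suc ?i))" using mono[of "g y - g x"] gle by auto
        also have "\<dots> \<le> DD j * (E * (y - x) / b (Suc ?i))"
          using gE b_pos[of "Suc ?i"] DD_nonneg by (intro mult_left_mono divide_right_mono) auto
        also have "\<dots> = E * DD j * ((y - x) / b (Suc ?i))" by simp
        finally have "(S - s) * (DD j * ((g y - g x) / b ?i)) \<le> (S - s) * (E * DD j * ((y - x) / b (Suc ?i)))"
          using sS by (intro mult_left_mono) auto
        then show ?thesis unfolding R_def by linarith
      qed
      finally show ?thesis .
    qed
    have D: "\<bar>psi ?i ?a y - psi ?i ?c (g y)\<bar> \<le> S - s"
    proof -
      have "osc ?i s S" using osc_mono[OF _ o, of ?i] by simp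
      then have "s \<le> psi ?i ?a y" "psi ?i ?a y \<le> S" "s \<le> psi ?i ?c (g y)" "psi ?i ?c (g y) \<le> S"
        using hy unfolding osc_def g_def by blast+
      then show ?thesis by linarith
    qed
    have w: "0 \<le> wt ?i x" "wt ?i x \<le> 1" using px(2,3) dl_pos by auto
    have "\<bar>psi (Suc ?i) \<alpha> x - psi (Suc ?i) \<alpha> y\<bar> \<le> R + \<bar>wt ?i x - wt ?i y\<bar> * (S - s)"
      unfolding True px(1) py(1) g_def[symmetric] by (rule wmean_diff[OF w a c D])
    also have "\<dots> \<le> R + (2 * C1 * C2 * ((y - x) / b (Suc ?i))) * (S - s)"
      using wt_diff[OF x y Suc.prems(3)] sS by (intro add_left_mono mult_right_mono) auto
    also have "\<dots> = ?T + (S - s) * (DD (Suc j) * ((y - x) / b (Suc ?i)))"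
      unfolding R_def DD.simps by (simp only: distrib_left distrib_right mult.commute[of "S - s"] mult.assoc add.assoc)
    finally show ?thesis by simp
  qed
qed

text \<open>After enough windows the images of whole intervals are so short that the inherited
  Hoelder constant is halved; the part due to the weights is Lipschitz, which is stronger than
  Hoelder since relative distances are at most 1.\<close>

lemma hol_step:
  assumes o: "osc n s S" and sS: "s \<le> S" and H: "hol n H" "0 \<le> H"
    and i: "(exp C1 / c0 * kp ^ i) powr \<nu> \<le> 1 / 2"
  shows "hol (n + 2 * k * i) (H / 2 + (S - s) * DD (2 * k * i))"
proof -
  let ?j = "2 * k * i"
  let ?n = "n + ?j"
  have main: "\<bar>psi ?n \<alpha> x - psi ?n \<alpha> y\<bar> \<le> (H / 2 + (S - s) * DD ?j) * (\<bar>x - y\<bar> / b ?n) powr \<nu>"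
    if x: "x \<in> J ?n \<alpha>" and y: "y \<in> J ?n \<alpha>" and xy: "x \<le> y" for \<alpha> x y
  proof (cases "x = y")
    case True
    then show ?thesis using H sS DD_nonneg by simp
  next
    case False
    then have lt: "x < y" using xy by simp
    define z where "z = (y - x) / b ?n"
    \<comment> \<open>z is the relative distance of x and y. By distortion exp \<open>C1\<close> and
      relative length at least \<open>c0\<close>, an image of the interval from x to y is at most
      exp \<open>C1\<close> z / \<open>c0\<close> times the bound \<open>kp ^ i * b n\<close> for
      the image of the whole interval.\<close>
    define \<theta> where "\<theta> = exp C1 / c0 * kp ^ i * b n * z"
    have z: "0 < z" "z \<le> 1" using lt b_pos[of ?n] len_le[of ?n \<alpha>] x y by (auto simp: z_def len_def divide_le_eq)
    have th: "q y - q x \<le> \<theta>" if q: "q \<in> PS n ?j \<alpha>" for q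
    proof -
      note sv = PS_slope_var[OF q]
      have tot: "C1 * m ?n \<alpha> (r ?n \<alpha>) - C1 * m ?n \<alpha> (l ?n \<alpha>) \<le> C1"
        using mult_left_mono[OF m_range_le[of ?n \<alpha> "l ?n \<alpha>" "r ?n \<alpha>"] C1] l_less[of ?n \<alpha>] by (simp add: algebra_simps)
      have "(q y - q x) / (y - x) \<le> exp C1 * ((q (r ?n \<alpha>) - q (l ?n \<alpha>)) / (r ?n \<alpha> - l ?n \<alpha>))"
        by (rule slope_var_ratio[OF sv tot]) (use x y lt l_less[of ?n \<alpha>] in auto)
      also have "\<dots> \<le> exp C1 * ((kp ^ i * b n) / (c0 * b ?n))"
      proof (intro mult_left_mono frac_le)
        show "q (r ?n \<alpha>) - q (l ?n \<alpha>) \<le> kp ^ i * b n" using small_pieces[of n i \<alpha>] q unfolding small_def by blast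
        show "c0 * b ?n \<le> r ?n \<alpha> - l ?n \<alpha>" using len_ge[of ?n \<alpha>] by (simp add: len_def)
        show "0 < c0 * b ?n" using c0_pos b_pos by simp
        show "0 \<le> kp ^ i * b n" using kp b_pos[of n] by simp
      qed auto
      finally have "q y - q x \<le> exp C1 * ((kp ^ i * b n) / (c0 * b ?n)) * (y - x)" using lt by (simp add: pos_divide_le_eq)
      also have "\<dots> = \<theta>" unfolding \<theta>_def z_def by simp
      finally show ?thesis .
    qed
    have "\<bar>psi ?n \<alpha> x - psi ?n \<alpha> y\<bar> \<le> H * (\<theta> / b n) powr \<nu> + (S - s) * (DD ?j * ((y - x) / b ?n))"
      by (rule holder_block[OF o sS H x y xy th])
    also have "\<dots> \<le> H * (1 / 2 * z powr \<nu>) + (S - s) * (DD ?j * z powr \<nu>)"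
    proof (intro add_mono mult_left_mono)
      have e1: "\<theta> / b n = (exp C1 / c0 * kp ^ i) * z" unfolding \<theta>_def using b_pos[of n] by simp
      have "0 \<le> exp C1 / c0 * kp ^ i" using c0_pos kp by simp
      then have "(\<theta> / b n) powr \<nu> = (exp C1 / c0 * kp ^ i) powr \<nu> * z powr \<nu>"
        unfolding e1 using powr_mult z(1) by (metis less_imp_le)
      also have "\<dots> \<le> 1 / 2 * z powr \<nu>" using i by (intro mult_right_mono) auto
      finally show "(\<theta> / b n) powr \<nu> \<le> 1 / 2 * z powr \<nu>" .
      have "z powr 1 \<le> z powr \<nu>" using z nu by (intro powr_mono') auto
      then show "(y - x) / b ?n \<le> z powr \<nu>" using z unfolding z_def[symmetric] by simp
    qed (use H sS DD_nonneg in auto)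
    also have "\<dots> = (H / 2 + (S - s) * DD ?j) * (\<bar>x - y\<bar> / b ?n) powr \<nu>"
      using lt unfolding z_def by (simp add: algebra_simps)
    finally show ?thesis .
  qed
  show ?thesis unfolding hol_def
  proof (intro allI ballI)
    fix \<alpha> x y assume "x \<in> J ?n \<alpha>" "y \<in> J ?n \<alpha>"
    then show "\<bar>psi ?n \<alpha> x - psi ?n \<alpha> y\<bar> \<le> (H / 2 + (S - s) * DD ?j) * (\<bar>x - y\<bar> / b ?n) powr \<nu>"
      using main[of x \<alpha> y] main[of y \<alpha> x] by (cases "x \<le> y") (auto simp: abs_minus_commute)
  qed
qed

lemma hol_mono: "hol n H \<Longrightarrow> H \<le> H' \<Longrightarrow> hol n H'"
  unfolding hol_def by (meson mult_right_mono order_trans powr_ge_zero)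

lemma k_pos: "0 < k"
  using wins[of 0 undefined] by auto

text \<open>The contraction of the oscillation has an error proportional to the Hoelder constant,
  whose estimate in turn has a source proportional to the oscillation. The invariant therefore
  couples them: e bounds the oscillation, 4 \<open>Cc\<close> e the Hoelder constant, and a block of
  M steps multiplies both by \<open>\<rho>\<close>.\<close>

lemma osc_exponential:
  "\<exists>C lam. 0 < C \<and> 0 < lam \<and> lam < 1 \<and> (\<forall>n. \<exists>s S. osc n s S \<and> s \<le> S \<and> S - s \<le> C * lam ^ n)"
proof -
  obtain i where i: "0 < i" "(exp C1 / c0 * kp ^ i) powr \<nu> \<le> 1 / 2"
    using power_powr_small[of kp \<nu> "1 / 2" "exp C1 / c0"] kp nu c0_pos by auto
  define sN where "sN = 2 * k * i"
  have sN: "0 < sN" using i k_pos by (simp add: sN_def)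
  define Cc where "Cc = max 1 (DD sN)"
  have Cc: "1 \<le> Cc" "DD sN \<le> Cc" by (auto simp: Cc_def)
  \<comment> \<open>Chosen so that the error 2 d \<open>\<eta>\<close> (4 \<open>Cc\<close> e) in
    \<open>osc_contract\<close> is d e / 2, half of the gain d e.\<close>
  define \<eta> where "\<eta> = 1 / (16 * Cc)"
  have eta: "0 < \<eta>" "\<eta> * Cc = 1 / 16" using Cc by (auto simp: \<eta>_def)
  obtain t where t: "(th ^ t) powr \<nu> \<le> \<eta>"
    using power_powr_small[of th \<nu> \<eta> 1] th nu eta by auto
  define rr where "rr = t + 2 * k"
  \<comment> \<open>A multiple of \<open>sN\<close>, so that \<open>hol_step\<close> can be
    repeated, and at least t + 2k, the duration of one contraction.\<close>
  define M where "M = rr * sN"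
  have rr: "0 < rr" "t + 2 * k \<le> M" using k_pos sN by (auto simp: rr_def M_def)
  have M: "0 < M" using rr sN by (simp add: M_def)
  define d where "d = dl ^ (t + 2 * k)"
  have d: "0 < d" "d \<le> 1" using dl_pos dl_le1 by (auto simp: d_def power_le_one)
  \<comment> \<open>One block brings the Hoelder constant from 4 \<open>Cc\<close> e down to 3
    \<open>Cc\<close> e, which requires 3/4, and the oscillation down to (1 - d / 2) e.\<close>
  define \<rho> where "\<rho> = max (3 / 4) (1 - d / 2)"
  have rho: "3 / 4 \<le> \<rho>" "1 - d / 2 \<le> \<rho>" "\<rho> < 1" using d by (auto simp: \<rho>_def)
  have block: "\<exists>s' S'. osc (n + M) s' S' \<and> s' \<le> S' \<and> S' - s' \<le> \<rho> * e \<and> hol (n + M) (4 * Cc * (\<rho> * e))"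
    if o: "osc n s S" "s \<le> S" "S - s \<le> e" and H: "hol n (4 * Cc * e)" for n s S e
  proof -
    have e: "0 \<le> e" using o by linarith
    have He: "0 \<le> 4 * Cc * e" using e Cc by simp
    have hj: "hol (n + j * sN) (4 * Cc * e) \<and> (0 < j \<longrightarrow> hol (n + j * sN) (3 * Cc * e))" for j
    proof (induction j)
      case (Suc j)
      have on: "osc (n + j * sN) s S" using osc_mono[OF _ o(1), of "n + j * sN"] by simp
      have A: "hol (n + j * sN + 2 * k * i) (4 * Cc * e / 2 + (S - s) * DD (2 * k * i))"
        by (rule hol_step[OF on o(2) _ He i(2)]) (use Suc in blast)
      have "(S - s) * DD sN \<le> e * Cc" using o Cc DD_nonneg e by (intro mult_mono) auto
      moreover have "4 * Cc * e / 2 = 2 * (e * Cc)" "3 * Cc * e = 3 * (e * Cc)" by simp_all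
      ultimately have "4 * Cc * e / 2 + (S - s) * DD sN \<le> 3 * Cc * e" by linarith
      from hol_mono[OF A[folded sN_def] this] have "hol (n + Suc j * sN) (3 * Cc * e)"
        by (simp add: add.commute add.left_commute)
      moreover have "3 * Cc * e \<le> 4 * Cc * e" using e Cc by (intro mult_right_mono) auto
      ultimately show ?case using hol_mono by blast
    qed (use H in auto)
    have h3: "hol (n + M) (3 * Cc * e)" using hj[of rr] rr unfolding M_def by blast
    have "Cc * (3 * e) \<le> Cc * (4 * (\<rho> * e))"
    proof (intro mult_left_mono)
      have "3 / 4 * e \<le> \<rho> * e" using rho e by (intro mult_right_mono) auto
      then show "3 * e \<le> 4 * (\<rho> * e)" by linarith
    qed (use Cc in auto)
    then have "3 * Cc * e \<le> 4 * Cc * (\<rho> * e)" by (simp only: ac_simps)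
    then have h: "hol (n + M) (4 * Cc * (\<rho> * e))" by (rule hol_mono[OF h3])
    obtain s' S' where s': "osc (n + t + 2 * k) s' S'" "s' \<le> S'" "S' - s' \<le> (1 - d) * (S - s) + 2 * d * (\<eta> * (4 * Cc * e))"
      using osc_contract[OF o(1,2) H He t] unfolding d_def by blast
    have "(1 - d) * (S - s) \<le> (1 - d) * e" using o d by (intro mult_left_mono) auto
    moreover have "2 * d * (\<eta> * (4 * Cc * e)) = 8 * d * e * (1 / 16)"
      unfolding eta(2)[symmetric] by simp
    ultimately have "S' - s' \<le> (1 - d) * e + 8 * d * e * (1 / 16)" using s'(3) by linarith
    also have "\<dots> = (1 - d / 2) * e" by (simp add: algebra_simps)
    also have "\<dots> \<le> \<rho> * e" using rho e by (intro mult_right_mono) auto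
    finally have "S' - s' \<le> \<rho> * e" .
    moreover have "osc (n + M) s' S'" using osc_mono[OF _ s'(1), of "n + M"] rr by simp
    ultimately show ?thesis using s'(2) h by blast
  qed
  \<comment> \<open>Initially \<open>psi\<close> lies between -\<open>C1\<close> and
    \<open>C1\<close> and has Hoelder constant \<open>C1\<close>; the extra 1 keeps
    \<open>e0\<close> positive when \<open>C1\<close> is 0.\<close>
  define e0 where "e0 = 2 * C1 + 1"
  have e0: "0 < e0" using C1 by (simp add: e0_def)
  have iter: "\<exists>s S. osc (j * M) s S \<and> s \<le> S \<and> S - s \<le> \<rho> ^ j * e0 \<and> hol (j * M) (4 * Cc * (\<rho> ^ j * e0))" for j
  proof (induction j)
    case 0
    have "osc 0 (- C1) C1" unfolding osc_def
    proof (intro allI ballI)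
      fix \<alpha> x assume "x \<in> J 0 \<alpha>"
      from psi_le[OF this] show "- C1 \<le> psi 0 \<alpha> x \<and> psi 0 \<alpha> x \<le> C1" by linarith
    qed
    moreover have "hol 0 (4 * Cc * e0)"
    proof -
      interpret Sg: rv_step "Rn 0 T" "b 0" by (rule step)
      have s: "Sg.smooth0 g0 F0 psi0 C1 \<nu>" using sm Rn_0 by simp
      have "hol 0 C1" unfolding hol_def using s b_0 unfolding Sg.smooth0_def by auto
      moreover have "C1 \<le> 4 * Cc * e0"
      proof -
        have "1 * e0 \<le> (4 * Cc) * e0" using Cc e0 by (intro mult_right_mono) auto
        moreover have "C1 \<le> e0" using C1 unfolding e0_def by linarith
        ultimately show ?thesis by linarith
      qed
      ultimately show ?thesis by (rule hol_mono)
    qed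
    ultimately show ?case using C1 by (intro exI[of _ "- C1"] exI[of _ C1]) (auto simp: e0_def)
  next
    case (Suc j)
    then obtain s S where "osc (j * M) s S" "s \<le> S" "S - s \<le> \<rho> ^ j * e0" "hol (j * M) (4 * Cc * (\<rho> ^ j * e0))" by blast
    from block[OF this] show ?case by (simp add: mult.assoc add.commute)
  qed
  \<comment> \<open>The rate \<open>\<rho>\<close> per M steps converted to a rate per step; the
    constant \<open>e0 / \<rho>\<close> pays for an incomplete last block.\<close>
  define lam where "lam = \<rho> powr (1 / real M)"
  have "\<rho> powr (1 / real M) < 1 powr (1 / real M)" using rho M by (intro powr_less_mono2) auto
  then have lam: "0 < lam" "lam < 1" using rho by (auto simp: lam_def)
  have "\<exists>s S. osc n s S \<and> s \<le> S \<and> S - s \<le> e0 / \<rho> * lam ^ n" for n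
  proof -
    define j where "j = n div M"
    obtain s S where sS: "osc (j * M) s S" "s \<le> S" "S - s \<le> \<rho> ^ j * e0" using iter by blast
    have "j * M \<le> n" by (simp add: j_def)
    then have o: "osc n s S" using osc_mono sS(1) by blast
    have "n = j * M + n mod M" by (simp add: j_def)
    moreover have "n mod M < M" using M by simp
    ultimately have "n < Suc j * M" by simp
    then have "real n \<le> real (Suc j) * real M" by (metis less_imp_le of_nat_le_iff of_nat_mult)
    then have le: "real n / real M \<le> real (Suc j)" using M by (simp add: pos_divide_le_eq)
    have "\<rho> ^ Suc j = \<rho> powr real (Suc j)" using rho by (subst powr_realpow) auto
    also have "\<dots> \<le> \<rho> powr (real n / real M)" using le rho by (intro powr_mono') auto
    also have "\<dots> = lam ^ n" unfolding lam_def using rho by (simp add: powr_realpow[symmetric] powr_powr)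
    finally have "\<rho> ^ Suc j \<le> lam ^ n" .
    then have "e0 / \<rho> * \<rho> ^ Suc j \<le> e0 / \<rho> * lam ^ n" using e0 rho by (intro mult_left_mono) auto
    moreover have "e0 / \<rho> * \<rho> ^ Suc j = \<rho> ^ j * e0" using rho by simp
    ultimately show ?thesis using o sS by (intro exI[of _ s] exI[of _ S]) auto
  qed
  moreover have "0 < e0 / \<rho>" using e0 rho by simp
  ultimately show ?thesis using lam by blast
qed

text \<open>On each letter the increase of \<open>F\<close> is a value of \<open>psi\<close> times a
  positive number. As these increases sum to 0, \<open>psi\<close> cannot have one strict sign, so 0
  lies between its bounds and the oscillation bounds \<open>psi\<close> itself. The density times
  the length stays below \<open>C2\<close>.\<close>

lemma psi_exponential:
  assumes zero: "(\<Sum>\<alpha>\<in>UNIV. F0 \<alpha> (r 0 \<alpha>) - F0 \<alpha> (l 0 \<alpha>)) = 0"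
  shows "\<exists>C lam. 0 < C \<and> 0 < lam \<and> lam < 1 \<and>
    (\<forall>n \<alpha>. \<forall>x\<in>J n \<alpha>. \<bar>psi n \<alpha> x * h n \<alpha> x\<bar> * len n \<alpha> \<le> C * lam ^ n)"
proof -
  obtain C lam where C: "0 < C" "0 < lam" "lam < 1" and os: "\<And>n. \<exists>s S. osc n s S \<and> s \<le> S \<and> S - s \<le> C * lam ^ n"
    using osc_exponential by blast
  have "\<bar>psi n \<alpha> x * h n \<alpha> x\<bar> * len n \<alpha> \<le> (C * C2) * lam ^ n" if x: "x \<in> J n \<alpha>" for n \<alpha> x
  proof -
    obtain s S where s: "osc n s S" "s \<le> S" "S - s \<le> C * lam ^ n" using os by blast
    have diff: "\<exists>\<xi>\<in>J n \<beta>. F n \<beta> (r n \<beta>) - F n \<beta> (l n \<beta>) = psi n \<beta> \<xi> * (h n \<beta> \<xi> * len n \<beta>) \<and> 0 < h n \<beta> \<xi> * len n \<beta>" for \<beta>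
    proof -
      obtain \<xi> where xi: "l n \<beta> < \<xi>" "\<xi> < r n \<beta>" "F n \<beta> (r n \<beta>) - F n \<beta> (l n \<beta>) = psi n \<beta> \<xi> * h n \<beta> \<xi> * (r n \<beta> - l n \<beta>)"
        using MVT_within[OF l_less F_deriv] by blast
      have "\<xi> \<in> J n \<beta>" using xi by auto
      moreover have "0 < h n \<beta> \<xi> * len n \<beta>" using h_ge1[OF \<open>\<xi> \<in> J n \<beta>\<close>] len_pos[of n \<beta>] by (intro mult_pos_pos) auto
      ultimately show ?thesis using xi(3) by (intro bexI[of _ \<xi>]) (auto simp: len_def mult.assoc)
    qed
    have sum0: "(\<Sum>\<beta>\<in>UNIV. F n \<beta> (r n \<beta>) - F n \<beta> (l n \<beta>)) = 0" using F_sum zero by simp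
    have "s \<le> 0"
    proof (rule ccontr)
      assume "\<not> s \<le> 0"
      have "0 < F n \<beta> (r n \<beta>) - F n \<beta> (l n \<beta>)" for \<beta>
      proof -
        obtain \<xi> where xi: "\<xi> \<in> J n \<beta>" "F n \<beta> (r n \<beta>) - F n \<beta> (l n \<beta>) = psi n \<beta> \<xi> * (h n \<beta> \<xi> * len n \<beta>)" "0 < h n \<beta> \<xi> * len n \<beta>"
          using diff by blast
        have "0 < psi n \<beta> \<xi>" using s(1) xi(1) \<open>\<not> s \<le> 0\<close> unfolding osc_def by (meson not_le less_le_trans)
        then show ?thesis unfolding xi(2) by (rule mult_pos_pos[OF _ xi(3)])
      qed
      then have "0 < (\<Sum>\<beta>\<in>UNIV. F n \<beta> (r n \<beta>) - F n \<beta> (l n \<beta>))" by (intro sum_pos) auto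
      then show False using sum0 by linarith
    qed
    moreover have "0 \<le> S"
    proof (rule ccontr)
      assume "\<not> 0 \<le> S"
      have "F n \<beta> (r n \<beta>) - F n \<beta> (l n \<beta>) < 0" for \<beta>
      proof -
        obtain \<xi> where xi: "\<xi> \<in> J n \<beta>" "F n \<beta> (r n \<beta>) - F n \<beta> (l n \<beta>) = psi n \<beta> \<xi> * (h n \<beta> \<xi> * len n \<beta>)" "0 < h n \<beta> \<xi> * len n \<beta>"
          using diff by blast
        have "psi n \<beta> \<xi> < 0" using s(1) xi(1) \<open>\<not> 0 \<le> S\<close> unfolding osc_def by (meson not_le le_less_trans)
        then show ?thesis unfolding xi(2) by (rule mult_neg_pos[OF _ xi(3)])
      qed
      then have "(\<Sum>\<beta>\<in>UNIV. F n \<beta> (r n \<beta>) - F n \<beta> (l n \<beta>)) < (\<Sum>\<beta>\<in>(UNIV::'a set). 0)" by (intro sum_strict_mono) auto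
      then show False using sum0 by simp
    qed
    moreover have "s \<le> psi n \<alpha> x" "psi n \<alpha> x \<le> S" using s(1) x unfolding osc_def by blast+
    ultimately have psi: "\<bar>psi n \<alpha> x\<bar> \<le> C * lam ^ n" using s by linarith
    have "h n \<alpha> x * len n \<alpha> \<le> C2 / b n * b n" using h_upper[OF x] len_le[of n \<alpha>] len_pos[of n \<alpha>] C2_pos b_pos[of n]
      by (intro mult_mono) (auto intro: divide_nonneg_pos)
    then have hl: "h n \<alpha> x * len n \<alpha> \<le> C2" using b_pos[of n] by simp
    have hp: "0 \<le> h n \<alpha> x" "0 \<le> len n \<alpha>" using h_ge1[OF x] len_pos[of n \<alpha>] by auto
    have "\<bar>psi n \<alpha> x * h n \<alpha> x\<bar> * len n \<alpha> = \<bar>psi n \<alpha> x\<bar> * (h n \<alpha> x * len n \<alpha>)" using hp by (simp add: abs_mult)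
    also have "\<dots> \<le> (C * lam ^ n) * C2" using psi hl hp C by (intro mult_mono) auto
    finally show ?thesis by (simp add: ac_simps)
  qed
  moreover have "0 < C * C2" using C C2_pos by simp
  ultimately show ?thesis using C by blast
qed

end

section \<open>Zooms and the theorem\<close>

lemma abs_exp_minus_one_le:
  fixes u e :: real
  assumes "\<bar>u\<bar> \<le> e"
  shows "\<bar>exp u - 1\<bar> \<le> e * exp e"
proof -
  have e: "0 \<le> e" using assms by linarith
  have "exp u - 1 \<le> e * exp e"
  proof -
    have "exp u \<le> exp e" using assms by simp
    moreover have "exp e * (1 - e) \<le> exp e * exp (- e)"
      using exp_ge_add_one_self[of "- e"] by (intro mult_left_mono) auto
    moreover have "exp e * exp (- e) = 1" by (simp add: exp_minus)
    moreover have "exp e * (1 - e) = exp e - e * exp e" by (simp add: algebra_simps)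
    ultimately show ?thesis by linarith
  qed
  moreover have "1 - exp u \<le> e * exp e"
  proof -
    have "1 - exp u \<le> e" using exp_ge_add_one_self[of u] assms by linarith
    moreover have "e * 1 \<le> e * exp e" using e by (intro mult_left_mono) auto
    ultimately show ?thesis by linarith
  qed
  ultimately show ?thesis by linarith
qed

text \<open>The zoom multiplies the nonlinearity by the length of the interval, so e bounds the
  total variation of the log derivative. The derivative of the zoom is then exp of a number at most
  e in size, and each of the three terms of the distance is at most e exp e.\<close>

lemma zoom_near_identity:
  fixes g F \<phi> :: "real \<Rightarrow> real"
  assumes lr: "l < r"
    and g: "\<And>x. x \<in> {l..r} \<Longrightarrow> (g has_real_derivative exp (F x)) (at x within {l..r})"
    and F: "\<And>x. x \<in> {l..r} \<Longrightarrow> (F has_real_derivative \<phi> x) (at x within {l..r})"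
    and c: "continuous_on {l..r} \<phi>" and e: "\<And>x. x \<in> {l..r} \<Longrightarrow> \<bar>\<phi> x\<bar> * (r - l) \<le> e"
  shows "\<exists>Z1 Z2. (\<forall>t\<in>{0..1}. (zoom {l..r} g has_real_derivative Z1 t) (at t within {0..1}) \<and>
       (Z1 has_real_derivative Z2 t) (at t within {0..1})) \<and> continuous_on {0..1} Z2 \<and>
       dC2 (zoom {l..r} g) Z1 Z2 id (\<lambda>_. 1) (\<lambda>_. 0) \<le> 3 * (e * exp e)"
proof -
  define L where "L = r - l"
  have L: "0 < L" using lr by (simp add: L_def)
  have inc: "g x < g y" if xy: "l \<le> x" "x < y" "y \<le> r" for x y
  proof -
    obtain \<xi> where "g y - g x = exp (F \<xi>) * (y - x)" using MVT_within_sub[OF g xy] by blast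
    moreover have "0 < exp (F \<xi>) * (y - x)" using xy by simp
    ultimately show ?thesis by linarith
  qed
  \<comment> \<open>The affine normalization divides by the mean slope, which is exp (F
    \<open>\<xi>\<close>); this makes the zoomed derivative exp of a difference of values of
    F.\<close>
  obtain \<xi> where xi: "l < \<xi>" "\<xi> < r" "g r - g l = exp (F \<xi>) * (r - l)"
    using MVT_within[OF lr g] by blast
  define D where "D = g r - g l"
  have D: "D = exp (F \<xi>) * L" "0 < D" using xi inc[of l r] lr by (auto simp: D_def L_def)
  have le: "g x \<le> g y" if "l \<le> x" "x \<le> y" "y \<le> r" for x y using inc[of x y] that by (cases "x = y") auto
  have I: "Inf (g ` {l..r}) = g l" by (rule cInf_eq_minimum) (use lr le in auto)
  have S: "Sup (g ` {l..r}) = g r" by (rule cSup_eq_maximum) (use lr le in auto)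
  define a where "a t = l + t * L" for t
  have aI: "a t \<in> {l..r}" if "t \<in> {0..1}" for t
  proof -
    have "0 \<le> t * L" "t * L \<le> 1 * L" using that L by (auto intro!: mult_right_mono)
    then show ?thesis by (auto simp: a_def L_def)
  qed
  have Z: "zoom {l..r} g = (\<lambda>t. (g (a t) - g l) / D)"
    unfolding zoom_def I S D_def a_def L_def using lr by auto
  have ad: "(a has_real_derivative L) (at t within {0..1})" for t
    unfolding a_def by (auto intro!: derivative_eq_intros)
  have ch: "((\<lambda>t. q (a t)) has_real_derivative q' * L) (at t within {0..1})"
    if "t \<in> {0..1}" "(q has_real_derivative q') (at (a t) within {l..r})" for q q' t
  proof -
    have "(q has_real_derivative q') (at (a t) within a ` {0..1})"
      by (rule has_field_derivative_subset[OF that(2)]) (use aI in blast)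
    from DERIV_image_chain[OF this ad] show ?thesis by (simp add: o_def)
  qed
  define Z1 where "Z1 t = exp (F (a t)) * L / D" for t
  define Z2 where "Z2 t = exp (F (a t)) * (\<phi> (a t) * L) * L / D" for t
  have Zd: "(zoom {l..r} g has_real_derivative Z1 t) (at t within {0..1})" if t: "t \<in> {0..1}" for t
  proof -
    have "((\<lambda>t. (g (a t) - g l) / D) has_real_derivative (exp (F (a t)) * L - 0) / D) (at t within {0..1})"
      by (intro DERIV_cdivide DERIV_diff DERIV_const ch[OF t g[OF aI[OF t]]])
    then show ?thesis unfolding Z Z1_def by simp
  qed
  have Z1d: "(Z1 has_real_derivative Z2 t) (at t within {0..1})" if t: "t \<in> {0..1}" for t
  proof -
    have "((\<lambda>t. exp (F (a t))) has_real_derivative exp (F (a t)) * (\<phi> (a t) * L)) (at t within {0..1})"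
      using DERIV_chain2[OF DERIV_exp ch[OF t F[OF aI[OF t]]]] .
    then have "((\<lambda>t. exp (F (a t)) * L / D) has_real_derivative exp (F (a t)) * (\<phi> (a t) * L) * L / D) (at t within {0..1})"
      by (intro DERIV_cdivide DERIV_cmult_right)
    then show ?thesis unfolding Z1_def[abs_def] Z2_def .
  qed
  have ca: "continuous_on {0..1} a" unfolding a_def by (intro continuous_intros)
  have aS: "a ` {0..1} \<subseteq> {l..r}" using aI by blast
  have cF: "continuous_on {l..r} F" using F by (rule DERIV_continuous_on)
  have cZ2: "continuous_on {0..1} Z2"
    unfolding Z2_def using D continuous_on_compose2[OF cF ca aS] continuous_on_compose2[OF c ca aS]
    by (intro continuous_intros) auto
  have e0: "0 \<le> e" using e[of l] lr by (smt (verit) atLeastAtMost_iff mult_nonneg_nonneg)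
  have Fd: "\<bar>F x - F y\<bar> \<le> e" if x: "x \<in> {l..r}" and y: "y \<in> {l..r}" for x y
  proof -
    have "norm (F x - F y) \<le> (e / L) * norm (x - y)"
    proof (rule field_differentiable_bound[of "{l..r}" F \<phi>])
      fix z assume z: "z \<in> {l..r}"
      show "(F has_field_derivative \<phi> z) (at z within {l..r})" by (rule F[OF z])
      show "norm (\<phi> z) \<le> e / L" using e[OF z] L by (simp add: pos_le_divide_eq L_def)
    qed (use x y in auto)
    also have "\<dots> \<le> (e / L) * L" using x y L e0 by (intro mult_left_mono) (auto simp: L_def)
    finally show ?thesis using L by simp
  qed
  have Z1e: "Z1 t = exp (F (a t) - F \<xi>)" for t unfolding Z1_def D(1) using L by (simp add: exp_diff)
  have u: "\<bar>F (a t) - F \<xi>\<bar> \<le> e" if "t \<in> {0..1}" for t using Fd[OF aI[OF that], of \<xi>] xi by auto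
  have b1: "\<bar>Z1 t - 1\<bar> \<le> e * exp e" if "t \<in> {0..1}" for t
    unfolding Z1e by (rule abs_exp_minus_one_le[OF u[OF that]])
  have b2: "\<bar>Z2 t - 0\<bar> \<le> e * exp e" if t: "t \<in> {0..1}" for t
  proof -
    have z: "Z2 t = Z1 t * (\<phi> (a t) * L)" unfolding Z1_def Z2_def by simp
    have "\<bar>\<phi> (a t) * L\<bar> \<le> e" using e[OF aI[OF t]] L by (simp add: abs_mult L_def)
    moreover have "\<bar>Z1 t\<bar> \<le> exp e" unfolding Z1e using u[OF t] by simp
    ultimately have "\<bar>Z1 t\<bar> * \<bar>\<phi> (a t) * L\<bar> \<le> exp e * e" by (intro mult_mono) auto
    then show ?thesis unfolding z by (simp add: abs_mult mult.commute)
  qed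
  have b0: "\<bar>zoom {l..r} g t - id t\<bar> \<le> e * exp e" if t: "t \<in> {0..1}" for t
  proof -
    have d: "((\<lambda>t. zoom {l..r} g t - t) has_field_derivative Z1 s - 1) (at s within {0..1})" if "s \<in> {0..1}" for s
      using Zd[OF that] by (intro DERIV_diff DERIV_ident)
    have "norm ((zoom {l..r} g t - t) - (zoom {l..r} g 0 - 0)) \<le> (e * exp e) * norm (t - 0)"
      by (rule field_differentiable_bound[OF convex_real_interval(5) d]) (use b1 t in auto)
    moreover have "zoom {l..r} g 0 = 0" unfolding Z a_def by simp
    moreover have "(e * exp e) * norm (t - 0) \<le> (e * exp e) * 1" using t e0 by (intro mult_left_mono) auto
    ultimately show ?thesis by simp
  qed
  have "dC2 (zoom {l..r} g) Z1 Z2 id (\<lambda>_. 1) (\<lambda>_. 0) \<le> e * exp e + e * exp e + e * exp e"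
    unfolding dC2_def by (intro add_mono cSUP_least b0 b1 b2) auto
  then show ?thesis using Zd Z1d cZ2 by (intro exI[of _ Z1] exI[of _ Z2]) auto
qed

text \<open>In the interior of each interval the integrand is the derivative of F. The values of
  \<open>deriv\<close> at the endpoints are unspecified, but they affect only a finite set.\<close>

lemma (in rv_step) nonlin_integral_eq:
  assumes s: "smooth0 g F \<psi> K \<nu>"
  shows "nonlin_integral T = (\<Sum>\<alpha>\<in>UNIV. F \<alpha> (rgt T \<alpha>) - F \<alpha> (lft T \<alpha>))"
  unfolding nonlin_integral_def
proof (rule sum.cong[OF refl])
  fix \<alpha>
  let ?l = "lft T \<alpha>" and ?r = "rgt T \<alpha>"
  let ?q = "\<lambda>x. deriv (deriv f) x / deriv f x"
  have Fd: "(F \<alpha> has_real_derivative \<psi> \<alpha> x) (at x within {?l..?r})" if "x \<in> {?l..?r}" for x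
    using s that unfolding smooth0_def by blast
  have d1: "deriv f x = exp (F \<alpha> x)" if "?l < x" "x < ?r" for x
    by (rule DERIV_imp_deriv[OF deriv_interior[OF s that]])
  have q: "?q x = \<psi> \<alpha> x" if x: "?l < x" "x < ?r" for x
  proof -
    have "(F \<alpha> has_real_derivative \<psi> \<alpha> x) (at x within {?l<..<?r})"
      by (rule has_field_derivative_subset[OF Fd]) (use x in auto)
    then have "(F \<alpha> has_real_derivative \<psi> \<alpha> x) (at x)" using at_within_open[of x "{?l<..<?r}"] x by auto
    then have "((\<lambda>x. exp (F \<alpha> x)) has_real_derivative exp (F \<alpha> x) * \<psi> \<alpha> x) (at x)"
      using DERIV_chain2[OF DERIV_exp] by blast
    then have "(deriv f has_real_derivative exp (F \<alpha> x) * \<psi> \<alpha> x) (at x)"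
      by (rule has_field_derivative_transform_within_open[of _ _ _ "{?l<..<?r}"]) (use x d1 in auto)
    then have "deriv (deriv f) x = exp (F \<alpha> x) * \<psi> \<alpha> x" by (rule DERIV_imp_deriv)
    then show ?thesis using d1[OF x] by simp
  qed
  have "(\<psi> \<alpha> has_integral F \<alpha> ?r - F \<alpha> ?l) {?l..?r}"
    by (rule fundamental_theorem_of_calculus)
       (use lft_less[of \<alpha>] Fd in \<open>auto simp: has_real_derivative_iff_has_vector_derivative[symmetric]\<close>)
  then have "(?q has_integral F \<alpha> ?r - F \<alpha> ?l) {?l..?r}"
    by (rule has_integral_spike_finite[of "{?l, ?r}", rotated -1]) (use q in auto)
  moreover have "negligible {x \<in> {?l..?r} - {?l..<?r}. ?q x \<noteq> 0}"
    by (rule negligible_subset[OF negligible_sing[of ?r]]) auto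
  moreover have "negligible {x \<in> {?l..<?r} - {?l..?r}. ?q x \<noteq> 0}"
    by (rule negligible_subset[OF negligible_empty]) auto
  ultimately have "(?q has_integral F \<alpha> ?r - F \<alpha> ?l) {?l..<?r}"
    using has_integral_spike_set_eq[of "{?l..?r}" "{?l..<?r}" ?q] by simp
  then show "integral (gpart T \<alpha>) ?q = F \<alpha> ?r - F \<alpha> ?l" unfolding part by (rule integral_unique)
qed

text \<open>The branch is represented by an extension g because at the right end of the closed
  interval the map itself takes a value from another branch or lies outside its domain. Continuity
  on the closure makes the extension unique there.\<close>

theorem theorem3:
  fixes T :: "('a::finite) giem" and k :: nat and \<nu> :: real
  assumes "CARD('a) \<ge> 2"
    and "\<nu> > 0"
    and "in_B k \<nu> T"
    and "gdom T = {0..<1}"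
    and "nonlin_integral T = 0"
  shows "\<exists>C>0. \<exists>lam. 0 < lam \<and> lam < 1 \<and>
    (\<forall>n \<alpha>. \<exists>g Z1 Z2.
       (\<forall>x\<in>gpart (Rn n T) \<alpha>. g x = gmap (Rn n T) x) \<and>
       continuous_on (closure (gpart (Rn n T) \<alpha>)) g \<and>
       (\<forall>t\<in>{0..1}.
          (zoom (closure (gpart (Rn n T) \<alpha>)) g has_real_derivative Z1 t) (at t within {0..1}) \<and>
          (Z1 has_real_derivative Z2 t) (at t within {0..1})) \<and>
       continuous_on {0..1} Z2 \<and>
       dC2 (zoom (closure (gpart (Rn n T) \<alpha>)) g) Z1 Z2 id (\<lambda>_. 1) (\<lambda>_. 0)
         \<le> C * lam powr sqrt (real n))"
proof -
  have B: "is_giem T" "irreducible_comb T" "C2nu_branches \<nu> T" "k_bounded k T" "genus_one T"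
    using assms(3) by (auto simp: in_B_def)
  interpret R: rvseq T k by unfold_locales (use B assms in auto)
  have st: "rv_step T 1" using R.step[of 0] R.b_0 R.Rn_0 by simp
  then interpret S: rv_step T 1 .
  obtain g F \<psi> K where sm: "S.smooth0 g F \<psi> K (min \<nu> 1)"
    using S.smooth0_ex[OF B(3) assms(2)] by auto
  obtain V u a c g0 g1 where "coarse V (gmap T) 1 u a c g0 g1"
    using S.coarse_initial[OF sm B(5)] by blast
  then have "coarse V (gmap (Rn 0 T)) (R.b 0) u a c g0 g1" using R.b_0 R.Rn_0 by simp
  from R.slopes_bounded[OF this] obtain Ks where
    Ks: "\<And>n \<alpha> x y. lft (Rn n T) \<alpha> \<le> x \<Longrightarrow> x < y \<Longrightarrow> y < rgt (Rn n T) \<alpha> \<Longrightarrow> \<bar>sl (gmap (Rn n T)) x y\<bar> \<le> Ks"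
    by blast
  interpret N: rvsmooth T k g F \<psi> K "min \<nu> 1" Ks
    by unfold_locales (use sm Ks assms in auto)
  have "(\<Sum>\<alpha>\<in>UNIV. F \<alpha> (rgt (Rn 0 T) \<alpha>) - F \<alpha> (lft (Rn 0 T) \<alpha>)) = 0"
    using S.nonlin_integral_eq[OF sm] assms(5) R.Rn_0 by simp
  from N.psi_exponential[OF this] obtain C lam where C: "0 < C" "0 < lam" "lam < 1" and
    ex: "\<And>n \<alpha> x. x \<in> {lft (Rn n T) \<alpha>..rgt (Rn n T) \<alpha>} \<Longrightarrow> \<bar>N.psi n \<alpha> x * N.h n \<alpha> x\<bar> * N.len n \<alpha> \<le> C * lam ^ n"
    by blast
  \<comment> \<open>The factor exp of the decaying term is at most exp C, and the geometric rate
    obtained is weakened to the stated one by sqrt n at most n.\<close>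
  have bound: "3 * ((C * lam ^ n) * exp (C * lam ^ n)) \<le> 3 * C * exp C * lam powr sqrt (real n)" for n
  proof -
    have l1: "lam ^ n \<le> 1" using C by (simp add: power_le_one)
    have "C * lam ^ n \<le> C * 1" using l1 C by (intro mult_left_mono) auto
    then have "exp (C * lam ^ n) \<le> exp C" by simp
    then have "(C * lam ^ n) * exp (C * lam ^ n) \<le> (C * lam ^ n) * exp C" using C by (intro mult_left_mono) auto
    moreover have "lam ^ n \<le> lam powr sqrt (real n)"
    proof -
      have "sqrt (real n) \<le> real n"
      proof (cases "n = 0")
        case False
        then have "real n * 1 \<le> real n * real n" by (intro mult_left_mono) auto
        then show ?thesis by (intro real_le_lsqrt) (auto simp: power2_eq_square)
      qed auto
      then have "lam powr real n \<le> lam powr sqrt (real n)" using C by (intro powr_mono') auto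
      then show ?thesis using C by (simp add: powr_realpow)
    qed
    then have "C * exp C * lam ^ n \<le> C * exp C * lam powr sqrt (real n)" using C by (intro mult_left_mono) auto
    ultimately show ?thesis by (simp add: ac_simps)
  qed
  show ?thesis
  proof (intro exI[of _ "3 * C * exp C"] conjI[OF _ exI[of _ lam]] conjI allI)
    show "0 < 3 * C * exp C" using C by simp
    show "0 < lam" "lam < 1" using C by auto
    fix n \<alpha>
    let ?l = "lft (Rn n T) \<alpha>" and ?r = "rgt (Rn n T) \<alpha>"
    interpret P: rv_step "Rn n T" "R.b n" by (rule R.step)
    have cl: "closure (gpart (Rn n T) \<alpha>) = {?l..?r}" unfolding P.part using P.lft_less[of \<alpha>] by simp
    have gd: "\<And>x. x \<in> {?l..?r} \<Longrightarrow> (N.G n \<alpha> has_real_derivative exp (N.F n \<alpha> x)) (at x within {?l..?r})"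
      by (rule N.G_deriv)
    have "\<exists>Z1 Z2. (\<forall>t\<in>{0..1}. (zoom {?l..?r} (N.G n \<alpha>) has_real_derivative Z1 t) (at t within {0..1}) \<and>
       (Z1 has_real_derivative Z2 t) (at t within {0..1})) \<and> continuous_on {0..1} Z2 \<and>
       dC2 (zoom {?l..?r} (N.G n \<alpha>)) Z1 Z2 id (\<lambda>_. 1) (\<lambda>_. 0) \<le> 3 * ((C * lam ^ n) * exp (C * lam ^ n))"
    proof (rule zoom_near_identity[where F = "N.F n \<alpha>" and \<phi> = "\<lambda>x. N.psi n \<alpha> x * N.h n \<alpha> x"])
      show "?l < ?r" by (rule P.lft_less)
      show "(N.G n \<alpha> has_real_derivative exp (N.F n \<alpha> x)) (at x within {?l..?r})"
        "(N.F n \<alpha> has_real_derivative N.psi n \<alpha> x * N.h n \<alpha> x) (at x within {?l..?r})" if "x \<in> {?l..?r}" for x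
        using N.G_deriv[OF that] N.F_deriv[OF that] .
      show "continuous_on {?l..?r} (\<lambda>x. N.psi n \<alpha> x * N.h n \<alpha> x)"
        by (intro continuous_intros N.psi_cont N.h_cont)
      show "\<bar>N.psi n \<alpha> x * N.h n \<alpha> x\<bar> * (?r - ?l) \<le> C * lam ^ n" if "x \<in> {?l..?r}" for x
        using ex[OF that] unfolding N.len_def .
    qed
    then obtain Z1 Z2 where Z: "\<forall>t\<in>{0..1}. (zoom {?l..?r} (N.G n \<alpha>) has_real_derivative Z1 t) (at t within {0..1}) \<and>
       (Z1 has_real_derivative Z2 t) (at t within {0..1})" "continuous_on {0..1} Z2"
       "dC2 (zoom {?l..?r} (N.G n \<alpha>)) Z1 Z2 id (\<lambda>_. 1) (\<lambda>_. 0) \<le> 3 * ((C * lam ^ n) * exp (C * lam ^ n))" by blast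
    have "\<forall>x\<in>gpart (Rn n T) \<alpha>. N.G n \<alpha> x = gmap (Rn n T) x" unfolding P.part using N.G_f by auto
    moreover have "continuous_on {?l..?r} (N.G n \<alpha>)" using gd by (rule DERIV_continuous_on)
    moreover have "dC2 (zoom {?l..?r} (N.G n \<alpha>)) Z1 Z2 id (\<lambda>_. 1) (\<lambda>_. 0) \<le> 3 * C * exp C * lam powr sqrt (real n)"
      using Z(3) bound[of n] by linarith
    ultimately show "\<exists>g Z1 Z2.
       (\<forall>x\<in>gpart (Rn n T) \<alpha>. g x = gmap (Rn n T) x) \<and>
       continuous_on (closure (gpart (Rn n T) \<alpha>)) g \<and>
       (\<forall>t\<in>{0..1}.
          (zoom (closure (gpart (Rn n T) \<alpha>)) g has_real_derivative Z1 t) (at t within {0..1}) \<and>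
          (Z1 has_real_derivative Z2 t) (at t within {0..1})) \<and>
       continuous_on {0..1} Z2 \<and>
       dC2 (zoom (closure (gpart (Rn n T) \<alpha>)) g) Z1 Z2 id (\<lambda>_. 1) (\<lambda>_. 0)
         \<le> 3 * C * exp C * lam powr sqrt (real n)"
      unfolding cl using Z(1,2) by (intro exI[of _ "N.G n \<alpha>"] exI[of _ Z1] exI[of _ Z2]) blast
  qed
qed

end
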